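(* Let $\Omega\subset\mathbb{R}^2$ be a capillary ring domain with capillarity constants $b_1,b_2\ne0$, let $g:\mathcal{U}\to\overline\Omega$ be its developing map and $\omega=\log|g'|$. For any $n\ge0$ let $h_n:\mathcal{U}\to\mathbb{R}$ be the harmonic function $h_n:=\mathrm{Im}\,Q_n[\omega_z]$, where $\{Q_n\}_{n\in\mathbb{N}}$ are the recursive mKdV operators. Then every $h_n$ is a conformal Jacobi field for $\Omega$. As a consequence, there exist $\mathfrak{m}\in\mathbb{N}$ (possibly $0$) and constants $c_0,\dots,c_{\mathfrak{m}-1}\in\mathbb{R}$ such that $$h_{\mathfrak{m}}=\sum_{j=0}^{\mathfrak{m}-1}c_jh_j$$ (for $\mathfrak{m}=0$ this means $h_0=0$). Moreover, if such a relation holds for some $\mathfrak{m}$, then for any $k\ge0$ the harmonic function $h_{\mathfrak{m}+k}$ is also a linear combination of $h_0,\dots,h_{\mathfrak{m}-1}$.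
   Context: $\mathbb{R}^2\equiv\mathbb{C}$, $z=x+iy$, $\partial_z=\frac12(\partial_x-i\partial_y)$. A ring domain is a smooth doubly connected domain $\Omega\subset\mathbb{R}^2$ bounded by two Jordan curves $\gamma_1,\gamma_2$. A curve $\gamma$ is capillary for $u$ if there is a polynomial $P=a+d_1x_1+d_2x_2-\frac c2(x_1^2+x_2^2)$ with real coefficients such that $u=P$ and $\|\nabla(u-P)\|$ is constant along $\gamma$. $\Omega$ is a capillary ring domain if there is a solution $u$ of $\Delta u+2=0$ in $\Omega$ for which both $\gamma_1,\gamma_2$ are capillary curves. Developing map: a holomorphic bijection $g:\mathcal{U}\to\overline\Omega$ from a quotient band $\mathcal{U}=([s_1,s_2]\times\mathbb{R},\sim)$, $(x,y)\sim(x,y+T)$, sending $\{x=s_j\}$ to $\gamma_j$. With $v=u\circ g$, $\omega=\log|g'|$, $\sigma=-|g|^2/2$, the Hopf differential $\mathfrak{q}=v_{zz}-2\omega_zv_z$ is a real constant, and capillarity of $\gamma_j$ means that there are real constants $a_j,b_j,c_j,d_{1,j},d_{2,j}$ such that, along $x=s_j$, $v=a_j+c_j\sigma+L_j$ and $v_x=b_je^{\omega}+c_j\sigma_x+(L_j)_x$, where $L_j=d_{1,j}\mathrm{Re}\,g+d_{2,j}\mathrm{Im}\,g$. The number $b_j$ is the capillarity constant of $\gamma_j$. When $b_j\ne0$ put $\alpha_j=\frac{4\mathfrak{q}}{b_j}$, $\beta_j=\frac{2(1-c_j)}{b_j}$; then $2\omega_x=-\alpha_je^{-\omega}-\beta_je^{\omega}$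 along $x=s_j$. A conformal Jacobi field on $\Omega$ is a function $\xi$ on $\mathcal{U}$ with $\Delta\xi=0$ in $\mathcal{U}$ and $\frac{\partial\xi}{\partial x}=\frac12(\alpha_je^{-\omega}-\beta_je^{\omega})\xi$ along $\{x=s_j\}$, $j=1,2$. mKdV operators: for a holomorphic function $\eta(z)$, $Q_n[\eta]$ is determined recursively by $Q_{-1}[\eta]=0$, $Q_0[\eta]=\eta$ and $Q_{n+1}'-\frac{\eta'}{\eta}Q_{n+1}=Q_n'''-\frac{\eta'}{\eta}Q_n''-4\eta^2Q_n'$ (derivatives in $z$), where the free additive term $k_{n+1}\eta$ in the solution is always chosen to be zero; thus $Q_n[\eta]$ is a polynomial in $\eta,\dots,\eta^{(2n)}$, homogeneous of weight $2n+1$ when $\eta^{(k)}$ has weight $k+1$. E.g. $Q_1[\eta]=\eta''-2\eta^3$. *)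

theory Defs
  imports "HOL-Analysis.Analysis" "HOL-Complex_Analysis.Complex_Analysis"
    "HOL-Library.Poly_Mapping"
begin

subsection \<open>Partial derivatives up to the boundary\<close>

text \<open>
  The plane is identified with \<^typ>\<open>complex\<close>.  All derivatives are taken within a set \<open>S\<close>, so that they
  make sense at boundary points too: \<open>S\<close> is an open set, a closed band or the closure of a domain
  with smooth boundary, and on such sets the derivative within \<open>S\<close> is unique.
\<close>

definition pdx :: "complex set \<Rightarrow> (complex \<Rightarrow> 'b::real_normed_vector) \<Rightarrow> complex \<Rightarrow> 'b" where
  "pdx S f z = frechet_derivative f (at z within S) 1"

definition pdy :: "complex set \<Rightarrow> (complex \<Rightarrow> 'b::real_normed_vector) \<Rightarrow> complex \<Rightarrow> 'b" where
  "pdy S f z = frechet_derivative f (at z within S) \<i>"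

primrec Ck_on :: "nat \<Rightarrow> complex set \<Rightarrow> (complex \<Rightarrow> 'b::real_normed_vector) \<Rightarrow> bool" where
  "Ck_on 0 S f = continuous_on S f"
| "Ck_on (Suc k) S f = (f differentiable_on S \<and> Ck_on k S (pdx S f) \<and> Ck_on k S (pdy S f))"

definition smooth_on :: "complex set \<Rightarrow> (complex \<Rightarrow> 'b::real_normed_vector) \<Rightarrow> bool" where
  "smooth_on S f \<longleftrightarrow> (\<forall>k. Ck_on k S f)"

definition laplacian :: "complex set \<Rightarrow> (complex \<Rightarrow> real) \<Rightarrow> complex \<Rightarrow> real" where
  "laplacian S f z = pdx S (pdx S f) z + pdy S (pdy S f) z"

definition grad :: "complex set \<Rightarrow> (complex \<Rightarrow> real) \<Rightarrow> complex \<Rightarrow> complex" where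
  "grad S f z = Complex (pdx S f z) (pdy S f z)"

text \<open>The Wirtinger derivative \<open>\<partial>\<^sub>z\<close>; for holomorphic functions it is the complex derivative.\<close>

definition dz :: "complex set \<Rightarrow> (complex \<Rightarrow> complex) \<Rightarrow> complex \<Rightarrow> complex" where
  "dz S f z = (pdx S f z - \<i> * pdy S f z) / 2"

subsection \<open>Capillary ring domains\<close>

text \<open>A C-infinity Jordan curve, as a point set; \<open>D k\<close> is the \<open>k\<close>-th derivative of the regular
  1-periodic parametrization \<open>D 0\<close>.\<close>

definition smooth_jordan_curve :: "complex set \<Rightarrow> bool" where
  "smooth_jordan_curve C \<longleftrightarrow> (\<exists>D :: nat \<Rightarrow> real \<Rightarrow> complex.
     (\<forall>k t. (D k has_vector_derivative D (Suc k) t) (at t)) \<and>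
     (\<forall>t. D 0 (t + 1) = D 0 t) \<and> (\<forall>t. D 1 t \<noteq> 0) \<and>
     simple_path (D 0) \<and> C = path_image (D 0))"

text \<open>For a bounded domain, double connectedness means that the complement in the plane has exactly
  two components.\<close>

definition ring_domain :: "complex set \<Rightarrow> complex set \<Rightarrow> complex set \<Rightarrow> bool" where
  "ring_domain \<Omega> \<gamma>\<^sub>1 \<gamma>\<^sub>2 \<longleftrightarrow>
     open \<Omega> \<and> connected \<Omega> \<and> bounded \<Omega> \<and> \<Omega> \<noteq> {} \<and> card (components (- \<Omega>)) = 2 \<and>
     smooth_jordan_curve \<gamma>\<^sub>1 \<and> smooth_jordan_curve \<gamma>\<^sub>2 \<and> \<gamma>\<^sub>1 \<inter> \<gamma>\<^sub>2 = {} \<and>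
     frontier \<Omega> = \<gamma>\<^sub>1 \<union> \<gamma>\<^sub>2"

definition capillary_poly :: "real \<Rightarrow> real \<Rightarrow> real \<Rightarrow> real \<Rightarrow> complex \<Rightarrow> real" where
  "capillary_poly a c d\<^sub>1 d\<^sub>2 p =
     a + d\<^sub>1 * Re p + d\<^sub>2 * Im p - c / 2 * ((Re p)\<^sup>2 + (Im p)\<^sup>2)"

definition capillary_curve :: "complex set \<Rightarrow> (complex \<Rightarrow> real) \<Rightarrow> complex set \<Rightarrow> bool" where
  "capillary_curve \<Omega> u \<gamma> \<longleftrightarrow> (\<exists>a c d\<^sub>1 d\<^sub>2.
     (\<forall>p\<in>\<gamma>. u p = capillary_poly a c d\<^sub>1 d\<^sub>2 p) \<and>
     (\<exists>r. \<forall>p\<in>\<gamma>. norm (grad (closure \<Omega>) (\<lambda>x. u x - capillary_poly a c d\<^sub>1 d\<^sub>2 x) p) = r))"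

text \<open>\<open>u\<close> is a classical solution, continuously differentiable up to the boundary.\<close>

definition capillary_solution ::
  "complex set \<Rightarrow> complex set \<Rightarrow> complex set \<Rightarrow> (complex \<Rightarrow> real) \<Rightarrow> bool" where
  "capillary_solution \<Omega> \<gamma>\<^sub>1 \<gamma>\<^sub>2 u \<longleftrightarrow>
     Ck_on 2 \<Omega> u \<and> Ck_on 1 (closure \<Omega>) u \<and> (\<forall>p\<in>\<Omega>. laplacian \<Omega> u p + 2 = 0) \<and>
     capillary_curve \<Omega> u \<gamma>\<^sub>1 \<and> capillary_curve \<Omega> u \<gamma>\<^sub>2"

definition capillary_ring_domain :: "complex set \<Rightarrow> complex set \<Rightarrow> complex set \<Rightarrow> bool" where
  "capillary_ring_domain \<Omega> \<gamma>\<^sub>1 \<gamma>\<^sub>2 \<longleftrightarrow>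
     ring_domain \<Omega> \<gamma>\<^sub>1 \<gamma>\<^sub>2 \<and> (\<exists>u. capillary_solution \<Omega> \<gamma>\<^sub>1 \<gamma>\<^sub>2 u)"

subsection \<open>Developing map\<close>

definition band :: "real \<Rightarrow> real \<Rightarrow> complex set" where
  "band s\<^sub>1 s\<^sub>2 = {z. s\<^sub>1 \<le> Re z \<and> Re z \<le> s\<^sub>2}"

definition vline :: "real \<Rightarrow> complex set" where
  "vline s = {z. Re z = s}"

text \<open>Functions on the quotient band are functions on the band that are periodic on it.\<close>

definition band_periodic :: "real \<Rightarrow> real \<Rightarrow> real \<Rightarrow> (complex \<Rightarrow> 'b) \<Rightarrow> bool" where
  "band_periodic s\<^sub>1 s\<^sub>2 T f \<longleftrightarrow> (\<forall>z\<in>band s\<^sub>1 s\<^sub>2. f (z + \<i> * of_real T) = f z)"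

text \<open>Holomorphic on the closed band is understood one-sidedly at the boundary lines (derivatives within
  the band); \<open>g\<close> is not assumed to extend holomorphically across them.\<close>

definition developing_map ::
  "complex set \<Rightarrow> complex set \<Rightarrow> complex set \<Rightarrow> real \<Rightarrow> real \<Rightarrow> real \<Rightarrow> (complex \<Rightarrow> complex) \<Rightarrow> bool" where
  "developing_map \<Omega> \<gamma>\<^sub>1 \<gamma>\<^sub>2 s\<^sub>1 s\<^sub>2 T g \<longleftrightarrow>
     s\<^sub>1 < s\<^sub>2 \<and> 0 < T \<and>
     smooth_on (band s\<^sub>1 s\<^sub>2) g \<and> g holomorphic_on band s\<^sub>1 s\<^sub>2 \<and>
     (\<forall>z\<in>band s\<^sub>1 s\<^sub>2. dz (band s\<^sub>1 s\<^sub>2) g z \<noteq> 0) \<and>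
     band_periodic s\<^sub>1 s\<^sub>2 T g \<and>
     bij_betw g {z \<in> band s\<^sub>1 s\<^sub>2. 0 \<le> Im z \<and> Im z < T} (closure \<Omega>) \<and>
     g ` vline s\<^sub>1 = \<gamma>\<^sub>1 \<and> g ` vline s\<^sub>2 = \<gamma>\<^sub>2"

definition log_factor :: "complex set \<Rightarrow> (complex \<Rightarrow> complex) \<Rightarrow> complex \<Rightarrow> real" where
  "log_factor S g z = ln (norm (dz S g z))"

definition log_factor_z :: "complex set \<Rightarrow> (complex \<Rightarrow> complex) \<Rightarrow> complex \<Rightarrow> complex" where
  "log_factor_z S g = dz S (\<lambda>z. of_real (log_factor S g z))"

definition hopf_differential ::
  "complex set \<Rightarrow> (complex \<Rightarrow> real) \<Rightarrow> (complex \<Rightarrow> complex) \<Rightarrow> complex \<Rightarrow> complex" where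
  "hopf_differential S u g z =
     (let v = (\<lambda>z. of_real (u (g z)))
      in dz S (dz S v) z - 2 * log_factor_z S g z * dz S v z)"

text \<open>The real number to which the Hopf differential reduces.  It is evaluated only in the open band,
  as \<open>u\<close> is not assumed to have second derivatives at the boundary.\<close>

definition hopf_constant ::
  "real \<Rightarrow> real \<Rightarrow> (complex \<Rightarrow> real) \<Rightarrow> (complex \<Rightarrow> complex) \<Rightarrow> real" where
  "hopf_constant s\<^sub>1 s\<^sub>2 u g =
     (THE q. \<forall>z. s\<^sub>1 < Re z \<and> Re z < s\<^sub>2 \<longrightarrow> hopf_differential (band s\<^sub>1 s\<^sub>2) u g z = of_real q)"

text \<open>The capillarity condition along the line \<open>x = s\<close>, in terms of \<open>u \<circ> g\<close>.  The number \<open>b\<close> is the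
  capillarity constant, whose sign is fixed by the normal direction \<open>\<partial>\<^sub>x\<close>.\<close>

definition capillarity_constants ::
  "complex set \<Rightarrow> (complex \<Rightarrow> real) \<Rightarrow> (complex \<Rightarrow> complex) \<Rightarrow> real \<Rightarrow>
   real \<Rightarrow> real \<Rightarrow> real \<Rightarrow> real \<Rightarrow> real \<Rightarrow> bool" where
  "capillarity_constants S u g s a b c d\<^sub>1 d\<^sub>2 \<longleftrightarrow>
     (let v = (\<lambda>z. u (g z));
          \<omega> = log_factor S g;
          \<sigma> = (\<lambda>z. - (norm (g z))\<^sup>2 / 2);
          L = (\<lambda>z. d\<^sub>1 * Re (g z) + d\<^sub>2 * Im (g z))
      in \<forall>z\<in>vline s.
           v z = a + c * \<sigma> z + L z \<and>
           pdx S v z = b * exp (\<omega> z) + c * pdx S \<sigma> z + pdx S L z)"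

definition robin_condition ::
  "complex set \<Rightarrow> (complex \<Rightarrow> complex) \<Rightarrow> real \<Rightarrow> real \<Rightarrow> real \<Rightarrow> (complex \<Rightarrow> real) \<Rightarrow> bool" where
  "robin_condition S g s \<alpha> \<beta> \<xi> \<longleftrightarrow>
     (\<forall>z\<in>vline s. pdx S \<xi> z =
        1 / 2 * (\<alpha> * exp (- log_factor S g z) - \<beta> * exp (log_factor S g z)) * \<xi> z)"

definition conformal_jacobi_field ::
  "real \<Rightarrow> real \<Rightarrow> real \<Rightarrow> (complex \<Rightarrow> complex) \<Rightarrow> real \<Rightarrow> real \<Rightarrow> real \<Rightarrow> real \<Rightarrow>
   (complex \<Rightarrow> real) \<Rightarrow> bool" where
  "conformal_jacobi_field s\<^sub>1 s\<^sub>2 T g \<alpha>\<^sub>1 \<beta>\<^sub>1 \<alpha>\<^sub>2 \<beta>\<^sub>2 \<xi> \<longleftrightarrow>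
     band_periodic s\<^sub>1 s\<^sub>2 T \<xi> \<and>
     Ck_on 2 (band s\<^sub>1 s\<^sub>2) \<xi> \<and> (\<forall>z\<in>band s\<^sub>1 s\<^sub>2. laplacian (band s\<^sub>1 s\<^sub>2) \<xi> z = 0) \<and>
     robin_condition (band s\<^sub>1 s\<^sub>2) g s\<^sub>1 \<alpha>\<^sub>1 \<beta>\<^sub>1 \<xi> \<and>
     robin_condition (band s\<^sub>1 s\<^sub>2) g s\<^sub>2 \<alpha>\<^sub>2 \<beta>\<^sub>2 \<xi>"

subsection \<open>The mKdV operators\<close>

text \<open>
  Differential polynomials in one function \<open>\<eta>\<close>: real polynomials in the variables \<open>jet k\<close>, which stand
  for the \<open>k\<close>-th derivative of \<open>\<eta>\<close>; a monomial maps \<open>k\<close> to the exponent of \<open>jet k\<close>.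
\<close>

type_synonym diffpoly = "(nat \<Rightarrow>\<^sub>0 nat) \<Rightarrow>\<^sub>0 real"

definition jet :: "nat \<Rightarrow> diffpoly" where
  "jet k = Poly_Mapping.single (Poly_Mapping.single k 1) 1"

text \<open>The derivation sending \<open>jet k\<close> to \<open>jet (Suc k)\<close>.\<close>

definition total_deriv :: "diffpoly \<Rightarrow> diffpoly" where
  "total_deriv p = (\<Sum>m\<in>Poly_Mapping.keys p. \<Sum>i\<in>Poly_Mapping.keys m.
     Poly_Mapping.single (m - Poly_Mapping.single i 1 + Poly_Mapping.single (Suc i) 1)
       (Poly_Mapping.lookup p m * real (Poly_Mapping.lookup m i)))"

text \<open>
  The recursion is multiplied by \<open>\<eta>\<close> to clear the denominator.  Two solutions differ by a constant
  multiple of \<open>\<eta>\<close>, and the last conjunct chooses the one without a term in \<open>\<eta>\<close>.  The step from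
  \<open>Q\<^bsub>-1\<^esub> = 0\<close> to \<open>Q\<^bsub>0\<^esub> = \<eta>\<close> is the base case.
\<close>

primrec mkdv :: "nat \<Rightarrow> diffpoly" where
  "mkdv 0 = jet 0"
| "mkdv (Suc n) = (THE R.
     jet 0 * total_deriv R - jet 1 * R =
       jet 0 * total_deriv (total_deriv (total_deriv (mkdv n)))
       - jet 1 * total_deriv (total_deriv (mkdv n))
       - 4 * jet 0 ^ 3 * total_deriv (mkdv n) \<and>
     Poly_Mapping.lookup R (Poly_Mapping.single 0 1) = 0)"

definition diffpoly_eval :: "diffpoly \<Rightarrow> (nat \<Rightarrow> complex) \<Rightarrow> complex" where
  "diffpoly_eval p x = (\<Sum>m\<in>Poly_Mapping.keys p.
     of_real (Poly_Mapping.lookup p m) *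
     (\<Prod>i\<in>Poly_Mapping.keys m. x i ^ Poly_Mapping.lookup m i))"

definition mkdv_op :: "complex set \<Rightarrow> nat \<Rightarrow> (complex \<Rightarrow> complex) \<Rightarrow> complex \<Rightarrow> complex" where
  "mkdv_op S n \<eta> z = diffpoly_eval (mkdv n) (\<lambda>k. (dz S ^^ k) \<eta> z)"

end

theory Submission
  imports Defs
begin

text \<open>
  Write \<open>\<eta> = \<omega>\<^sub>z\<close>.  The recursion integrates explicitly: \<open>Q\<^bsub>n+1\<^esub> = Q\<^bsub>n\<^esub>'' - 4 \<eta> B\<^bsub>n\<^esub>\<close> with
  \<open>B\<^bsub>n\<^esub>' = \<eta> Q\<^bsub>n\<^esub>'\<close>, where \<open>B\<^bsub>n\<^esub>\<close> is the differential polynomial given by the quadratic relation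
  \<open>(1 - 4 t B)\<^sup>2 = 1 - 4 t Q\<^sup>2 + 4 t\<^sup>2 Q'\<^sup>2\<close> between the generating series.

  \<open>F = v\<^sub>z - \<sigma>\<^sub>z\<close> is holomorphic and the Hopf differential is \<open>F' - 2 \<eta> F\<close>.  It has a primitive that is
  continuous up to the boundary, and whose real part is constant on each boundary line by the
  capillarity conditions; by the maximum principle this real part is affine in \<open>x\<close>, so that the Hopf
  differential is a real constant and the stated equation for \<open>\<omega>\<^sub>x\<close> holds on the lines.  No regularity
  of \<open>u\<close> beyond \<open>C\<^sup>1\<close> is needed at the boundary.

  On a boundary line the equation for \<open>\<omega>\<^sub>x\<close> propagates the Robin condition along the recursion, together
  with \<open>Im B\<^bsub>n\<^esub> = Re \<eta> \<cdot> Im Q\<^bsub>n\<^esub>\<close>.  The quadratic relation is what excludes an integration constant in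
  the latter identity.

  Finite dimension: if \<open>M\<close> is the maximum of \<open>|h|\<close>, the Robin condition and the maximum principle bound
  \<open>|h\<^sub>x|\<close> by a multiple of \<open>M\<close>, and with interior gradient estimates \<open>h\<close> varies by at most \<open>M/2\<close> on short
  boundary arcs.  Hence a Jacobi field that vanishes on a fine enough finite set of boundary points
  is zero.
\<close>

section \<open>Differential polynomials\<close>

text \<open>The quadratic relation is an energy integral. For the generating series Q and B in t the
  recursion reads Q = \<eta> + t (Q'' - 4 \<eta> B) with B' = \<eta> Q'. Hence (Q^2 - t Q'^2)' = 2
  Q' (Q - t Q'') = 2 \<eta> Q' (1 - 4 t B) = (2 B - 4 t B^2)', and integration gives the relation.
  Taking its coefficients as the definition of the primitives avoids integration: for differential
  polynomials it is not evident that \<eta> times the derivative of \<open>mkdv n\<close> is a total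
  derivative, and without this the definite description in \<open>mkdv\<close> is not known to
  denote anything. On a boundary line the same relation is used pointwise. Differentiating Im B - Re
  \<eta> Im Q along the line gives zero by the Robin conditions for \<eta> and Q, which leaves a
  constant of integration, and a nonzero one would in general break the Robin condition for the next
  Q. Imaginary parts in the quadratic relation show that it vanishes.\<close>

definition mon_eval :: "(nat \<Rightarrow> complex) \<Rightarrow> (nat \<Rightarrow>\<^sub>0 nat) \<Rightarrow> complex" where
  "mon_eval x m = (\<Prod>i\<in>Poly_Mapping.keys m. x i ^ Poly_Mapping.lookup m i)"

definition mon_deriv :: "(nat \<Rightarrow>\<^sub>0 nat) \<Rightarrow> diffpoly" where
  "mon_deriv m = (\<Sum>i\<in>Poly_Mapping.keys m.
     Poly_Mapping.single (m - Poly_Mapping.single i 1 + Poly_Mapping.single (Suc i) 1)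
       (real (Poly_Mapping.lookup m i)))"

lemma poly_mapping_sum_singles:
  "(p :: 'a \<Rightarrow>\<^sub>0 'b::comm_monoid_add) = (\<Sum>k\<in>Poly_Mapping.keys p. Poly_Mapping.single k (Poly_Mapping.lookup p k))"
proof (rule poly_mapping_eqI)
  fix k
  have "Poly_Mapping.lookup (\<Sum>k\<in>Poly_Mapping.keys p. Poly_Mapping.single k (Poly_Mapping.lookup p k)) k
      = (\<Sum>j\<in>Poly_Mapping.keys p. if j = k then Poly_Mapping.lookup p j else 0)"
    by (simp add: lookup_sum lookup_single when_def)
  also have "\<dots> = Poly_Mapping.lookup p k"
    by (simp add: in_keys_iff)
  finally show "Poly_Mapping.lookup p k = Poly_Mapping.lookup (\<Sum>k\<in>Poly_Mapping.keys p. Poly_Mapping.single k (Poly_Mapping.lookup p k)) k" ..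
qed

lemma single_sum:
  "finite A \<Longrightarrow> Poly_Mapping.single (\<Sum>i\<in>A. f i) (1::'b::comm_semiring_1)
     = (\<Prod>i\<in>A. Poly_Mapping.single (f i :: 'a::comm_monoid_add) 1)"
proof (induction A rule: finite_induct)
  case (insert a A)
  then show ?case by (simp add: mult_single[where a = "1::'b" and b = "1::'b", simplified, symmetric])
qed (simp)

lemma jet_power: "jet i ^ k = Poly_Mapping.single (Poly_Mapping.single i k) 1"
  by (induction k) (simp_all add: jet_def mult_single single_add[symmetric])

lemma diffpoly_add_induct:
  assumes "\<And>m c. P (Poly_Mapping.single m c)" and "\<And>p q. P p \<Longrightarrow> P q \<Longrightarrow> P (p + q)"
  shows "P (p :: diffpoly)"
proof -
  have sum: "P (\<Sum>m\<in>A. Poly_Mapping.single m (f m))" if "finite A" for A f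
    using that
  proof (induction A rule: finite_induct)
    case empty
    show ?case using assms(1)[of _ 0] by simp
  qed (auto intro: assms)
  show ?thesis by (subst poly_mapping_sum_singles) (rule sum[OF finite_keys])
qed

text \<open>Constants and jets generate the ring, so a property stable under sums and products, such
  as the derivative formula \<open>deriv_ev\<close>, need only be checked on generators.\<close>

lemma diffpoly_induct [case_names const jet add mult]:
  assumes const: "\<And>c. P (Poly_Mapping.single 0 c)" and jet: "\<And>i. P (jet i)"
    and add: "\<And>p q. P p \<Longrightarrow> P q \<Longrightarrow> P (p + q)" and mult: "\<And>p q. P p \<Longrightarrow> P q \<Longrightarrow> P (p * q)"
  shows "P (p :: diffpoly)"
proof -
  have one: "P 1" using const[of 1] by simp
  have pow: "P (jet i ^ k)" for i k
    by (induction k) (auto intro: one jet mult)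
  have prod: "P (\<Prod>i\<in>A. jet i ^ f i)" if "finite A" for A f
    using that by (induction A rule: finite_induct) (auto intro: one pow mult)
  have mon: "P (Poly_Mapping.single m c)" for m c
  proof -
    have "Poly_Mapping.single m c = Poly_Mapping.single 0 c * Poly_Mapping.single m 1"
      by (simp add: mult_single)
    also have "Poly_Mapping.single m 1 = (\<Prod>i\<in>Poly_Mapping.keys m. jet i ^ Poly_Mapping.lookup m i)"
      by (subst poly_mapping_sum_singles) (simp add: single_sum jet_power)
    finally show ?thesis using mult[OF const prod[OF finite_keys]] by simp
  qed
  show ?thesis by (rule diffpoly_add_induct[OF mon add])
qed

lemma total_deriv_alt:
  "total_deriv p = (\<Sum>m\<in>Poly_Mapping.keys p. Poly_Mapping.single 0 (Poly_Mapping.lookup p m) * mon_deriv m)"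
  by (simp add: total_deriv_def mon_deriv_def sum_distrib_left mult_single)

lemma diffpoly_eval_alt:
  "diffpoly_eval p x = (\<Sum>m\<in>Poly_Mapping.keys p. of_real (Poly_Mapping.lookup p m) * mon_eval x m)"
  by (simp add: diffpoly_eval_def mon_eval_def)

lemma total_deriv_add: "total_deriv (p + q) = total_deriv p + total_deriv q"
  unfolding total_deriv_alt
  by (rule setsum_keys_plus_distrib) (simp_all add: single_add ring_distribs)

lemma diffpoly_eval_add: "diffpoly_eval (p + q) x = diffpoly_eval p x + diffpoly_eval q x"
  unfolding diffpoly_eval_alt
  by (rule setsum_keys_plus_distrib) (simp_all add: ring_distribs)

lemma total_deriv_zero [simp]: "total_deriv 0 = 0" by (simp add: total_deriv_def)

lemma diffpoly_eval_zero [simp]: "diffpoly_eval 0 x = 0" by (simp add: diffpoly_eval_def)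

lemma total_deriv_single: "total_deriv (Poly_Mapping.single m c) = Poly_Mapping.single 0 c * mon_deriv m"
  by (cases "c = 0") (simp_all add: total_deriv_alt)

lemma diffpoly_eval_single: "diffpoly_eval (Poly_Mapping.single m c) x = of_real c * mon_eval x m"
  by (cases "c = 0") (simp_all add: diffpoly_eval_alt)

text \<open>Indices outside the keys contribute zero coefficients. This allows the sums for
  \<open>m\<close>, \<open>n\<close> and \<open>m + n\<close> to run over one common set in the
  Leibniz rule.\<close>

lemma mon_deriv_superset:
  assumes "finite A" "Poly_Mapping.keys m \<subseteq> A"
  shows "mon_deriv m = (\<Sum>i\<in>A. Poly_Mapping.single
     (m - Poly_Mapping.single i 1 + Poly_Mapping.single (Suc i) 1) (real (Poly_Mapping.lookup m i)))"
  unfolding mon_deriv_def using assms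
  by (intro sum.mono_neutral_left) (auto simp: in_keys_iff)

lemma mon_eval_superset:
  assumes "finite A" "Poly_Mapping.keys m \<subseteq> A"
  shows "mon_eval x m = (\<Prod>i\<in>A. x i ^ Poly_Mapping.lookup m i)"
  unfolding mon_eval_def using assms
  by (intro prod.mono_neutral_left) (auto simp: in_keys_iff)

lemma mon_eval_add: "mon_eval x (m + n) = mon_eval x m * mon_eval x n"
proof -
  let ?A = "Poly_Mapping.keys m \<union> Poly_Mapping.keys n"
  have "Poly_Mapping.keys (m + n) \<subseteq> ?A" by (rule keys_add)
  then show ?thesis
    by (simp add: mon_eval_superset[of ?A] lookup_add power_add prod.distrib)
qed

lemma mon_deriv_add:
  "mon_deriv (m + n) = Poly_Mapping.single m 1 * mon_deriv n + mon_deriv m * Poly_Mapping.single n 1"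
proof -
  let ?A = "Poly_Mapping.keys m \<union> Poly_Mapping.keys n"
  let ?s = "\<lambda>i. Poly_Mapping.single i (1::nat)"
  have split: "Poly_Mapping.single (m + n - ?s i + ?s (Suc i)) (real (Poly_Mapping.lookup (m + n) i))
     = Poly_Mapping.single m 1 * Poly_Mapping.single (n - ?s i + ?s (Suc i)) (real (Poly_Mapping.lookup n i))
     + Poly_Mapping.single (m - ?s i + ?s (Suc i)) (real (Poly_Mapping.lookup m i)) * Poly_Mapping.single n 1" for i
  proof -
    \<comment> \<open>Subtraction of exponents is truncated, so it commutes with adding
      \<open>a\<close> only if \<open>jet i\<close> occurs in \<open>b\<close>. If it does not, the
      coefficient in question is zero and both sides vanish.\<close>
    have *: "a + b - ?s i = a + (b - ?s i)" if "Poly_Mapping.lookup b i \<noteq> 0" for a b :: "nat \<Rightarrow>\<^sub>0 nat"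
      using that by (intro poly_mapping_eqI) (auto simp: lookup_add lookup_minus lookup_single when_def)
    have 1: "Poly_Mapping.single (m + n - ?s i + ?s (Suc i)) (real (Poly_Mapping.lookup n i))
      = Poly_Mapping.single m 1 * Poly_Mapping.single (n - ?s i + ?s (Suc i)) (real (Poly_Mapping.lookup n i))"
      using *[of n m] by (cases "Poly_Mapping.lookup n i = 0") (simp_all add: mult_single add.assoc)
    have 2: "Poly_Mapping.single (m + n - ?s i + ?s (Suc i)) (real (Poly_Mapping.lookup m i))
      = Poly_Mapping.single (m - ?s i + ?s (Suc i)) (real (Poly_Mapping.lookup m i)) * Poly_Mapping.single n 1"
      using *[of m n] by (cases "Poly_Mapping.lookup m i = 0") (simp_all add: mult_single ac_simps)
    show ?thesis unfolding lookup_add of_nat_add single_add 1 2 by (rule add.commute)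
  qed
  have "mon_deriv (m + n) = (\<Sum>i\<in>?A. Poly_Mapping.single (m + n - ?s i + ?s (Suc i)) (real (Poly_Mapping.lookup (m + n) i)))"
    by (intro mon_deriv_superset keys_add) simp
  also have "\<dots> = Poly_Mapping.single m 1 * mon_deriv n + mon_deriv m * Poly_Mapping.single n 1"
    by (simp only: split sum.distrib sum_distrib_left[symmetric] sum_distrib_right[symmetric])
       (simp add: mon_deriv_superset[of ?A])
  finally show ?thesis .
qed

lemma total_deriv_mult: "total_deriv (p * q) = total_deriv p * q + p * total_deriv q"
proof (induction p rule: diffpoly_add_induct)
  case (1 m c)
  show ?case
  proof (induction q rule: diffpoly_add_induct)
    case (1 n d)
    let ?c = "Poly_Mapping.single 0 c :: diffpoly" and ?d = "Poly_Mapping.single 0 d :: diffpoly"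
    let ?m = "Poly_Mapping.single m 1 :: diffpoly" and ?n = "Poly_Mapping.single n 1 :: diffpoly"
    have *: "Poly_Mapping.single m c = ?c * ?m" "Poly_Mapping.single n d = ?d * ?n"
      "Poly_Mapping.single 0 (c * d) = ?c * ?d"
      by (simp_all add: mult_single)
    have "total_deriv (Poly_Mapping.single m c * Poly_Mapping.single n d)
        = ?c * ?d * (?m * mon_deriv n + mon_deriv m * ?n)"
      by (simp only: mult_single total_deriv_single mon_deriv_add *(3))
    also have "\<dots> = ?c * mon_deriv m * (?d * ?n) + ?c * ?m * (?d * mon_deriv n)"
      by (simp only: algebra_simps)
    also have "\<dots> = ?c * mon_deriv m * Poly_Mapping.single n d + Poly_Mapping.single m c * (?d * mon_deriv n)"
      by (simp only: *(1,2))
    finally show ?case by (simp only: total_deriv_single)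
  qed (simp add: ring_distribs total_deriv_add)
qed (simp add: ring_distribs total_deriv_add)

lemma diffpoly_eval_mult: "diffpoly_eval (p * q) x = diffpoly_eval p x * diffpoly_eval q x"
proof (induction p rule: diffpoly_add_induct)
  case (1 m c)
  show ?case
  proof (induction q rule: diffpoly_add_induct)
    case (1 n d)
    show ?case by (simp add: mult_single diffpoly_eval_single mon_eval_add)
  qed (simp add: ring_distribs diffpoly_eval_add)
qed (simp add: ring_distribs diffpoly_eval_add)

lemma total_deriv_const [simp]: "total_deriv (Poly_Mapping.single 0 c) = 0"
  by (simp add: total_deriv_single mon_deriv_def)

lemma total_deriv_jet [simp]: "total_deriv (jet i) = jet (Suc i)"
  by (simp add: jet_def total_deriv_single mon_deriv_def)

lemma diffpoly_eval_const [simp]: "diffpoly_eval (Poly_Mapping.single 0 c) x = of_real c"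
  by (simp add: diffpoly_eval_single mon_eval_def)

lemma diffpoly_eval_jet [simp]: "diffpoly_eval (jet i) x = x i"
  by (simp add: jet_def diffpoly_eval_single mon_eval_def)

lemma total_deriv_numeral [simp]: "total_deriv (numeral w) = 0"
  using total_deriv_const[of "numeral w"] by (simp add: single_numeral)

lemma diffpoly_eval_numeral [simp]: "diffpoly_eval (numeral w) x = numeral w"
  using diffpoly_eval_const[of "numeral w"] by (simp add: single_numeral)

lemma total_deriv_uminus: "total_deriv (- p) = - total_deriv p"
  using total_deriv_add[of p "- p"] by (simp add: eq_neg_iff_add_eq_0 add.commute)

lemma total_deriv_diff: "total_deriv (p - q) = total_deriv p - total_deriv q"
  using total_deriv_add[of p "- q"] by (simp add: total_deriv_uminus)

lemma diffpoly_eval_diff: "diffpoly_eval (p - q) x = diffpoly_eval p x - diffpoly_eval q x"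
  using diffpoly_eval_add[of "p - q" q x] by simp

lemma total_deriv_sum: "total_deriv (\<Sum>i\<in>A. f i) = (\<Sum>i\<in>A. total_deriv (f i))"
  by (induction A rule: infinite_finite_induct) (simp_all add: total_deriv_add)

lemma diffpoly_eval_sum: "diffpoly_eval (\<Sum>i\<in>A. f i) x = (\<Sum>i\<in>A. diffpoly_eval (f i) x)"
  by (induction A rule: infinite_finite_induct) (simp_all add: diffpoly_eval_add)


section \<open>Coefficients of differential polynomials and uniqueness in the recursion\<close>

lemma lookup_mult_zero:
  "Poly_Mapping.lookup (p * q :: diffpoly) 0 = Poly_Mapping.lookup p 0 * Poly_Mapping.lookup q 0"
proof (induction p rule: diffpoly_add_induct)
  case (1 m c)
  show ?case
  proof (induction q rule: diffpoly_add_induct)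
    case (1 n d)
    have "m + n = 0 \<longleftrightarrow> m = 0 \<and> n = 0"
      by (auto simp: poly_mapping_eq_iff fun_eq_iff lookup_add)
    then show ?case by (auto simp: mult_single lookup_single when_def)
  qed (simp add: ring_distribs lookup_add)
qed (simp add: ring_distribs lookup_add)

lemma lookup_jet_mult:
  "Poly_Mapping.lookup (jet i * p) (Poly_Mapping.single i 1 + m) = Poly_Mapping.lookup p m"
  by (induction p rule: diffpoly_add_induct)
     (simp_all add: ring_distribs lookup_add jet_def mult_single lookup_single when_def)

lemma lookup_jet_mult_eq_0:
  assumes "Poly_Mapping.lookup m i = 0"
  shows "Poly_Mapping.lookup (jet i * p) m = 0"
proof (induction p rule: diffpoly_add_induct)
  case (1 n c)
  have "Poly_Mapping.single i 1 + n \<noteq> m" using assms by (auto simp: lookup_add)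
  then show ?case by (simp add: jet_def mult_single lookup_single when_def)
qed (simp add: ring_distribs lookup_add)

lemma lookup_jet_zero [simp]: "Poly_Mapping.lookup (jet i) 0 = 0"
  using lookup_jet_mult_eq_0[of 0 i 1] by simp

lemma lookup_total_deriv:
  "Poly_Mapping.lookup (total_deriv p) k = (\<Sum>m\<in>Poly_Mapping.keys p. \<Sum>i\<in>Poly_Mapping.keys m.
     if m - Poly_Mapping.single i 1 + Poly_Mapping.single (Suc i) 1 = k
     then Poly_Mapping.lookup p m * real (Poly_Mapping.lookup m i) else 0)"
  by (simp add: total_deriv_def lookup_sum lookup_single when_def)

lemma lookup_total_deriv_zero [simp]: "Poly_Mapping.lookup (total_deriv p) 0 = 0"
proof -
  have "m - Poly_Mapping.single i 1 + Poly_Mapping.single (Suc i) 1 \<noteq> 0" for m :: "nat \<Rightarrow>\<^sub>0 nat" and i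
    by (metis add_is_0 lookup_add lookup_single_eq lookup_zero zero_neq_one)
  then show ?thesis by (simp add: lookup_total_deriv)
qed

text \<open>Each monomial of a total derivative contains some \<open>jet (Suc i)\<close>. Total
  derivatives therefore satisfy the normalization of \<open>mkdv\<close> automatically.\<close>

lemma lookup_total_deriv_jet_zero [simp]: "Poly_Mapping.lookup (total_deriv p) (Poly_Mapping.single 0 (Suc 0)) = 0"
proof -
  have "m - Poly_Mapping.single i 1 + Poly_Mapping.single (Suc i) 1 \<noteq> Poly_Mapping.single 0 1"
    for m :: "nat \<Rightarrow>\<^sub>0 nat" and i
    by (metis Zero_neq_Suc add_is_0 lookup_add lookup_single_eq lookup_single_not_eq zero_neq_one)
  then show ?thesis by (simp add: lookup_total_deriv)
qed

text \<open>No cancellation can occur at this monomial: since \<open>jet (Suc N)\<close> is absent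
  from \<open>p\<close>, its single occurrence must come from differentiating a
  \<open>jet N\<close>, and undoing this recovers \<open>m\<close>.\<close>

lemma lookup_total_deriv_top:
  assumes top: "\<And>m. m \<in> Poly_Mapping.keys p \<Longrightarrow> Poly_Mapping.lookup m (Suc N) = 0"
    and m: "m \<in> Poly_Mapping.keys p" and N: "N \<in> Poly_Mapping.keys m"
  shows "Poly_Mapping.lookup (total_deriv p) (m - Poly_Mapping.single N 1 + Poly_Mapping.single (Suc N) 1)
     = Poly_Mapping.lookup p m * real (Poly_Mapping.lookup m N)"
proof -
  let ?e = "\<lambda>i. Poly_Mapping.single i (1::nat)"
  let ?t = "\<lambda>m i. m - ?e i + ?e (Suc i)"
  have iff: "?t m' i = ?t m N \<longleftrightarrow> m' = m \<and> i = N" if "m' \<in> Poly_Mapping.keys p" "i \<in> Poly_Mapping.keys m'" for m' i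
  proof
    assume eq: "?t m' i = ?t m N"
    have "Poly_Mapping.lookup (?t m' i) (Suc N) = 1"
      unfolding eq using top[OF m] by (simp add: lookup_add lookup_minus lookup_single)
    then have i: "i = N"
      using top[OF that(1)] by (auto simp: lookup_add lookup_minus lookup_single when_def split: if_splits)
    have "m' - ?e N + ?e N = m - ?e N + ?e N" using eq i by simp
    moreover have "k - ?e N + ?e N = k" if "N \<in> Poly_Mapping.keys k" for k :: "nat \<Rightarrow>\<^sub>0 nat"
      using that by (intro poly_mapping_eqI) (auto simp: in_keys_iff lookup_add lookup_minus lookup_single when_def)
    ultimately show "m' = m \<and> i = N" using i that N by metis
  qed auto
  have "Poly_Mapping.lookup (total_deriv p) (?t m N) =
     (\<Sum>m'\<in>Poly_Mapping.keys p. \<Sum>i\<in>Poly_Mapping.keys m'.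
        if m' = m \<and> i = N then Poly_Mapping.lookup p m' * real (Poly_Mapping.lookup m' i) else 0)"
    unfolding lookup_total_deriv by (intro sum.cong refl) (simp only: iff)
  also have "\<dots> = (\<Sum>m'\<in>Poly_Mapping.keys p. if m' = m then
        (\<Sum>i\<in>Poly_Mapping.keys m'. if i = N then Poly_Mapping.lookup p m' * real (Poly_Mapping.lookup m' i) else 0) else 0)"
    by (intro sum.cong refl) simp
  also have "\<dots> = Poly_Mapping.lookup p m * real (Poly_Mapping.lookup m N)"
    using m N by simp
  finally show ?thesis .
qed

lemma jet_kernel:
  assumes eq: "jet 0 * total_deriv S = jet 1 * S"
    and norm: "Poly_Mapping.lookup S (Poly_Mapping.single 0 1) = 0"
  shows "S = 0"
proof (rule ccontr)
  assume "S \<noteq> 0"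
  let ?e = "\<lambda>i. Poly_Mapping.single i (1::nat)"
  let ?V = "\<Union>m\<in>Poly_Mapping.keys S. Poly_Mapping.keys m"
  show False
  proof (cases "?V = {}")
    case True
    have "total_deriv S = 0"
      unfolding total_deriv_def by (intro sum.neutral ballI) (use True in auto)
    then have "jet 1 * S = 0" using eq by (simp only: mult_zero_right)
    then have "Poly_Mapping.lookup (jet 1 * S) (?e 1 + m) = 0" for m by (simp only: lookup_zero)
    then have "S = 0" by (intro poly_mapping_eqI) (simp only: lookup_jet_mult lookup_zero)
    with \<open>S \<noteq> 0\<close> show False ..
  next
    case False
    define N where "N = Max ?V"
    have fin: "finite ?V" by simp
    have "N \<in> ?V" unfolding N_def by (rule Max_in[OF fin False])
    then obtain m where m: "m \<in> Poly_Mapping.keys S" "N \<in> Poly_Mapping.keys m" by blast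
    have le: "i \<le> N" if "m' \<in> Poly_Mapping.keys S" "i \<in> Poly_Mapping.keys m'" for m' i
      unfolding N_def using that by (intro Max_ge[OF fin]) blast
    have top: "Poly_Mapping.lookup m' (Suc N) = 0" if "m' \<in> Poly_Mapping.keys S" for m'
      using le[OF that, of "Suc N"] by (auto simp: in_keys_iff)
    let ?t = "m - ?e N + ?e (Suc N)"
    have "Poly_Mapping.lookup (jet 0 * total_deriv S) (?e 0 + ?t) = Poly_Mapping.lookup S m * real (Poly_Mapping.lookup m N)"
      using lookup_total_deriv_top[OF top m] by (simp only: lookup_jet_mult)
    then have coeff: "Poly_Mapping.lookup (jet 1 * S) (?e 0 + ?t) = Poly_Mapping.lookup S m * real (Poly_Mapping.lookup m N)"
      by (simp only: eq)
    have nz: "Poly_Mapping.lookup S m * real (Poly_Mapping.lookup m N) \<noteq> 0"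
      using m by (simp add: in_keys_iff)
    show False
    proof (cases "N = 0")
      case True
      \<comment> \<open>For \<open>N = 0\<close> both sides hit the same monomial, and their
        coefficients differ by the factor \<open>lookup m 0\<close>, which must be 1. So
        \<open>m\<close> is \<open>jet 0\<close> itself.\<close>
      have "?e 0 + ?t = ?e 1 + m"
        using m(2) True
        by (intro poly_mapping_eqI) (auto simp: in_keys_iff lookup_add lookup_minus lookup_single when_def)
      then have "Poly_Mapping.lookup S m = Poly_Mapping.lookup S m * real (Poly_Mapping.lookup m N)"
        using coeff by (simp only: lookup_jet_mult)
      then have "Poly_Mapping.lookup m 0 = 1" using nz True by simp
      moreover have "Poly_Mapping.lookup m i = 0" if "i \<noteq> 0" for i
        using le[OF m(1), of i] that True by (auto simp: in_keys_iff)
      ultimately have "m = ?e 0"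
        by (intro poly_mapping_eqI) (auto simp: lookup_single when_def)
      then show False using norm m by (simp add: in_keys_iff)
    next
      case False
      \<comment> \<open>For \<open>N > 0\<close> the factor \<open>jet 1\<close> cannot supply the
        required \<open>jet (Suc N)\<close>, and no monomial of \<open>S\<close> contains
        it.\<close>
      have "Poly_Mapping.lookup (jet 1 * S) (?e 0 + ?t) = 0"
      proof (cases "Poly_Mapping.lookup (?e 0 + ?t) 1 = 0")
        case True
        then show ?thesis by (rule lookup_jet_mult_eq_0)
      next
        case 1: False
        define k where "k = ?e 0 + ?t - ?e 1"
        have k: "?e 0 + ?t = ?e 1 + k"
          unfolding k_def using 1
          by (intro poly_mapping_eqI) (auto simp: lookup_add lookup_minus lookup_single when_def split: if_splits)
        have "Poly_Mapping.lookup (?e 0 + ?t) (Suc N) \<noteq> 0" by (simp add: lookup_add)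
        then have "Poly_Mapping.lookup k (Suc N) \<noteq> 0"
          unfolding k using False by (simp add: lookup_add lookup_single)
        then have "k \<notin> Poly_Mapping.keys S" using top by auto
        then show ?thesis unfolding k lookup_jet_mult by (simp add: in_keys_iff)
      qed
      with coeff nz show False by simp
    qed
  qed
qed

section \<open>The integrated recursion\<close>

declare mkdv.simps(2) [simp del]

text \<open>This is the coefficient of t^n in 2 B = Q^2 - t Q'^2 + 4 t B^2. The factor t in front of
  B^2 makes the recursion well-founded, as only primitives of smaller index occur on the right. The
  constant polynomial 1/2 stands for a division by 2.\<close>

fun mkdv_prim :: "nat \<Rightarrow> diffpoly" where
  "mkdv_prim n = Poly_Mapping.single 0 (1/2) *
      ((\<Sum>i\<le>n. mkdv i * mkdv (n - i)) - (\<Sum>i<n. total_deriv (mkdv i) * total_deriv (mkdv (n - Suc i)))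
       + 4 * (\<Sum>i<n. mkdv_prim i * mkdv_prim (n - Suc i)))"

declare mkdv_prim.simps [simp del]

lemma two_mkdv_prim:
  "2 * mkdv_prim n =
     (\<Sum>i\<le>n. mkdv i * mkdv (n - i)) - (\<Sum>i<n. total_deriv (mkdv i) * total_deriv (mkdv (n - Suc i)))
       + 4 * (\<Sum>i<n. mkdv_prim i * mkdv_prim (n - Suc i))"
proof -
  have "2 * Poly_Mapping.single 0 (1/2) = (1 :: diffpoly)"
    using mult_single[of "0::nat \<Rightarrow>\<^sub>0 nat" 2 0 "1/2::real"] by simp
  then show ?thesis
    by (subst mkdv_prim.simps) (simp only: mult.assoc[symmetric] mult_1_left)
qed

lemma total_deriv_convolution:
  fixes f :: "nat \<Rightarrow> diffpoly"
  shows
  "total_deriv (\<Sum>i<n. f i * f (n - Suc i)) = 2 * (\<Sum>i<n. f (n - Suc i) * total_deriv (f i))"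
proof -
  have "(\<Sum>i<n. f i * total_deriv (f (n - Suc i))) = (\<Sum>i<n. f (n - Suc i) * total_deriv (f i))"
    by (subst sum.nat_diff_reindex[symmetric]) (auto intro!: sum.cong)
  then show ?thesis
    by (simp only: total_deriv_sum total_deriv_mult sum.distrib mult.commute[of "total_deriv _"] mult_2)
qed

lemma total_deriv_convolution_atMost:
  fixes f :: "nat \<Rightarrow> diffpoly"
  shows
  "total_deriv (\<Sum>i\<le>n. f i * f (n - i)) = 2 * (\<Sum>i\<le>n. f (n - i) * total_deriv (f i))"
  using total_deriv_convolution[of f "Suc n"] by (simp add: lessThan_Suc_atMost)

text \<open>After differentiation every summand carries a factor
  \<open>total_deriv (mkdv i)\<close>. For \<open>i < n\<close> its cofactor is the difference of
  the two sides of the recursion for \<open>mkdv (n - i)\<close> and vanishes; only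
  \<open>i = n\<close> survives, with cofactor \<open>mkdv 0 = jet 0\<close>.\<close>

lemma mkdv_prim_step:
  assumes rec: "\<And>k. k < n \<Longrightarrow> mkdv (Suc k) = total_deriv (total_deriv (mkdv k)) - 4 * jet 0 * mkdv_prim k"
    and prim: "\<And>k. k < n \<Longrightarrow> total_deriv (mkdv_prim k) = jet 0 * total_deriv (mkdv k)"
  shows "total_deriv (mkdv_prim n) = jet 0 * total_deriv (mkdv n)"
proof -
  let ?D = total_deriv
  let ?S = "\<Sum>i\<le>n. mkdv (n - i) * ?D (mkdv i)"
  let ?S2 = "\<Sum>i<n. ?D (mkdv (n - Suc i)) * ?D (?D (mkdv i))"
  let ?T = "\<Sum>i<n. ?D (?D (mkdv (n - Suc i))) * ?D (mkdv i)"
  let ?U = "\<Sum>i<n. mkdv_prim (n - Suc i) * ?D (mkdv i)"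
  have ring: "2 * a - 2 * b + 4 * (2 * (j * c)) = 2 * (a - (b - 4 * j * c))" for a b c j :: diffpoly
    by (simp add: algebra_simps)
  have "(\<Sum>i<n. mkdv_prim (n - Suc i) * ?D (mkdv_prim i)) = jet 0 * ?U"
    unfolding sum_distrib_left by (intro sum.cong refl) (simp add: prim mult.left_commute)
  moreover have "?S2 = ?T"
    by (subst sum.nat_diff_reindex[symmetric]) (auto intro!: sum.cong simp: mult.commute)
  moreover have "2 * ?D (mkdv_prim n) = ?D (2 * mkdv_prim n)" by (simp add: total_deriv_mult)
  ultimately have "2 * ?D (mkdv_prim n) = 2 * ?S - 2 * ?T + 4 * (2 * (jet 0 * ?U))"
    unfolding two_mkdv_prim
    by (simp add: total_deriv_add total_deriv_diff total_deriv_mult[of 4]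
        total_deriv_convolution[of "\<lambda>i. ?D (mkdv i)"] total_deriv_convolution[of mkdv_prim]
        total_deriv_convolution_atMost[of mkdv])
  also have "\<dots> = 2 * (?S - (?T - 4 * jet 0 * ?U))" by (rule ring)
  also have "?T - 4 * jet 0 * ?U = (\<Sum>i<n. (?D (?D (mkdv (n - Suc i))) - 4 * jet 0 * mkdv_prim (n - Suc i)) * ?D (mkdv i))"
    by (simp only: left_diff_distrib sum_subtractf sum_distrib_left mult.assoc)
  also have "(\<Sum>i<n. (?D (?D (mkdv (n - Suc i))) - 4 * jet 0 * mkdv_prim (n - Suc i)) * ?D (mkdv i))
     = (\<Sum>i<n. mkdv (n - i) * ?D (mkdv i))"
  proof (intro sum.cong refl)
    fix i assume "i \<in> {..<n}"
    then have "n - Suc i < n" "n - i = Suc (n - Suc i)" by auto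
    then show "(?D (?D (mkdv (n - Suc i))) - 4 * jet 0 * mkdv_prim (n - Suc i)) * ?D (mkdv i) = mkdv (n - i) * ?D (mkdv i)"
      using rec[of "n - Suc i"] by simp
  qed
  also have "?S - (\<Sum>i<n. mkdv (n - i) * ?D (mkdv i)) = jet 0 * ?D (mkdv n)"
    by (simp add: lessThan_Suc_atMost[symmetric])
  finally show ?thesis by simp
qed

text \<open>The operator on the left of the recursion is \<eta>^2 times the derivative of R /
  \<eta>, so Q'' is reproduced and - 4 \<eta> B contributes - 4 \<eta>^2 B' = - 4 \<eta>^3 Q'. A
  vanishing constant term of \<open>mkdv_prim n\<close> means that \<eta> B has no term in \<eta>,
  as the normalization demands. Two solutions differ by an element of the kernel treated in
  \<open>jet_kernel\<close>.\<close>

lemma mkdv_Suc_eqI: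
  assumes prim: "total_deriv (mkdv_prim n) = jet 0 * total_deriv (mkdv n)"
    and zero: "Poly_Mapping.lookup (mkdv_prim n) 0 = 0"
  shows "mkdv (Suc n) = total_deriv (total_deriv (mkdv n)) - 4 * jet 0 * mkdv_prim n"
proof -
  let ?D = total_deriv
  let ?P = "\<lambda>R. jet 0 * ?D R - jet 1 * R =
       jet 0 * ?D (?D (?D (mkdv n))) - jet 1 * ?D (?D (mkdv n)) - 4 * jet 0 ^ 3 * ?D (mkdv n) \<and>
     Poly_Mapping.lookup R (Poly_Mapping.single 0 1) = 0"
  let ?R = "?D (?D (mkdv n)) - 4 * jet 0 * mkdv_prim n"
  have "jet 0 * ?D ?R - jet 1 * ?R =
       jet 0 * ?D (?D (?D (mkdv n))) - jet 1 * ?D (?D (mkdv n)) - 4 * jet 0 ^ 3 * ?D (mkdv n)"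
    unfolding total_deriv_diff total_deriv_mult prim total_deriv_jet
    by (simp add: algebra_simps power3_eq_cube)
  moreover have "Poly_Mapping.lookup ?R (Poly_Mapping.single 0 1) = 0"
    using lookup_jet_mult[of 0 "4 * mkdv_prim n" 0]
    by (simp add: lookup_minus lookup_mult_zero zero ac_simps)
  ultimately have R: "?P ?R" by simp
  have "R = ?R" if "?P R" for R
  proof -
    have ring: "a * (x - y) - b * (R - R') = (a * x - b * R) - (a * y - b * R')" for a b x y R R' :: diffpoly
      by (simp add: algebra_simps)
    have "jet 0 * ?D (R - ?R) - jet 1 * (R - ?R) = (jet 0 * ?D R - jet 1 * R) - (jet 0 * ?D ?R - jet 1 * ?R)"
      unfolding total_deriv_diff[of R] by (rule ring)
    also have "\<dots> = 0" using that R by simp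
    finally have "jet 0 * ?D (R - ?R) = jet 1 * (R - ?R)" by simp
    then have "R - ?R = 0" using that R by (intro jet_kernel) (simp_all add: lookup_minus)
    then show ?thesis by simp
  qed
  then have "(THE R. ?P R) = ?R" using R by (intro the_equality)
  then show ?thesis by (simp only: mkdv.simps)
qed

text \<open>The four claims depend on one another: the primitive of index \<open>n\<close> needs the
  recursion for all smaller indices, the next \<open>mkdv\<close> needs that primitive, and the
  constant terms must be carried along for the normalization.\<close>

lemma mkdv_recursion:
  "total_deriv (mkdv_prim n) = jet 0 * total_deriv (mkdv n) \<and>
   mkdv (Suc n) = total_deriv (total_deriv (mkdv n)) - 4 * jet 0 * mkdv_prim n \<and>
   Poly_Mapping.lookup (mkdv_prim n) 0 = 0 \<and> Poly_Mapping.lookup (mkdv n) 0 = 0"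
proof (induction n rule: less_induct)
  case (less n)
  note IH1 = less.IH[THEN conjunct1] and IH2 = less.IH[THEN conjunct2, THEN conjunct1]
    and IH3 = less.IH[THEN conjunct2, THEN conjunct2, THEN conjunct1]
    and IH4 = less.IH[THEN conjunct2, THEN conjunct2, THEN conjunct2]
  have Q0: "Poly_Mapping.lookup (mkdv n) 0 = 0"
  proof (cases n)
    case (Suc j)
    then have "mkdv n = total_deriv (total_deriv (mkdv j)) - 4 * jet 0 * mkdv_prim j"
      using IH2[of j] by (simp only: lessI)
    then show ?thesis by (simp only: lookup_minus lookup_mult_zero lookup_jet_zero lookup_total_deriv_zero)
  qed simp
  have prim: "total_deriv (mkdv_prim n) = jet 0 * total_deriv (mkdv n)"
    by (rule mkdv_prim_step[OF IH2 IH1])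
  have "Poly_Mapping.lookup (mkdv_prim n) 0 = 0"
  proof -
    have "Poly_Mapping.lookup (mkdv i) 0 = 0" if "i \<le> n" for i
      using Q0 IH4[of i] that by (cases "i = n") simp_all
    then show ?thesis
      by (subst mkdv_prim.simps) (simp add: lookup_mult_zero lookup_add lookup_minus lookup_sum IH3)
  qed
  with prim Q0 show ?case
    by (intro conjI mkdv_Suc_eqI)
qed

lemmas total_deriv_mkdv_prim = mkdv_recursion[THEN conjunct1]
lemmas mkdv_Suc_eq = mkdv_recursion[THEN conjunct2, THEN conjunct1]

section \<open>Calculus on a closed band\<close>

text \<open>Uniqueness only needs arbitrarily short steps inside the band in both coordinate
  directions: vertical steps are always possible, and horizontal ones go right, or left from the
  line \<open>Re z = s\<^sub>2\<close>.\<close>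

lemma has_derivative_band_unique:
  fixes f :: "complex \<Rightarrow> 'b::real_normed_vector"
  assumes "s\<^sub>1 < s\<^sub>2" "z \<in> band s\<^sub>1 s\<^sub>2"
    and "(f has_derivative L) (at z within band s\<^sub>1 s\<^sub>2)" "(f has_derivative L') (at z within band s\<^sub>1 s\<^sub>2)"
  shows "L = L'"
proof (rule frechet_derivative_unique_within[OF assms(3,4)])
  fix i :: complex and e :: real
  assume i: "i \<in> Basis" and e: "0 < e"
  show "\<exists>d. 0 < \<bar>d\<bar> \<and> \<bar>d\<bar> < e \<and> z + d *\<^sub>R i \<in> band s\<^sub>1 s\<^sub>2"
  proof (cases "Re z < s\<^sub>2")
    case True
    then show ?thesis using assms(2) e i
      by (intro exI[of _ "min (s\<^sub>2 - Re z) e / 2"]) (auto simp: band_def Basis_complex_def min_def field_simps)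
  next
    case False
    then show ?thesis using assms(1,2) e i
      by (intro exI[of _ "- min (s\<^sub>2 - s\<^sub>1) e / 2"]) (auto simp: band_def Basis_complex_def min_def field_simps)
  qed
qed

lemma frechet_derivative_band:
  assumes "s\<^sub>1 < s\<^sub>2" "z \<in> band s\<^sub>1 s\<^sub>2" "(f has_derivative L) (at z within band s\<^sub>1 s\<^sub>2)"
  shows "frechet_derivative f (at z within band s\<^sub>1 s\<^sub>2) = L"
proof -
  have "f differentiable (at z within band s\<^sub>1 s\<^sub>2)" using assms(3) by (auto simp: differentiable_def)
  then show ?thesis
    unfolding frechet_derivative_works by (rule has_derivative_band_unique[OF assms(1,2) _ assms(3)])
qed

lemma
  assumes "s\<^sub>1 < s\<^sub>2" "z \<in> band s\<^sub>1 s\<^sub>2" "(f has_derivative L) (at z within band s\<^sub>1 s\<^sub>2)"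
  shows pdx_band: "pdx (band s\<^sub>1 s\<^sub>2) f z = L 1" and pdy_band: "pdy (band s\<^sub>1 s\<^sub>2) f z = L \<i>"
  using frechet_derivative_band[OF assms] by (simp_all add: pdx_def pdy_def)

lemma
  assumes "s\<^sub>1 < s\<^sub>2" "z \<in> band s\<^sub>1 s\<^sub>2" "(f has_field_derivative d) (at z within band s\<^sub>1 s\<^sub>2)"
  shows pdx_band_field: "pdx (band s\<^sub>1 s\<^sub>2) f z = d" and dz_band_field: "dz (band s\<^sub>1 s\<^sub>2) f z = d"
  using pdx_band[OF assms(1,2), of f "(*) d"] pdy_band[OF assms(1,2), of f "(*) d"] assms(3)
  by (simp_all add: has_field_derivative_def dz_def complex_eq_iff)

lemma has_derivative_cong_on:
  assumes "z \<in> S" "\<And>w. w \<in> S \<Longrightarrow> f w = g w"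
  shows "(f has_derivative L) (at z within S) \<longleftrightarrow> (g has_derivative L) (at z within S)"
  using has_derivative_transform[OF assms(1), of g f L] has_derivative_transform[OF assms(1), of f g L] assms(2)
  by metis

lemma
  fixes f g :: "complex \<Rightarrow> 'b::real_normed_vector"
  assumes "z \<in> S" "\<And>w. w \<in> S \<Longrightarrow> f w = g w"
  shows pdx_cong: "pdx S f z = pdx S g z" and pdy_cong: "pdy S f z = pdy S g z"
  by (simp_all add: pdx_def pdy_def frechet_derivative_def has_derivative_cong_on[OF assms])

lemma dz_cong: "z \<in> S \<Longrightarrow> (\<And>w. w \<in> S \<Longrightarrow> f w = g w) \<Longrightarrow> dz S f z = dz S g z"
  unfolding dz_def using pdx_cong[of z S f g] pdy_cong[of z S f g] by simp

lemma Ck_on_cong: "(\<And>w. w \<in> S \<Longrightarrow> f w = g w) \<Longrightarrow> Ck_on k S f \<longleftrightarrow> Ck_on k S g"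
proof (induction k arbitrary: f g)
  case 0
  then show ?case by (simp cong: continuous_on_cong)
next
  case (Suc k)
  have "f differentiable_on S \<longleftrightarrow> g differentiable_on S"
    using Suc.prems by (simp add: differentiable_on_def differentiable_def has_derivative_cong_on[of _ S f g])
  then show ?case using Suc.IH[of "pdx S f" "pdx S g"] Suc.IH[of "pdy S f" "pdy S g"] Suc.prems
    by (simp add: pdx_cong[of _ S f g] pdy_cong[of _ S f g])
qed

lemma interior_band: "interior (band s\<^sub>1 s\<^sub>2) = {z. s\<^sub>1 < Re z \<and> Re z < s\<^sub>2}"
proof -
  have "band s\<^sub>1 s\<^sub>2 = {z. Re z \<ge> s\<^sub>1} \<inter> {z. Re z \<le> s\<^sub>2}" by (auto simp: band_def)
  moreover have "interior {z. Re z \<ge> s\<^sub>1} = {z. Re z > s\<^sub>1}" "interior {z. Re z \<le> s\<^sub>2} = {z. Re z < s\<^sub>2}"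
    using interior_halfspace_ge[of "1::complex" s\<^sub>1] interior_halfspace_le[of "1::complex" s\<^sub>2]
    by (simp_all add: inner_complex_def)
  ultimately show ?thesis by (auto simp: interior_Int)
qed

lemma convex_band: "convex (band s\<^sub>1 s\<^sub>2)"
proof -
  have "band s\<^sub>1 s\<^sub>2 = {z. Re z \<ge> s\<^sub>1} \<inter> {z. Re z \<le> s\<^sub>2}" by (auto simp: band_def)
  then show ?thesis by (simp add: convex_Int convex_halfspace_Re_ge convex_halfspace_Re_le)
qed

lemma closed_band: "closed (band s\<^sub>1 s\<^sub>2)"
  unfolding band_def by (intro closed_Collect_conj closed_Collect_le continuous_intros)

lemma closure_interior_band:
  assumes "s\<^sub>1 < s\<^sub>2" shows "closure (interior (band s\<^sub>1 s\<^sub>2)) = band s\<^sub>1 s\<^sub>2"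
proof -
  have "complex_of_real ((s\<^sub>1 + s\<^sub>2) / 2) \<in> interior (band s\<^sub>1 s\<^sub>2)" using assms by (simp add: interior_band)
  then have "interior (band s\<^sub>1 s\<^sub>2) \<noteq> {}" by blast
  from convex_closure_interior[OF convex_band this] show ?thesis by (simp add: closed_band)
qed

lemma band_eq_by_continuity:
  fixes f g :: "complex \<Rightarrow> 'b::real_normed_vector"
  assumes "s\<^sub>1 < s\<^sub>2" "continuous_on (band s\<^sub>1 s\<^sub>2) f" "continuous_on (band s\<^sub>1 s\<^sub>2) g"
    and "\<And>z. z \<in> interior (band s\<^sub>1 s\<^sub>2) \<Longrightarrow> f z = g z" and "z \<in> band s\<^sub>1 s\<^sub>2"
  shows "f z = g z"
proof -
  have "continuous_on (closure (interior (band s\<^sub>1 s\<^sub>2))) (\<lambda>z. f z - g z)"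
    unfolding closure_interior_band[OF assms(1)] by (intro continuous_on_diff assms)
  then have "f z - g z = 0"
    by (rule continuous_constant_on_closure) (simp_all add: closure_interior_band assms)
  then show ?thesis by simp
qed

section \<open>Complex derivatives up to the boundary of the band\<close>

lemma holomorphic_on_dz_band:
  assumes "s\<^sub>1 < s\<^sub>2" "f holomorphic_on band s\<^sub>1 s\<^sub>2" "z \<in> band s\<^sub>1 s\<^sub>2"
  shows "(f has_field_derivative dz (band s\<^sub>1 s\<^sub>2) f z) (at z within band s\<^sub>1 s\<^sub>2)"
  using assms dz_band_field by (metis holomorphic_on_def field_differentiable_def)

text \<open>In the interior \<open>pdx\<close> of \<open>f\<close> is the complex derivative, so it
  satisfies the Cauchy-Riemann equation. Since \<open>f\<close> is C^2 on the closed band, both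
  sides of this equation are continuous up to the boundary and it persists there, which makes the
  real derivative of \<open>pdx\<close> complex linear.\<close>

lemma holomorphic_on_pdx_band:
  assumes s: "s\<^sub>1 < s\<^sub>2" and hol: "f holomorphic_on band s\<^sub>1 s\<^sub>2" and C: "Ck_on 2 (band s\<^sub>1 s\<^sub>2) f"
  shows "pdx (band s\<^sub>1 s\<^sub>2) f holomorphic_on band s\<^sub>1 s\<^sub>2"
proof -
  let ?S = "band s\<^sub>1 s\<^sub>2"
  let ?p = "pdx ?S f"
  have diff: "?p differentiable_on ?S" and cont: "continuous_on ?S (pdx ?S ?p)" "continuous_on ?S (pdy ?S ?p)"
    using C by (simp_all add: numeral_2_eq_2)
  have der: "(?p has_derivative frechet_derivative ?p (at z within ?S)) (at z within ?S)" if "z \<in> ?S" for z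
    using diff that by (simp add: differentiable_on_def frechet_derivative_works)
  have CR: "pdy ?S ?p z = \<i> * pdx ?S ?p z" if "z \<in> ?S" for z
  proof (rule band_eq_by_continuity[OF s cont(2) _ _ that])
    show "continuous_on ?S (\<lambda>z. \<i> * pdx ?S ?p z)" by (intro continuous_intros cont)
    fix w assume w: "w \<in> interior ?S"
    then have wS: "w \<in> ?S" using interior_subset by blast
    have "f holomorphic_on interior ?S" using hol holomorphic_on_subset interior_subset by blast
    then have "deriv f holomorphic_on interior ?S" by (intro holomorphic_deriv) auto
    moreover have eq: "?p v = deriv f v" if "v \<in> interior ?S" for v
    proof -
      have "v \<in> ?S" using that interior_subset by blast
      then show ?thesis
        using pdx_band_field[OF s _ holomorphic_on_dz_band[OF s hol]] holomorphic_on_dz_band[OF s hol] that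
        by (metis DERIV_imp_deriv at_within_interior)
    qed
    ultimately have "?p holomorphic_on interior ?S" by (simp cong: holomorphic_cong)
    from holomorphic_on_imp_differentiable_at[OF this open_interior w]
    obtain d where "(?p has_field_derivative d) (at w)" unfolding field_differentiable_def ..
    then have "(?p has_field_derivative d) (at w within ?S)" by (rule has_field_derivative_at_within)
    then have "(?p has_derivative (*) d) (at w within ?S)" by (simp add: has_field_derivative_def)
    then show "pdy ?S ?p w = \<i> * pdx ?S ?p w"
      by (simp add: pdx_band[OF s wS] pdy_band[OF s wS])
  qed
  show ?thesis unfolding holomorphic_on_def field_differentiable_def
  proof
    fix z assume z: "z \<in> ?S"
    let ?L = "frechet_derivative ?p (at z within ?S)"
    interpret L: bounded_linear ?L using der[OF z] by (rule has_derivative_bounded_linear)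
    have "?L h = pdx ?S ?p z * h" for h
    proof -
      have "h = Re h *\<^sub>R 1 + Im h *\<^sub>R \<i>" by (simp add: complex_eq_iff)
      then have "?L h = Re h *\<^sub>R ?L 1 + Im h *\<^sub>R ?L \<i>" by (metis L.add L.scaleR)
      also have "\<dots> = Re h *\<^sub>R pdx ?S ?p z + Im h *\<^sub>R (\<i> * pdx ?S ?p z)"
        using CR[OF z] by (simp add: pdx_def[of ?S ?p z] pdy_def[of ?S ?p z])
      also have "\<dots> = pdx ?S ?p z * h" by (simp add: complex_eq_iff algebra_simps)
      finally show ?thesis .
    qed
    then have "?L = (*) (pdx ?S ?p z)" by auto
    then show "\<exists>d. (?p has_field_derivative d) (at z within ?S)"
      using der[OF z] by (auto simp: has_field_derivative_def)
  qed
qed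

text \<open>All derivatives up to order \<open>k\<close> are complex differentiable within the set.
  The order is recorded because on a closed band \<open>holomorphic_on\<close> gives only one-sided
  differentiability at boundary points, which by itself does not pass to the derivative.\<close>

primrec chol :: "nat \<Rightarrow> complex set \<Rightarrow> (complex \<Rightarrow> complex) \<Rightarrow> bool" where
  "chol 0 S f \<longleftrightarrow> f holomorphic_on S"
| "chol (Suc k) S f \<longleftrightarrow> f holomorphic_on S \<and> chol k S (dz S f)"

lemma chol_imp_holomorphic: "chol k S f \<Longrightarrow> f holomorphic_on S"
  by (cases k) auto

lemma chol_Suc_imp: "chol (Suc k) S f \<Longrightarrow> chol k S f"
proof (induction k arbitrary: f)
  case (Suc k)
  then show ?case by (metis chol.simps(2))
qed simp

lemma chol_cong: "(\<And>w. w \<in> S \<Longrightarrow> f w = g w) \<Longrightarrow> chol k S f \<longleftrightarrow> chol k S g"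
proof (induction k arbitrary: f g)
  case (Suc k)
  have "f holomorphic_on S \<longleftrightarrow> g holomorphic_on S" using Suc.prems by (intro holomorphic_cong) auto
  moreover have "chol k S (dz S f) \<longleftrightarrow> chol k S (dz S g)" using Suc.prems by (intro Suc.IH dz_cong)
  ultimately show ?case by simp
qed (simp cong: holomorphic_cong)

lemma chol_const: assumes "s\<^sub>1 < s\<^sub>2" shows "chol k (band s\<^sub>1 s\<^sub>2) (\<lambda>z. c)"
proof (induction k arbitrary: c)
  case (Suc k)
  have "dz (band s\<^sub>1 s\<^sub>2) (\<lambda>z. c) z = 0" if "z \<in> band s\<^sub>1 s\<^sub>2" for z
    using dz_band_field[OF assms that DERIV_const] .
  then show ?case using Suc[of 0] by (simp cong: chol_cong)
qed simp

lemma chol_add: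
  assumes "s\<^sub>1 < s\<^sub>2" "chol k (band s\<^sub>1 s\<^sub>2) f" "chol k (band s\<^sub>1 s\<^sub>2) g"
  shows "chol k (band s\<^sub>1 s\<^sub>2) (\<lambda>z. f z + g z)"
  using assms(2,3)
proof (induction k arbitrary: f g)
  case (Suc k)
  let ?S = "band s\<^sub>1 s\<^sub>2"
  have hol: "f holomorphic_on ?S" "g holomorphic_on ?S" using Suc.prems by auto
  have "dz ?S (\<lambda>z. f z + g z) z = dz ?S f z + dz ?S g z" if "z \<in> ?S" for z
    by (intro dz_band_field[OF assms(1) that] DERIV_add holomorphic_on_dz_band[OF assms(1)] hol that)
  then show ?case using Suc hol
    by (auto cong: chol_cong intro!: holomorphic_intros)
qed (auto intro: holomorphic_intros)

lemma chol_mult: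
  assumes "s\<^sub>1 < s\<^sub>2" "chol k (band s\<^sub>1 s\<^sub>2) f" "chol k (band s\<^sub>1 s\<^sub>2) g"
  shows "chol k (band s\<^sub>1 s\<^sub>2) (\<lambda>z. f z * g z)"
  using assms(2,3)
proof (induction k arbitrary: f g)
  case (Suc k)
  let ?S = "band s\<^sub>1 s\<^sub>2"
  have hol: "f holomorphic_on ?S" "g holomorphic_on ?S" using Suc.prems by auto
  have "dz ?S (\<lambda>z. f z * g z) z = dz ?S f z * g z + dz ?S g z * f z" if "z \<in> ?S" for z
    by (intro dz_band_field[OF assms(1) that] DERIV_mult holomorphic_on_dz_band[OF assms(1)] hol that)
  moreover have "chol k ?S (\<lambda>z. dz ?S f z * g z + dz ?S g z * f z)"
    using Suc.prems chol_Suc_imp[of k ?S f] chol_Suc_imp[of k ?S g]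
    by (intro chol_add[OF assms(1)] Suc.IH) auto
  ultimately show ?case using hol
    by (auto cong: chol_cong intro!: holomorphic_intros)
qed (auto intro: holomorphic_intros)

lemma chol_inverse:
  assumes s: "s\<^sub>1 < s\<^sub>2" and "chol k (band s\<^sub>1 s\<^sub>2) f" and nz: "\<And>z. z \<in> band s\<^sub>1 s\<^sub>2 \<Longrightarrow> f z \<noteq> 0"
  shows "chol k (band s\<^sub>1 s\<^sub>2) (\<lambda>z. inverse (f z))"
  using assms(2)
proof (induction k)
  case 0
  then show ?case using nz by (auto intro!: holomorphic_intros)
next
  case (Suc k)
  let ?S = "band s\<^sub>1 s\<^sub>2"
  have hol: "f holomorphic_on ?S" using Suc.prems by auto
  have "dz ?S (\<lambda>z. inverse (f z)) z = (-1) * (inverse (f z) * (dz ?S f z * inverse (f z)))" if "z \<in> ?S" for z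
    using dz_band_field[OF s that DERIV_inverse'[OF holomorphic_on_dz_band[OF s hol that] nz[OF that]]]
    by (simp add: mult.assoc)
  moreover have "chol k ?S (\<lambda>z. (-1) * (inverse (f z) * (dz ?S f z * inverse (f z))))"
    using Suc chol_Suc_imp[of k ?S f] by (intro chol_mult[OF s] chol_const[OF s]) auto
  ultimately show ?case using hol nz
    by (auto cong: chol_cong intro!: holomorphic_intros)
qed

lemma Ck_on_smooth_pdx: "smooth_on S f \<Longrightarrow> smooth_on S (pdx S f)"
  unfolding smooth_on_def by (metis Ck_on.simps(2))

lemma chol_smooth:
  assumes s: "s\<^sub>1 < s\<^sub>2" and "f holomorphic_on band s\<^sub>1 s\<^sub>2" "smooth_on (band s\<^sub>1 s\<^sub>2) f"
  shows "chol k (band s\<^sub>1 s\<^sub>2) f"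
  using assms(2,3)
proof (induction k arbitrary: f)
  case (Suc k)
  let ?S = "band s\<^sub>1 s\<^sub>2"
  have "pdx ?S f holomorphic_on ?S"
    using Suc.prems by (intro holomorphic_on_pdx_band s) (auto simp: smooth_on_def)
  then have "chol k ?S (pdx ?S f)" using Suc.prems by (intro Suc.IH Ck_on_smooth_pdx)
  moreover have "dz ?S f z = pdx ?S f z" if "z \<in> ?S" for z
    using pdx_band_field[OF s that holomorphic_on_dz_band[OF s Suc.prems(1) that]] by simp
  ultimately show ?case using Suc.prems by (auto cong: chol_cong)
qed simp

lemma has_derivative_Re_mult:
  "(f has_field_derivative d) F \<Longrightarrow> ((\<lambda>z. Re (c * f z)) has_derivative (\<lambda>h. Re (c * d * h))) F"
  by (auto simp: has_field_derivative_def mult.assoc intro!: derivative_eq_intros)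

text \<open>The factor \<open>c\<close> makes the class closed under both partial derivatives:
  \<partial>_x replaces \<open>f\<close> by its derivative, and \<partial>_y also multiplies
  \<open>c\<close> by \<i>. Imaginary parts are the case \<open>c = - \<i>\<close>.\<close>

lemma
  assumes s: "s\<^sub>1 < s\<^sub>2" and hol: "f holomorphic_on band s\<^sub>1 s\<^sub>2" and z: "z \<in> band s\<^sub>1 s\<^sub>2"
  shows pdx_Re_mult: "pdx (band s\<^sub>1 s\<^sub>2) (\<lambda>z. Re (c * f z)) z = Re (c * dz (band s\<^sub>1 s\<^sub>2) f z)"
    and pdy_Re_mult: "pdy (band s\<^sub>1 s\<^sub>2) (\<lambda>z. Re (c * f z)) z = Re ((c * \<i>) * dz (band s\<^sub>1 s\<^sub>2) f z)"
  using pdx_band[OF s z has_derivative_Re_mult[OF holomorphic_on_dz_band[OF s hol z]], of c]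
    pdy_band[OF s z has_derivative_Re_mult[OF holomorphic_on_dz_band[OF s hol z]], of c]
  by (simp_all add: ac_simps)

lemma Ck_on_Re_mult:
  assumes s: "s\<^sub>1 < s\<^sub>2" and "chol k (band s\<^sub>1 s\<^sub>2) f"
  shows "Ck_on k (band s\<^sub>1 s\<^sub>2) (\<lambda>z. Re (c * f z))"
  using assms(2)
proof (induction k arbitrary: f c)
  case 0
  then show ?case by (auto intro!: continuous_intros holomorphic_on_imp_continuous_on)
next
  case (Suc k)
  let ?S = "band s\<^sub>1 s\<^sub>2"
  have hol: "f holomorphic_on ?S" and ch: "chol k ?S (dz ?S f)" using Suc.prems by auto
  have "(\<lambda>z. Re (c * f z)) differentiable_on ?S"
    unfolding differentiable_on_def differentiable_def
    using has_derivative_Re_mult[OF holomorphic_on_dz_band[OF s hol]] by blast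
  then show ?case using Suc.IH[OF ch, of c] Suc.IH[OF ch, of "c * \<i>"]
    by (simp add: pdx_Re_mult[OF s hol] pdy_Re_mult[OF s hol] del: times_complex.sel cong: Ck_on_cong)
qed

lemma laplacian_Re_mult:
  assumes s: "s\<^sub>1 < s\<^sub>2" and "chol 1 (band s\<^sub>1 s\<^sub>2) f" and z: "z \<in> band s\<^sub>1 s\<^sub>2"
  shows "laplacian (band s\<^sub>1 s\<^sub>2) (\<lambda>z. Re (c * f z)) z = 0"
proof -
  let ?S = "band s\<^sub>1 s\<^sub>2"
  have hol: "f holomorphic_on ?S" "dz ?S f holomorphic_on ?S" using assms(2) by auto
  have "pdx ?S (pdx ?S (\<lambda>z. Re (c * f z))) z = Re (c * dz ?S (dz ?S f) z)"
    using pdx_cong[OF z pdx_Re_mult[OF s hol(1)]] pdx_Re_mult[OF s hol(2) z] by simp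
  moreover have "pdy ?S (pdy ?S (\<lambda>z. Re (c * f z))) z = Re (c * \<i> * \<i> * dz ?S (dz ?S f) z)"
    using pdy_cong[OF z pdy_Re_mult[OF s hol(1)]] pdy_Re_mult[OF s hol(2) z, of "c * \<i>"] by simp
  ultimately show ?thesis by (simp add: laplacian_def)
qed

text \<open>A vertical line stays inside the closed band, so even on a boundary line the derivative
  within the band gives a two-sided derivative in \<open>y\<close>.\<close>

lemma has_vector_derivative_vline:
  assumes "(f has_derivative L) (at (Complex s y) within band s\<^sub>1 s\<^sub>2)" "s\<^sub>1 \<le> s" "s \<le> s\<^sub>2"
  shows "((\<lambda>t. f (Complex s t)) has_vector_derivative L \<i>) (at y)"
proof -
  have c: "((\<lambda>t. Complex s t) has_derivative (\<lambda>h. h *\<^sub>R \<i>)) (at y)"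
  proof -
    have "(\<lambda>t. Complex s t) = (\<lambda>t. of_real s + t *\<^sub>R \<i>)" by (auto simp: complex_eq_iff)
    then show ?thesis by (auto intro!: derivative_eq_intros)
  qed
  have "(\<lambda>t. Complex s t) ` UNIV \<subseteq> band s\<^sub>1 s\<^sub>2" using assms by (auto simp: band_def)
  then have "(f has_derivative L) (at (Complex s y) within (\<lambda>t. Complex s t) ` UNIV)"
    by (rule has_derivative_subset[OF assms(1)])
  from diff_chain_within[OF c this] have "((\<lambda>t. f (Complex s t)) has_derivative (\<lambda>h. L (h *\<^sub>R \<i>))) (at y)"
    by (simp add: o_def)
  moreover interpret bounded_linear L using assms(1) by (rule has_derivative_bounded_linear)
  have "(\<lambda>h. L (h *\<^sub>R \<i>)) = (\<lambda>h. h *\<^sub>R L \<i>)" by (simp add: scaleR)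
  ultimately show ?thesis by (simp add: has_vector_derivative_def)
qed

lemma has_field_derivative_band_shift:
  fixes T :: real
  assumes f: "\<And>z. z \<in> band s\<^sub>1 s\<^sub>2 \<Longrightarrow> (f has_field_derivative f' z) (at z within band s\<^sub>1 s\<^sub>2)"
    and z: "z \<in> band s\<^sub>1 s\<^sub>2"
  shows "((\<lambda>z. f (z + \<i> * of_real T)) has_field_derivative f' (z + \<i> * of_real T)) (at z within band s\<^sub>1 s\<^sub>2)"
proof -
  let ?S = "band s\<^sub>1 s\<^sub>2" and ?c = "\<i> * complex_of_real T"
  have im: "(\<lambda>w. w + ?c) ` ?S \<subseteq> ?S" by (auto simp: band_def)
  have "z + ?c \<in> ?S" using im z by blast
  from f[OF this] have "(f has_field_derivative f' (z + ?c)) (at (z + ?c) within (\<lambda>w. w + ?c) ` ?S)"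
    using im has_field_derivative_subset by blast
  moreover have "((\<lambda>w. w + ?c) has_field_derivative 1) (at z within ?S)" by (auto intro!: derivative_eq_intros)
  ultimately show ?thesis
    using DERIV_image_chain[of f _ "\<lambda>w. w + ?c" z ?S 1] by (simp add: o_def)
qed

lemma band_periodic_dz:
  assumes s: "s\<^sub>1 < s\<^sub>2" and hol: "f holomorphic_on band s\<^sub>1 s\<^sub>2" and per: "band_periodic s\<^sub>1 s\<^sub>2 T f"
  shows "band_periodic s\<^sub>1 s\<^sub>2 T (dz (band s\<^sub>1 s\<^sub>2) f)"
  unfolding band_periodic_def
proof
  let ?S = "band s\<^sub>1 s\<^sub>2" and ?c = "\<i> * complex_of_real T"
  fix z assume z: "z \<in> ?S"
  have "((\<lambda>w. f (w + ?c)) has_field_derivative dz ?S f (z + ?c)) (at z within ?S)"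
    by (rule has_field_derivative_band_shift[OF holomorphic_on_dz_band[OF s hol] z])
  then have "(f has_field_derivative dz ?S f (z + ?c)) (at z within ?S)"
    using per has_derivative_cong_on[OF z, of "\<lambda>w. f (w + ?c)" f]
    by (simp add: has_field_derivative_def band_periodic_def)
  from dz_band_field[OF s z this] show "dz ?S f (z + ?c) = dz ?S f z" by simp
qed

section \<open>Harmonic functions on a periodic band\<close>

lemma band_translate [simp]: "z + \<i> * complex_of_real t \<in> band s\<^sub>1 s\<^sub>2 \<longleftrightarrow> z \<in> band s\<^sub>1 s\<^sub>2"
  by (simp add: band_def)

lemma band_periodicD:
  "band_periodic s\<^sub>1 s\<^sub>2 T f \<Longrightarrow> z \<in> band s\<^sub>1 s\<^sub>2 \<Longrightarrow> f (z + \<i> * of_real T) = f z"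
  by (simp add: band_periodic_def)

lemma band_periodic_of_int:
  assumes per: "band_periodic s\<^sub>1 s\<^sub>2 T f" and z: "z \<in> band s\<^sub>1 s\<^sub>2"
  shows "f (z + \<i> * of_real (of_int k * T)) = f z"
proof (induction k rule: int_induct[where k = 0])
  case (step1 i)
  have eq: "z + \<i> * of_real (of_int (i + 1) * T) = (z + \<i> * of_real (of_int i * T)) + \<i> * of_real T"
    by (simp add: algebra_simps)
  show ?case unfolding eq using band_periodicD[OF per] z step1.IH by (metis band_translate)
next
  case (step2 i)
  have eq: "z + \<i> * of_real (of_int i * T) = (z + \<i> * of_real (of_int (i - 1) * T)) + \<i> * of_real T"
    by (simp add: algebra_simps)
  show ?case using step2.IH unfolding eq using band_periodicD[OF per] z by (metis band_translate)
qed simp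

lemma band_fundamental_translate:
  assumes "0 < T"
  obtains k :: int where "0 \<le> Im (z + \<i> * of_real (of_int k * T))" "Im (z + \<i> * of_real (of_int k * T)) < T"
proof
  let ?k = "- \<lfloor>Im z / T\<rfloor>"
  have "of_int \<lfloor>Im z / T\<rfloor> * T \<le> Im z" "Im z < (of_int \<lfloor>Im z / T\<rfloor> + 1) * T"
    using assms floor_divide_lower[of T "Im z"] floor_divide_upper[of T "Im z"] by simp_all
  then show "0 \<le> Im (z + \<i> * of_real (of_int ?k * T))" "Im (z + \<i> * of_real (of_int ?k * T)) < T"
    by (simp_all add: algebra_simps)
qed

lemma band_periodic_attains_sup:
  fixes f :: "complex \<Rightarrow> real"
  assumes s: "s\<^sub>1 < s\<^sub>2" and T: "0 < T" and per: "band_periodic s\<^sub>1 s\<^sub>2 T f" and cont: "continuous_on (band s\<^sub>1 s\<^sub>2) f"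
  obtains \<xi> where "\<xi> \<in> band s\<^sub>1 s\<^sub>2" "\<And>z. z \<in> band s\<^sub>1 s\<^sub>2 \<Longrightarrow> f z \<le> f \<xi>"
proof -
  let ?K = "cbox (Complex s\<^sub>1 0) (Complex s\<^sub>2 T)"
  have sub: "?K \<subseteq> band s\<^sub>1 s\<^sub>2" by (auto simp: band_def in_cbox_complex_iff)
  have "Complex s\<^sub>1 0 \<in> ?K" using s T by (simp add: in_cbox_complex_iff)
  then obtain \<xi> where \<xi>: "\<xi> \<in> ?K" "\<And>z. z \<in> ?K \<Longrightarrow> f z \<le> f \<xi>"
    using continuous_attains_sup[OF compact_cbox, of "Complex s\<^sub>1 0" "Complex s\<^sub>2 T" f] continuous_on_subset[OF cont sub]
    by blast
  have "f z \<le> f \<xi>" if "z \<in> band s\<^sub>1 s\<^sub>2" for z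
  proof -
    obtain k :: int where k: "0 \<le> Im (z + \<i> * of_real (of_int k * T))" "Im (z + \<i> * of_real (of_int k * T)) < T"
      by (rule band_fundamental_translate[OF T])
    have "z + \<i> * of_real (of_int k * T) \<in> ?K"
      using k that by (auto simp: in_cbox_complex_iff band_def)
    from \<xi>(2)[OF this] show ?thesis by (simp only: band_periodic_of_int[OF per that])
  qed
  then show ?thesis using \<xi>(1) sub by (intro that[of \<xi>]) auto
qed

lemma band_periodic_bounded:
  fixes f :: "complex \<Rightarrow> real"
  assumes "s\<^sub>1 < s\<^sub>2" "0 < T" "band_periodic s\<^sub>1 s\<^sub>2 T f" "continuous_on (band s\<^sub>1 s\<^sub>2) f"
  obtains L where "0 < L" "\<And>z. z \<in> band s\<^sub>1 s\<^sub>2 \<Longrightarrow> \<bar>f z\<bar> \<le> L"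
proof -
  have "band_periodic s\<^sub>1 s\<^sub>2 T (\<lambda>z. \<bar>f z\<bar>)" "continuous_on (band s\<^sub>1 s\<^sub>2) (\<lambda>z. \<bar>f z\<bar>)"
    using assms by (auto simp: band_periodic_def intro: continuous_intros)
  from band_periodic_attains_sup[OF assms(1,2) this] obtain \<xi> where "\<And>z. z \<in> band s\<^sub>1 s\<^sub>2 \<Longrightarrow> \<bar>f z\<bar> \<le> \<bar>f \<xi>\<bar>" by blast
  then have "\<bar>f z\<bar> \<le> \<bar>f \<xi>\<bar> + 1" if "z \<in> band s\<^sub>1 s\<^sub>2" for z
    using that by (meson add_increasing2 zero_le_one)
  then show ?thesis by (intro that[of "\<bar>f \<xi>\<bar> + 1"]) auto
qed

text \<open>Only the real part is assumed periodic, so the maximum modulus principle is applied to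
  exp f, whose modulus is exp (Re f). If the maximum is attained inside, Re f is constant in the
  interior, hence by continuity equal to a boundary value.\<close>

lemma band_Re_max:
  fixes f :: "complex \<Rightarrow> complex"
  assumes s: "s\<^sub>1 < s\<^sub>2" and T: "0 < T" and per: "band_periodic s\<^sub>1 s\<^sub>2 T (\<lambda>z. Re (f z))"
    and cont: "continuous_on (band s\<^sub>1 s\<^sub>2) f" and hol: "f holomorphic_on interior (band s\<^sub>1 s\<^sub>2)"
    and bd: "\<And>z. z \<in> vline s\<^sub>1 \<union> vline s\<^sub>2 \<Longrightarrow> Re (f z) \<le> M" and z: "z \<in> band s\<^sub>1 s\<^sub>2"
  shows "Re (f z) \<le> M"
proof -
  let ?S = "band s\<^sub>1 s\<^sub>2"
  have contR: "continuous_on ?S (\<lambda>z. Re (f z))" by (intro continuous_intros cont)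
  obtain \<xi> where \<xi>: "\<xi> \<in> ?S" "\<And>z. z \<in> ?S \<Longrightarrow> Re (f z) \<le> Re (f \<xi>)"
    using band_periodic_attains_sup[OF s T per contR] by blast
  have "Re (f \<xi>) \<le> M"
  proof (cases "\<xi> \<in> vline s\<^sub>1 \<union> vline s\<^sub>2")
    case False
    then have int: "\<xi> \<in> interior ?S" using \<xi>(1) unfolding interior_band by (auto simp: band_def vline_def)
    have "(\<lambda>z. exp (f z)) constant_on interior ?S"
    proof (rule maximum_modulus_principle[OF _ _ _ _ _ int])
      show "connected (interior ?S)" by (intro convex_connected convex_interior convex_band)
      fix w assume "w \<in> interior ?S"
      then show "norm (exp (f w)) \<le> norm (exp (f \<xi>))" using \<xi>(2)[of w] interior_subset by auto
    qed (auto intro!: holomorphic_intros hol)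
    then obtain c where c: "\<And>w. w \<in> interior ?S \<Longrightarrow> exp (f w) = c" unfolding constant_on_def by blast
    have eq: "Re (f w) = Re (f \<xi>)" if "w \<in> interior ?S" for w
    proof -
      have "norm (exp (f w)) = norm (exp (f \<xi>))" using c[OF that] c[OF int] by simp
      then show ?thesis by simp
    qed
    have s1: "complex_of_real s\<^sub>1 \<in> ?S" using s by (simp add: band_def)
    have "Re (f (of_real s\<^sub>1)) = Re (f \<xi>)"
      by (rule band_eq_by_continuity[OF s contR continuous_on_const eq s1])
    then show ?thesis using bd[of "of_real s\<^sub>1"] by (simp add: vline_def)
  qed (use bd in blast)
  then show ?thesis using \<xi>(2)[OF z] by linarith
qed

lemma band_Re_max_abs:
  fixes f :: "complex \<Rightarrow> complex"
  assumes s: "s\<^sub>1 < s\<^sub>2" "0 < T" and per: "band_periodic s\<^sub>1 s\<^sub>2 T (\<lambda>z. Re (f z))"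
    and cont: "continuous_on (band s\<^sub>1 s\<^sub>2) f" and hol: "f holomorphic_on interior (band s\<^sub>1 s\<^sub>2)"
    and bd: "\<And>z. z \<in> vline s\<^sub>1 \<union> vline s\<^sub>2 \<Longrightarrow> \<bar>Re (f z)\<bar> \<le> M" and z: "z \<in> band s\<^sub>1 s\<^sub>2"
  shows "\<bar>Re (f z)\<bar> \<le> M"
proof -
  have bd': "Re (f w) \<le> M" "- Re (f w) \<le> M" if "w \<in> vline s\<^sub>1 \<union> vline s\<^sub>2" for w
    using bd[OF that] by linarith+
  have "Re (f z) \<le> M" by (rule band_Re_max[OF s per cont hol bd'(1) z])
  moreover have "Re (- f z) \<le> M"
    by (rule band_Re_max[OF s _ _ _ _ z, of "\<lambda>z. - f z"])
       (use per bd'(2) in \<open>auto simp: band_periodic_def intro!: continuous_intros holomorphic_intros cont hol\<close>)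
  ultimately show ?thesis by simp
qed

lemma band_Im_max_abs:
  fixes f :: "complex \<Rightarrow> complex"
  assumes s: "s\<^sub>1 < s\<^sub>2" "0 < T" and per: "band_periodic s\<^sub>1 s\<^sub>2 T (\<lambda>z. Im (f z))"
    and cont: "continuous_on (band s\<^sub>1 s\<^sub>2) f" and hol: "f holomorphic_on interior (band s\<^sub>1 s\<^sub>2)"
    and bd: "\<And>z. z \<in> vline s\<^sub>1 \<union> vline s\<^sub>2 \<Longrightarrow> \<bar>Im (f z)\<bar> \<le> M" and z: "z \<in> band s\<^sub>1 s\<^sub>2"
  shows "\<bar>Im (f z)\<bar> \<le> M"
proof -
  have "\<bar>Re (- \<i> * f z)\<bar> \<le> M"
    by (rule band_Re_max_abs[OF s _ _ _ _ z, of "\<lambda>z. - \<i> * f z"])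
       (use per bd in \<open>auto simp: band_periodic_def intro!: continuous_intros holomorphic_intros cont hol\<close>)
  then show ?thesis by simp
qed

text \<open>Subtract the affine function \<open>A * z + B\<close> whose real part takes the same two
  boundary values; the maximum principle with bound 0 then applies to the difference.\<close>

lemma band_Re_linear:
  fixes f :: "complex \<Rightarrow> complex"
  assumes s: "s\<^sub>1 < s\<^sub>2" "0 < T" and per: "band_periodic s\<^sub>1 s\<^sub>2 T (\<lambda>z. Re (f z))"
    and cont: "continuous_on (band s\<^sub>1 s\<^sub>2) f" and hol: "f holomorphic_on interior (band s\<^sub>1 s\<^sub>2)"
    and c1: "\<And>z. z \<in> vline s\<^sub>1 \<Longrightarrow> Re (f z) = C\<^sub>1" and c2: "\<And>z. z \<in> vline s\<^sub>2 \<Longrightarrow> Re (f z) = C\<^sub>2"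
  obtains A B :: real where "\<And>z. z \<in> band s\<^sub>1 s\<^sub>2 \<Longrightarrow> Re (f z) = A * Re z + B"
proof -
  define A where "A = (C\<^sub>2 - C\<^sub>1) / (s\<^sub>2 - s\<^sub>1)"
  define B where "B = C\<^sub>1 - A * s\<^sub>1"
  have "A * (s\<^sub>2 - s\<^sub>1) = C\<^sub>2 - C\<^sub>1" using s by (simp add: A_def)
  then have B2: "C\<^sub>2 = A * s\<^sub>2 + B" and B1: "C\<^sub>1 = A * s\<^sub>1 + B" by (simp_all add: B_def algebra_simps)
  have "\<bar>Re (f z - of_real A * z - of_real B)\<bar> \<le> 0" if "z \<in> band s\<^sub>1 s\<^sub>2" for z
  proof (rule band_Re_max_abs[OF s _ _ _ _ that, of "\<lambda>z. f z - of_real A * z - of_real B"])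
    show "band_periodic s\<^sub>1 s\<^sub>2 T (\<lambda>z. Re (f z - of_real A * z - of_real B))"
      using per by (simp add: band_periodic_def)
    show "\<bar>Re (f z - of_real A * z - of_real B)\<bar> \<le> 0" if "z \<in> vline s\<^sub>1 \<union> vline s\<^sub>2" for z
      using that c1[of z] c2[of z] B1 B2 by (auto simp: vline_def)
  qed (auto intro!: continuous_intros holomorphic_intros cont hol)
  then have "Re (f z) = A * Re z + B" if "z \<in> band s\<^sub>1 s\<^sub>2" for z
    using that by fastforce
  then show ?thesis by (rule that)
qed

lemma deriv_bound_Im:
  assumes r: "0 < r" and hol: "f holomorphic_on ball z r" and M: "0 < M"
    and bd: "\<And>w. w \<in> ball z r \<Longrightarrow> \<bar>Im (f w)\<bar> \<le> M"
  shows "norm (deriv f z) \<le> 2 * exp 2 * M / r"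
proof -
  \<comment> \<open>\<open>|exp (\<i> f / M)|\<close> lies between \<open>1/e\<close> and \<open>e\<close>, so Cauchy's inequality for it bounds \<open>f'\<close>.\<close>
  let ?E = "\<lambda>w. exp (\<i> * f w / of_real M)"
  have norm_E: "norm (?E w) = exp (- (Im (f w) / M))" for w by simp
  have bdE: "- 1 \<le> - (Im (f w) / M) \<and> - (Im (f w) / M) \<le> 1" if "w \<in> ball z r" for w
    using bd[OF that] M by (auto simp: field_simps abs_le_iff)
  have holE: "?E holomorphic_on ball z r" using M by (auto intro!: holomorphic_intros hol)
  have "norm ((deriv ^^ 1) ?E z) \<le> fact 1 * exp 1 / (r / 2) ^ 1"
  proof (rule Cauchy_inequality)
    show "?E holomorphic_on ball z (r / 2)" using r by (intro holomorphic_on_subset[OF holE] subset_ball) simp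
    show "continuous_on (cball z (r / 2)) ?E"
      using r by (intro holomorphic_on_imp_continuous_on holomorphic_on_subset[OF holE]) auto
    show "norm (?E x) \<le> exp 1" if "norm (z - x) = r / 2" for x
      using bdE[of x] that r unfolding norm_E by (simp add: dist_norm)
  qed (use r in simp)
  moreover have "(?E has_field_derivative (\<i> * deriv f z / of_real M) * ?E z) (at z)"
  proof -
    have "f field_differentiable at z" using hol r by (intro holomorphic_on_imp_differentiable_at[OF hol]) auto
    then have d: "(f has_field_derivative deriv f z) (at z)" by (simp add: DERIV_deriv_iff_field_differentiable)
    show ?thesis using M by (auto intro!: derivative_eq_intros d)
  qed
  ultimately have "norm (deriv f z) / M * norm (?E z) \<le> 2 * exp 1 / r"
    using M by (simp add: DERIV_imp_deriv norm_mult norm_divide mult.commute)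
  \<comment> \<open>Cauchy's inequality on the radius \<open>r / 2\<close> gives 2 e / r for the
    derivative of \<open>?E\<close>; dividing by the lower bound 1 / e of its modulus at
    \<open>z\<close> produces the constant 2 e^2.\<close>
  moreover have "exp (- 1) \<le> norm (?E z)" using bdE[of z] r unfolding norm_E by simp
  then have "norm (deriv f z) / M * exp (- 1) \<le> norm (deriv f z) / M * norm (?E z)"
    using M by (intro mult_left_mono) auto
  ultimately have "norm (deriv f z) / M * exp (- 1) \<le> 2 * exp 1 / r" by linarith
  then have "norm (deriv f z) / M * exp (- 1) * exp 1 \<le> 2 * exp 1 / r * exp 1" by (rule mult_right_mono) simp
  then have "norm (deriv f z) / M \<le> 2 * exp 2 / r"
    by (simp add: mult.assoc mult_exp_exp)
  then show ?thesis using M by (simp add: field_simps)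
qed


section \<open>Finite dimension of the solutions of a Robin problem\<close>

lemma has_real_derivative_hline:
  assumes "(f has_field_derivative d) (at (Complex t y) within band s\<^sub>1 s\<^sub>2)"
  shows "((\<lambda>t. Im (f (Complex t y))) has_real_derivative Im d) (at t within {s\<^sub>1..s\<^sub>2})"
proof -
  have c: "((\<lambda>t. Complex t y) has_derivative (\<lambda>h. h *\<^sub>R 1)) (at t within {s\<^sub>1..s\<^sub>2})"
  proof -
    have "(\<lambda>t. Complex t y) = (\<lambda>t. t *\<^sub>R 1 + \<i> * of_real y)" by (auto simp: complex_eq_iff)
    then show ?thesis by (auto intro!: derivative_eq_intros)
  qed
  have "(\<lambda>t. Complex t y) ` {s\<^sub>1..s\<^sub>2} \<subseteq> band s\<^sub>1 s\<^sub>2" by (auto simp: band_def)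
  then have "(f has_derivative (*) d) (at (Complex t y) within (\<lambda>t. Complex t y) ` {s\<^sub>1..s\<^sub>2})"
    using assms has_derivative_subset unfolding has_field_derivative_def by blast
  from diff_chain_within[OF c this] have "((\<lambda>t. f (Complex t y)) has_derivative (\<lambda>h. d * (h *\<^sub>R 1))) (at t within {s\<^sub>1..s\<^sub>2})"
    by (simp add: o_def)
  from bounded_linear.has_derivative[OF bounded_linear_Im this]
  have "((\<lambda>t. Im (f (Complex t y))) has_derivative (\<lambda>h. Im (d * (h *\<^sub>R 1)))) (at t within {s\<^sub>1..s\<^sub>2})" .
  moreover have "(\<lambda>h. Im (d * (h *\<^sub>R 1))) = (*) (Im d)" by auto
  ultimately show ?thesis by (simp only: has_field_derivative_def)
qed

text \<open>
  The horizontal derivative controls \<open>Im f\<close> on the way from the line into the band, where the interior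
  gradient estimate controls its vertical oscillation.
\<close>

lemma vline_oscillation:
  assumes s: "s\<^sub>1 < s\<^sub>2" and s01: "s\<^sub>1 \<le> s" "s \<le> s\<^sub>2"
    and f: "\<And>z. z \<in> band s\<^sub>1 s\<^sub>2 \<Longrightarrow> (f has_field_derivative f1 z) (at z within band s\<^sub>1 s\<^sub>2)"
    and M: "0 < M" "\<And>z. z \<in> band s\<^sub>1 s\<^sub>2 \<Longrightarrow> \<bar>Im (f z)\<bar> \<le> M"
    and M1: "\<And>z. z \<in> band s\<^sub>1 s\<^sub>2 \<Longrightarrow> \<bar>Im (f1 z)\<bar> \<le> M1"
    and d: "0 < d" "s\<^sub>1 + d \<le> x" "x \<le> s\<^sub>2 - d" "\<bar>s - x\<bar> \<le> d"
  shows "\<bar>Im (f (Complex s y)) - Im (f (Complex s y'))\<bar> \<le> 2 * M1 * d + 2 * exp 2 * M / d * \<bar>y - y'\<bar>"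
proof -
  let ?S = "band s\<^sub>1 s\<^sub>2"
  have x: "s\<^sub>1 < x" "x < s\<^sub>2" using d by auto
  have "0 \<le> M1" using M1[of "of_real s"] s01 by (auto simp: band_def intro: order_trans[OF abs_ge_zero])
  have hor: "\<bar>Im (f (Complex s y)) - Im (f (Complex x y))\<bar> \<le> M1 * d" for y
  proof -
    have "norm (Im (f (Complex s y)) - Im (f (Complex x y))) \<le> M1 * norm (s - x)"
    proof (rule field_differentiable_bound[of "{s\<^sub>1..s\<^sub>2}"])
      fix t assume "t \<in> {s\<^sub>1..s\<^sub>2}"
      then have t: "Complex t y \<in> ?S" by (simp add: band_def)
      show "((\<lambda>t. Im (f (Complex t y))) has_field_derivative Im (f1 (Complex t y))) (at t within {s\<^sub>1..s\<^sub>2})"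
        by (rule has_real_derivative_hline[OF f[OF t]])
      show "norm (Im (f1 (Complex t y))) \<le> M1" using M1[OF t] by simp
    qed (use s01 x in auto)
    also have "\<dots> \<le> M1 * d" using d \<open>0 \<le> M1\<close> by (intro mult_left_mono) auto
    finally show ?thesis by simp
  qed
  have int: "interior ?S \<subseteq> ?S" by (rule interior_subset)
  have deriv: "(f has_field_derivative f1 z) (at z)" if "z \<in> interior ?S" for z
    using f[OF subsetD[OF int that]] by (simp only: at_within_interior[OF that])
  have hol: "f holomorphic_on interior ?S"
    using deriv by (meson field_differentiable_at_within field_differentiable_def holomorphic_on_def)
  have "norm (f (Complex x y) - f (Complex x y')) \<le> 2 * exp 2 * M / d * norm (Complex x y - Complex x y')"
  proof (rule field_differentiable_bound[of "vline x"])
    show "convex (vline x)"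
      using convex_hyperplane[of "1::complex" x] by (simp add: vline_def inner_complex_def)
    fix z assume z: "z \<in> vline x"
    then have zi: "z \<in> interior ?S" using x by (simp add: vline_def interior_band)
    show "(f has_field_derivative f1 z) (at z within vline x)"
      by (rule has_field_derivative_at_within[OF deriv[OF zi]])
    have ball: "ball z d \<subseteq> interior ?S"
    proof
      fix w assume "w \<in> ball z d"
      then have "\<bar>Re (z - w)\<bar> < d" using abs_Re_le_cmod[of "z - w"] by (auto simp: dist_norm intro: le_less_trans)
      then show "w \<in> interior ?S" using z d by (auto simp: vline_def interior_band)
    qed
    have "norm (deriv f z) \<le> 2 * exp 2 * M / d"
      using ball int by (intro deriv_bound_Im d M holomorphic_on_subset[OF hol ball]) auto
    then show "norm (f1 z) \<le> 2 * exp 2 * M / d" using DERIV_imp_deriv[OF deriv[OF zi]] by simp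
  qed (auto simp: vline_def)
  moreover have "norm (Complex x y - Complex x y') = \<bar>y - y'\<bar>" by (simp add: cmod_def)
  moreover have "\<bar>Im (f (Complex x y) - f (Complex x y'))\<bar> \<le> norm (f (Complex x y) - f (Complex x y'))"
    by (rule abs_Im_le_cmod)
  ultimately have "\<bar>Im (f (Complex x y)) - Im (f (Complex x y'))\<bar> \<le> 2 * exp 2 * M / d * \<bar>y - y'\<bar>" by simp
  then show ?thesis using hor[of y] hor[of y'] by linarith
qed

text \<open>The set \<open>X\<close> depends only on the band, the period and \<open>L\<close>, not
  on \<open>f\<close>. This order of quantifiers matters, because the \<open>f\<close> to which the
  lemma is applied is a linear combination whose coefficients are chosen after
  \<open>X\<close>.\<close>

lemma robin_uniqueness:
  assumes s: "s\<^sub>1 < s\<^sub>2" and T: "0 < T" and L: "0 < L"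
  obtains X where "finite X" "X \<subseteq> band s\<^sub>1 s\<^sub>2"
    "\<And>f f1 z. \<lbrakk>\<And>z. z \<in> band s\<^sub>1 s\<^sub>2 \<Longrightarrow> (f has_field_derivative f1 z) (at z within band s\<^sub>1 s\<^sub>2);
       continuous_on (band s\<^sub>1 s\<^sub>2) f1; band_periodic s\<^sub>1 s\<^sub>2 T f; band_periodic s\<^sub>1 s\<^sub>2 T f1;
       \<And>z. z \<in> vline s\<^sub>1 \<union> vline s\<^sub>2 \<Longrightarrow> \<bar>Im (f1 z)\<bar> \<le> L * \<bar>Im (f z)\<bar>;
       \<And>z. z \<in> X \<Longrightarrow> Im (f z) = 0; z \<in> band s\<^sub>1 s\<^sub>2\<rbrakk> \<Longrightarrow> Im (f z) = 0"
proof -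
  let ?S = "band s\<^sub>1 s\<^sub>2"
  \<comment> \<open>The oscillation on a boundary line is bounded by 2 (L M) d + (2 e^2 M / d) r.
    The choices of \<open>d\<close> and \<open>r\<close> make each term at most M / 4, and
    \<open>d\<close> is at most half the width so that a line at distance at least \<open>d\<close>
    from both boundary lines exists.\<close>
  define d where "d = min ((s\<^sub>2 - s\<^sub>1) / 2) (1 / (8 * L))"
  have d: "0 < d" "d \<le> (s\<^sub>2 - s\<^sub>1) / 2" using s L unfolding d_def by (simp, intro min.cobounded1)
  have "d \<le> 1 / (8 * L)" by (simp add: d_def)
  then have dL: "2 * L * d \<le> 1 / 4" using L by (simp add: field_simps)
  define r where "r = d / (8 * exp 2)"
  have r: "0 < r" using d by (simp add: r_def)
  \<comment> \<open>The heights \<open>k * r\<close> with \<open>k \<le> N\<close> approximate every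
    point of a full period to within \<open>r\<close>.\<close>
  define N where "N = nat \<lceil>T / r\<rceil>"
  define X where "X = (\<lambda>k. Complex s\<^sub>1 (of_nat k * r)) ` {..N} \<union> (\<lambda>k. Complex s\<^sub>2 (of_nat k * r)) ` {..N}"
  show ?thesis
  proof (rule that[of X])
    show "finite X" by (simp add: X_def)
    show "X \<subseteq> ?S" using s by (auto simp: X_def band_def)
  next
    fix f f1 z
    assume f: "\<And>z. z \<in> ?S \<Longrightarrow> (f has_field_derivative f1 z) (at z within ?S)"
      and cont1: "continuous_on ?S f1" and per: "band_periodic s\<^sub>1 s\<^sub>2 T f" and per1: "band_periodic s\<^sub>1 s\<^sub>2 T f1"
      and robin: "\<And>z. z \<in> vline s\<^sub>1 \<union> vline s\<^sub>2 \<Longrightarrow> \<bar>Im (f1 z)\<bar> \<le> L * \<bar>Im (f z)\<bar>"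
      and X: "\<And>z. z \<in> X \<Longrightarrow> Im (f z) = 0" and z: "z \<in> ?S"
    have int: "interior ?S \<subseteq> ?S" by (rule interior_subset)
    have hol: "f holomorphic_on ?S" using f by (auto simp: holomorphic_on_def field_differentiable_def)
    then have cont: "continuous_on ?S f" by (rule holomorphic_on_imp_continuous_on)
    have holi: "f holomorphic_on interior ?S" by (rule holomorphic_on_subset[OF hol int])
    have "f1 w = deriv f w" if "w \<in> interior ?S" for w
      using f[of w] int that DERIV_imp_deriv by (metis at_within_interior subsetD)
    moreover have "deriv f holomorphic_on interior ?S" by (intro holomorphic_deriv holi open_interior)
    ultimately have holi1: "f1 holomorphic_on interior ?S" by (simp cong: holomorphic_cong)
    have perI: "band_periodic s\<^sub>1 s\<^sub>2 T (\<lambda>z. Im (f z))" "band_periodic s\<^sub>1 s\<^sub>2 T (\<lambda>z. Im (f1 z))"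
      "band_periodic s\<^sub>1 s\<^sub>2 T (\<lambda>z. \<bar>Im (f z)\<bar>)"
      using per per1 by (simp_all add: band_periodic_def)
    have vl: "vline s\<^sub>1 \<union> vline s\<^sub>2 \<subseteq> ?S" using s by (auto simp: vline_def band_def)
    have "continuous_on ?S (\<lambda>z. \<bar>Im (f z)\<bar>)" by (intro continuous_intros cont)
    then obtain \<xi> where \<xi>: "\<xi> \<in> ?S" "\<And>z. z \<in> ?S \<Longrightarrow> \<bar>Im (f z)\<bar> \<le> \<bar>Im (f \<xi>)\<bar>"
      using band_periodic_attains_sup[OF s T perI(3)] by blast
    define M where "M = \<bar>Im (f \<xi>)\<bar>"
    have M: "\<bar>Im (f w)\<bar> \<le> M" if "w \<in> ?S" for w using \<xi>(2)[OF that] by (simp add: M_def)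
    have "M = 0"
    proof (rule ccontr)
      assume "M \<noteq> 0"
      then have M0: "0 < M" by (simp add: M_def)
      \<comment> \<open>\<open>f1\<close> is itself holomorphic inside and periodic, so the maximum
        principle spreads the boundary bound on Im f1 over the whole band.\<close>
      have M1: "\<bar>Im (f1 w)\<bar> \<le> L * M" if "w \<in> ?S" for w
      proof (rule band_Im_max_abs[OF s T perI(2) cont1 holi1 _ that])
        fix w assume w: "w \<in> vline s\<^sub>1 \<union> vline s\<^sub>2"
        have "L * \<bar>Im (f w)\<bar> \<le> L * M" using M[of w] vl w L by (intro mult_left_mono) auto
        then show "\<bar>Im (f1 w)\<bar> \<le> L * M" using robin[OF w] by linarith
      qed
      have osc: "\<bar>Im (f (Complex t y)) - Im (f (Complex t y'))\<bar> \<le> M / 2"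
        if "t = s\<^sub>1 \<or> t = s\<^sub>2" "\<bar>y - y'\<bar> \<le> r" for t y y'
      proof -
        define x where "x = (if t = s\<^sub>1 then s\<^sub>1 + d else s\<^sub>2 - d)"
        have "s\<^sub>1 + d \<le> x" "x \<le> s\<^sub>2 - d" "\<bar>t - x\<bar> \<le> d" using d that(1) by (auto simp: x_def)
        then have "\<bar>Im (f (Complex t y)) - Im (f (Complex t y'))\<bar> \<le> 2 * (L * M) * d + 2 * exp 2 * M / d * \<bar>y - y'\<bar>"
          using that(1) s d by (intro vline_oscillation[OF s _ _ f M0 M M1]) auto
        also have "2 * exp 2 * M / d * \<bar>y - y'\<bar> \<le> 2 * exp 2 * M / d * r"
          using that(2) M0 d by (intro mult_left_mono) auto
        also have "2 * exp 2 * M / d * r = M / 4" using d by (simp add: r_def)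
        also have "2 * (L * M) * d \<le> M / 4" using mult_left_mono[OF dL, of M] M0 by (simp add: ac_simps)
        finally show ?thesis by simp
      qed
      have "\<bar>Im (f w)\<bar> \<le> M / 2" if w: "w \<in> vline s\<^sub>1 \<union> vline s\<^sub>2" for w
      proof -
        obtain k :: int where k: "0 \<le> Im (w + \<i> * of_real (of_int k * T))" "Im (w + \<i> * of_real (of_int k * T)) < T"
          by (rule band_fundamental_translate[OF T])
        define t y where "t = Re w" and "y = Im (w + \<i> * of_real (of_int k * T))"
        have t: "t = s\<^sub>1 \<or> t = s\<^sub>2" using w by (auto simp: vline_def t_def)
        have "Complex t y = w + \<i> * of_real (of_int k * T)" by (simp add: complex_eq_iff t_def y_def)
        then have fw: "f (Complex t y) = f w" using band_periodic_of_int[OF per] w vl by (metis subsetD)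
        define j where "j = nat \<lfloor>y / r\<rfloor>"
        have y: "0 \<le> y" "y \<le> T" using k by (auto simp: y_def)
        have j: "real j = of_int \<lfloor>y / r\<rfloor>" using y r by (simp add: j_def)
        have "of_int \<lfloor>y / r\<rfloor> * r \<le> y" "y < (of_int \<lfloor>y / r\<rfloor> + 1) * r"
          using floor_divide_lower[OF r, of y] floor_divide_upper[OF r, of y] by simp_all
        then have "\<bar>y - real j * r\<bar> \<le> r" unfolding j by (simp add: algebra_simps)
        moreover have "j \<le> N"
        proof -
          have "\<lfloor>y / r\<rfloor> \<le> \<lceil>T / r\<rceil>" using y r by (meson divide_right_mono floor_mono floor_le_ceiling order_trans less_imp_le)
          then show ?thesis by (simp add: j_def N_def nat_mono)
        qed
        then have "Complex t (real j * r) \<in> X" using t by (auto simp: X_def)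
        ultimately show ?thesis using osc[OF t, of y "real j * r"] X fw by fastforce
      qed
      from band_Im_max_abs[OF s T perI(1) cont holi this \<xi>(1)] have "M \<le> M / 2" by (simp add: M_def)
      then show False using M0 by simp
    qed
    then show "Im (f z) = 0" using M[OF z] by simp
  qed
qed

text \<open>Gaussian elimination: if equation \<open>x\<close> is not trivial, it is solved for the
  unknown with pivot index \<open>p\<close>. The coefficients \<open>w\<close> are those of the
  remaining system, and \<open>c\<close> is the value obtained by back substitution.\<close>

lemma linear_dependence_finite:
  fixes v :: "'i \<Rightarrow> 'j \<Rightarrow> real"
  assumes "finite K" "finite J" "card K < card J"
  obtains a where "\<exists>j\<in>J. a j \<noteq> 0" "\<And>i. i \<in> K \<Longrightarrow> (\<Sum>j\<in>J. a j * v j i) = 0"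
proof -
  have "\<exists>a. (\<exists>j\<in>J. a j \<noteq> 0) \<and> (\<forall>i\<in>K. (\<Sum>j\<in>J. a j * v j i) = 0)"
    using assms
  proof (induction K arbitrary: J v rule: finite_induct)
    case empty
    then have "J \<noteq> {}" by auto
    then show ?case by (intro exI[of _ "\<lambda>_. 1"]) auto
  next
    case (insert x K)
    show ?case
    proof (cases "\<forall>j\<in>J. v j x = 0")
      case True
      obtain a where "\<exists>j\<in>J. a j \<noteq> 0" "\<forall>i\<in>K. (\<Sum>j\<in>J. a j * v j i) = 0"
        using insert.IH[OF insert.prems(1), of v] insert.prems insert.hyps by auto
      with True show ?thesis by (intro exI[of _ a]) auto
    next
      case False
      then obtain p where p: "p \<in> J" "v p x \<noteq> 0" by blast
      define w where "w j i = v j i - v j x / v p x * v p i" for j i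
      have "card K < card (J - {p})" using insert.prems insert.hyps p by simp
      then obtain a where a: "\<exists>j\<in>J - {p}. a j \<noteq> 0" "\<forall>i\<in>K. (\<Sum>j\<in>J - {p}. a j * w j i) = 0"
        using insert.IH[of "J - {p}" w] insert.prems by auto
      define c where "c = - (\<Sum>j\<in>J - {p}. a j * v j x) / v p x"
      have sum: "(\<Sum>j\<in>J. (a(p := c)) j * v j i) = (\<Sum>j\<in>J - {p}. a j * w j i)" for i
      proof -
        have "(\<Sum>j\<in>J. (a(p := c)) j * v j i) = c * v p i + (\<Sum>j\<in>J - {p}. a j * v j i)"
          using p(1) insert.prems(1) by (subst sum.remove[of J p]) (auto intro!: sum.cong)
        also have "\<dots> = (\<Sum>j\<in>J - {p}. a j * w j i)"
          by (simp add: w_def c_def right_diff_distrib sum_subtractf sum_divide_distrib sum_distrib_left sum_negf ac_simps)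
        finally show ?thesis .
      qed
      have "(\<Sum>j\<in>J - {p}. a j * w j x) = 0" using p by (simp add: w_def)
      then have "\<forall>i\<in>insert x K. (\<Sum>j\<in>J. (a(p := c)) j * v j i) = 0" unfolding sum using a(2) by simp
      moreover have "\<exists>j\<in>J. (a(p := c)) j \<noteq> 0" using a(1) by auto
      ultimately show ?thesis by blast
    qed
  qed
  then show ?thesis using that by blast
qed

text \<open>All \<open>f j\<close> share the coefficient \<open>lam\<close>, so the Robin condition
  is inherited by real linear combinations. Among \<open>card X + 1\<close> functions some
  nontrivial combination has vanishing imaginary part on \<open>X\<close>, and
  \<open>robin_uniqueness\<close> makes its imaginary part vanish on the band.\<close>

lemma robin_finite_dimension:
  fixes f f1 :: "nat \<Rightarrow> complex \<Rightarrow> complex" and lam :: "complex \<Rightarrow> real"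
  assumes s: "s\<^sub>1 < s\<^sub>2" and T: "0 < T"
    and f: "\<And>j z. z \<in> band s\<^sub>1 s\<^sub>2 \<Longrightarrow> (f j has_field_derivative f1 j z) (at z within band s\<^sub>1 s\<^sub>2)"
    and cont1: "\<And>j. continuous_on (band s\<^sub>1 s\<^sub>2) (f1 j)"
    and per: "\<And>j. band_periodic s\<^sub>1 s\<^sub>2 T (f j)" and per1: "\<And>j. band_periodic s\<^sub>1 s\<^sub>2 T (f1 j)"
    and robin: "\<And>j z. z \<in> vline s\<^sub>1 \<union> vline s\<^sub>2 \<Longrightarrow> Im (f1 j z) = lam z * Im (f j z)"
    and lam: "0 < L" "\<And>z. z \<in> vline s\<^sub>1 \<union> vline s\<^sub>2 \<Longrightarrow> \<bar>lam z\<bar> \<le> L"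
  shows "\<exists>m. \<exists>c :: nat \<Rightarrow> real. \<forall>z\<in>band s\<^sub>1 s\<^sub>2. Im (f m z) = (\<Sum>j<m. c j * Im (f j z))"
proof (rule robin_uniqueness[OF s T lam(1)])
  let ?S = "band s\<^sub>1 s\<^sub>2"
  fix X :: "complex set"
  assume X: "finite X" "X \<subseteq> ?S" and uniq: "\<And>f f1 z. \<lbrakk>\<And>z. z \<in> band s\<^sub>1 s\<^sub>2 \<Longrightarrow> (f has_field_derivative f1 z) (at z within band s\<^sub>1 s\<^sub>2);
       continuous_on (band s\<^sub>1 s\<^sub>2) f1; band_periodic s\<^sub>1 s\<^sub>2 T f; band_periodic s\<^sub>1 s\<^sub>2 T f1;
       \<And>z. z \<in> vline s\<^sub>1 \<union> vline s\<^sub>2 \<Longrightarrow> \<bar>Im (f1 z)\<bar> \<le> L * \<bar>Im (f z)\<bar>;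
       \<And>z. z \<in> X \<Longrightarrow> Im (f z) = 0; z \<in> band s\<^sub>1 s\<^sub>2\<rbrakk> \<Longrightarrow> Im (f z) = 0"
  obtain a where a: "\<exists>j\<in>{..card X}. a j \<noteq> 0" "\<And>z. z \<in> X \<Longrightarrow> (\<Sum>j\<le>card X. a j * Im (f j z)) = 0"
    using linear_dependence_finite[OF X(1), of "{..card X}" "\<lambda>j z. Im (f j z)"] by auto
  define g g1 where "g z = (\<Sum>j\<le>card X. of_real (a j) * f j z)" and "g1 z = (\<Sum>j\<le>card X. of_real (a j) * f1 j z)" for z
  have Im_g: "Im (g z) = (\<Sum>j\<le>card X. a j * Im (f j z))" "Im (g1 z) = (\<Sum>j\<le>card X. a j * Im (f1 j z))" for z
    by (simp_all add: g_def g1_def)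
  have zero: "Im (g z) = 0" if z: "z \<in> ?S" for z
  proof (rule uniq[of g g1, OF _ _ _ _ _ _ z])
    show "(g has_field_derivative g1 z) (at z within ?S)" if "z \<in> ?S" for z
      unfolding g_def g1_def by (intro DERIV_sum DERIV_cmult f that)
    show "continuous_on ?S g1" unfolding g1_def by (intro continuous_intros cont1)
    show "band_periodic s\<^sub>1 s\<^sub>2 T g" "band_periodic s\<^sub>1 s\<^sub>2 T g1"
      using per per1 by (simp_all add: band_periodic_def g_def g1_def)
    show "\<bar>Im (g1 z)\<bar> \<le> L * \<bar>Im (g z)\<bar>" if z: "z \<in> vline s\<^sub>1 \<union> vline s\<^sub>2" for z
    proof -
      have "Im (g1 z) = lam z * Im (g z)"
        unfolding Im_g sum_distrib_left by (intro sum.cong refl) (simp add: robin[OF z])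
      then show ?thesis using lam(2)[OF z] by (simp add: abs_mult mult_right_mono)
    qed
    show "Im (g z) = 0" if "z \<in> X" for z unfolding Im_g by (rule a(2)[OF that])
  qed
  \<comment> \<open>The last index with a nonzero coefficient: the relation can be solved for this
    function in terms of the earlier ones only.\<close>
  define m where "m = (GREATEST j. j \<le> card X \<and> a j \<noteq> 0)"
  have m: "m \<le> card X \<and> a m \<noteq> 0" unfolding m_def
    by (rule GreatestI_ex_nat[of _ "card X"]) (use a(1) in auto)
  have top: "j \<le> m" if "j \<le> card X" "a j \<noteq> 0" for j unfolding m_def
    by (rule Greatest_le_nat[of _ _ "card X"]) (use that in auto)
  have rel: "Im (f m z) = (\<Sum>j<m. - (a j / a m) * Im (f j z))" if z: "z \<in> ?S" for z
  proof -
    have "(\<Sum>j\<le>card X. a j * Im (f j z)) = (\<Sum>j\<le>m. a j * Im (f j z))"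
      using m top by (intro sum.mono_neutral_right) (auto simp: not_le)
    also have "\<dots> = (\<Sum>j<m. a j * Im (f j z)) + a m * Im (f m z)"
      by (simp add: lessThan_Suc_atMost[symmetric])
    finally have "a m * Im (f m z) = - (\<Sum>j<m. a j * Im (f j z))" using zero[OF z] by (simp add: Im_g)
    then have "Im (f m z) = - (\<Sum>j<m. a j * Im (f j z)) / a m" using m by (simp add: field_simps)
    then show ?thesis by (simp add: sum_divide_distrib sum_negf)
  qed
  show "\<exists>m. \<exists>c :: nat \<Rightarrow> real. \<forall>z\<in>?S. Im (f m z) = (\<Sum>j<m. c j * Im (f j z))"
    by (intro exI[of _ m] exI[of _ "\<lambda>j. - (a j / a m)"] ballI rel)
qed

section \<open>The Robin condition along a boundary line\<close>

lemma sum_Im_convolution: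
  fixes f :: "nat \<Rightarrow> complex"
  shows
  "(\<Sum>i<n. Im (f i * f (n - Suc i))) = 2 * (\<Sum>i<n. Re (f (n - Suc i)) * Im (f i))"
proof -
  have "(\<Sum>i<n. Re (f i) * Im (f (n - Suc i))) = (\<Sum>i<n. Re (f (n - Suc i)) * Im (f i))"
    by (subst sum.nat_diff_reindex[symmetric]) (auto intro!: sum.cong)
  then show ?thesis by (simp add: sum.distrib mult.commute)
qed

lemma sum_Im_convolution_atMost:
  fixes f :: "nat \<Rightarrow> complex"
  shows
  "(\<Sum>i\<le>n. Im (f i * f (n - i))) = 2 * (\<Sum>i\<le>n. Re (f (n - i)) * Im (f i))"
  using sum_Im_convolution[of f "Suc n"] by (simp only: lessThan_Suc_atMost diff_Suc_Suc)

lemma has_real_derivative_Re: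
  "(f has_vector_derivative d) F \<Longrightarrow> ((\<lambda>y. Re (f y)) has_real_derivative Re d) F"
  using bounded_linear.has_vector_derivative[OF bounded_linear_Re]
  by (simp add: has_real_derivative_iff_has_vector_derivative)

lemma has_real_derivative_Im:
  "(f has_vector_derivative d) F \<Longrightarrow> ((\<lambda>y. Im (f y)) has_real_derivative Im d) F"
  using bounded_linear.has_vector_derivative[OF bounded_linear_Im]
  by (simp add: has_real_derivative_iff_has_vector_derivative)

text \<open>
  Along a boundary line all functions depend on \<open>y\<close> only, and \<open>\<partial>\<^sub>y = \<i> \<partial>\<^sub>z\<close>.  The Robin condition for
  \<open>Q\<close> reads \<open>Im Q' = \<lambda> Im Q\<close>; the derivative of \<open>\<lambda>\<close> comes from the equation satisfied by \<open>\<omega>\<^sub>x\<close> on the line.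
\<close>

locale robin_line =
  fixes Q Q1 Q2 Q3 B :: "nat \<Rightarrow> real \<Rightarrow> complex" and \<eta> \<eta>1 :: "real \<Rightarrow> complex" and lam :: "real \<Rightarrow> real"
  assumes dQ: "\<And>n y. (Q n has_vector_derivative \<i> * Q1 n y) (at y)"
    and dQ1: "\<And>n y. (Q1 n has_vector_derivative \<i> * Q2 n y) (at y)"
    and dQ2: "\<And>n y. (Q2 n has_vector_derivative \<i> * Q3 n y) (at y)"
    and d\<eta>: "\<And>y. (\<eta> has_vector_derivative \<i> * \<eta>1 y) (at y)"
    and dlam: "\<And>y. (lam has_real_derivative - 4 * Re (\<eta> y) * Im (\<eta> y)) (at y)"
    and Q_0: "\<And>y. Q 0 y = \<eta> y" "\<And>y. Q1 0 y = \<eta>1 y"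
    and Q_Suc: "\<And>n y. Q (Suc n) y = Q2 n y - 4 * \<eta> y * B n y"
    and Q1_Suc: "\<And>n y. Q1 (Suc n) y = Q3 n y - 4 * \<eta>1 y * B n y - 4 * \<eta> y * (\<eta> y * Q1 n y)"
    and two_B: "\<And>n y. 2 * B n y = (\<Sum>i\<le>n. Q i y * Q (n - i) y) - (\<Sum>i<n. Q1 i y * Q1 (n - Suc i) y)
       + 4 * (\<Sum>i<n. B i y * B (n - Suc i) y)"
    and robin_\<eta>: "\<And>y. Im (\<eta>1 y) = lam y * Im (\<eta> y)"
begin

text \<open>The Robin condition holds identically along the line, so it may be differentiated in
  \<open>y\<close>; since \<partial>_y is multiplication of the complex derivative by \<i>, real and
  imaginary parts are exchanged.\<close>

lemma robin_deriv:
  assumes "\<And>y. Im (Q1 n y) = lam y * Im (Q n y)"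
  shows "Re (Q2 n y) = - 4 * Re (\<eta> y) * Im (\<eta> y) * Im (Q n y) + lam y * Re (Q1 n y)"
proof -
  have "((\<lambda>y. Im (Q1 n y)) has_real_derivative Re (Q2 n y)) (at y)"
    using has_real_derivative_Im[OF dQ1[of n y]] by simp
  moreover have "((\<lambda>y. lam y * Im (Q n y)) has_real_derivative
     - 4 * Re (\<eta> y) * Im (\<eta> y) * Im (Q n y) + Re (Q1 n y) * lam y) (at y)"
    using DERIV_mult[OF dlam has_real_derivative_Im[OF dQ[of n y]]] by simp
  ultimately show ?thesis unfolding assms by (metis DERIV_unique mult.commute)
qed

lemma robin_deriv2:
  assumes "\<And>y. Im (Q1 n y) = lam y * Im (Q n y)"
  shows "- Im (Q3 n y) = 4 * Im (\<eta>1 y) * Im (\<eta> y) * Im (Q n y) - 4 * Re (\<eta> y) * Re (\<eta>1 y) * Im (Q n y)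
      - 8 * Re (\<eta> y) * Im (\<eta> y) * Re (Q1 n y) - lam y * Im (Q2 n y)"
proof -
  have D: "((\<lambda>y. Re (Q2 n y)) has_real_derivative - Im (Q3 n y)) (at y)"
    "((\<lambda>y. Re (Q1 n y)) has_real_derivative - Im (Q2 n y)) (at y)"
    "((\<lambda>y. Im (Q n y)) has_real_derivative Re (Q1 n y)) (at y)"
    "((\<lambda>y. Re (\<eta> y)) has_real_derivative - Im (\<eta>1 y)) (at y)"
    "((\<lambda>y. Im (\<eta> y)) has_real_derivative Re (\<eta>1 y)) (at y)"
    using has_real_derivative_Re[OF dQ2[of n y]] has_real_derivative_Re[OF dQ1[of n y]]
      has_real_derivative_Im[OF dQ[of n y]] has_real_derivative_Re[OF d\<eta>[of y]] has_real_derivative_Im[OF d\<eta>[of y]]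
    by simp_all
  have "((\<lambda>y. - 4 * Re (\<eta> y) * Im (\<eta> y) * Im (Q n y) + lam y * Re (Q1 n y)) has_real_derivative
      4 * Im (\<eta>1 y) * Im (\<eta> y) * Im (Q n y) - 4 * Re (\<eta> y) * Re (\<eta>1 y) * Im (Q n y)
      - 8 * Re (\<eta> y) * Im (\<eta> y) * Re (Q1 n y) - lam y * Im (Q2 n y)) (at y)"
    by (rule derivative_eq_intros D dlam refl)+ (simp add: algebra_simps)
  with D(1) show ?thesis unfolding robin_deriv[OF assms] by (rule DERIV_unique)
qed

text \<open>Same cancellation as in \<open>mkdv_prim_step\<close>, with imaginary parts in place of
  derivatives. The differentiated Robin condition turns the recursion into Re Q(k+1) = lam Re Q1(k)
  - 4 Re \<eta> Re B(k), so all products with index \<open>i < n\<close> cancel in the imaginary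
  part of the quadratic relation. What remains is the product with
  \<open>Re (Q 0 y) = Re (\<eta> y)\<close>, without any constant of integration.\<close>

lemma robin_B:
  assumes "\<And>i y. i < n \<Longrightarrow> Im (Q1 i y) = lam y * Im (Q i y)"
    and "\<And>i y. i < n \<Longrightarrow> Im (B i y) = Re (\<eta> y) * Im (Q i y)"
  shows "Im (B n y) = Re (\<eta> y) * Im (Q n y)"
proof -
  have Re_Q: "Re (Q (Suc k) y) = lam y * Re (Q1 k y) - 4 * Re (\<eta> y) * Re (B k y)" if "k < n" for k
    using robin_deriv[of k y] assms that by (simp add: Q_Suc algebra_simps)
  have Im4: "Im (4 * z) = 4 * Im z" for z by simp
  have "2 * Im (B n y) = Im (2 * B n y)" by simp
  also have "\<dots> = 2 * (\<Sum>i\<le>n. Re (Q (n - i) y) * Im (Q i y)) - 2 * (\<Sum>i<n. Re (Q1 (n - Suc i) y) * Im (Q1 i y))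
      + 8 * (\<Sum>i<n. Re (B (n - Suc i) y) * Im (B i y))"
    unfolding two_B using sum_Im_convolution_atMost[of "\<lambda>i. Q i y" n] sum_Im_convolution[of "\<lambda>i. Q1 i y" n]
      sum_Im_convolution[of "\<lambda>i. B i y" n]
    by (simp add: Im4 del: times_complex.sel)
  also have "(\<Sum>i\<le>n. Re (Q (n - i) y) * Im (Q i y)) = Re (\<eta> y) * Im (Q n y) + (\<Sum>i<n. Re (Q (n - i) y) * Im (Q i y))"
    by (simp add: lessThan_Suc_atMost[symmetric] Q_0)
  also have "(\<Sum>i<n. Re (Q (n - i) y) * Im (Q i y))
     = (\<Sum>i<n. Re (Q1 (n - Suc i) y) * Im (Q1 i y)) - 4 * (\<Sum>i<n. Re (B (n - Suc i) y) * Im (B i y))"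
    unfolding sum_distrib_left sum_subtractf[symmetric]
  proof (intro sum.cong refl)
    fix i assume "i \<in> {..<n}"
    then have i: "i < n" "n - Suc i < n" "n - i = Suc (n - Suc i)" by auto
    show "Re (Q (n - i) y) * Im (Q i y) = Re (Q1 (n - Suc i) y) * Im (Q1 i y) - 4 * (Re (B (n - Suc i) y) * Im (B i y))"
      unfolding i(3) Re_Q[OF i(2)] assms(1)[OF i(1)] assms(2)[OF i(1)] by (simp add: algebra_simps)
  qed
  finally show ?thesis by simp
qed

text \<open>The terms containing Re B cancel by the Robin condition for \<eta>. After Im B is
  replaced, the others cancel against the twice differentiated Robin condition.\<close>

lemma robin_Q_Suc:
  assumes Q: "\<And>y. Im (Q1 n y) = lam y * Im (Q n y)" and B: "Im (B n y) = Re (\<eta> y) * Im (Q n y)"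
  shows "Im (Q1 (Suc n) y) = lam y * Im (Q (Suc n) y)"
  using robin_deriv2[OF Q, of y] unfolding Q_Suc Q1_Suc
  by (simp add: B Q robin_\<eta> algebra_simps)

theorem robin: "Im (Q1 n y) = lam y * Im (Q n y) \<and> Im (B n y) = Re (\<eta> y) * Im (Q n y)"
proof (induction n arbitrary: y rule: less_induct)
  case (less n)
  have B: "Im (B n y) = Re (\<eta> y) * Im (Q n y)" for y
    by (rule robin_B[OF less.IH[THEN conjunct1] less.IH[THEN conjunct2]])
  have "Im (Q1 n y) = lam y * Im (Q n y)" for y
  proof (cases n)
    case 0
    then show ?thesis by (simp add: Q_0 robin_\<eta>)
  next
    case (Suc m)
    then have m: "m < n" by simp
    show ?thesis
      unfolding Suc by (rule robin_Q_Suc[OF less.IH[OF m, THEN conjunct1] less.IH[OF m, THEN conjunct2]])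
  qed
  with B show ?case by blast
qed

end

section \<open>Derivatives of harmonic functions\<close>

text \<open>The second difference is symmetric in the directions \<open>p\<close> and
  \<open>q\<close>. Applying the lemma in both orders equates the two mixed derivatives at points
  close to \<open>w\<close>.\<close>

lemma second_difference_MVT:
  fixes f fp fpq :: "complex \<Rightarrow> real"
  assumes t: "0 < t"
    and fp: "\<And>r r'. \<lbrakk>0 \<le> r; r \<le> t; 0 \<le> r'; r' \<le> t\<rbrakk> \<Longrightarrow>
       ((\<lambda>r. f (w + of_real r * p + of_real r' * q)) has_real_derivative fp (w + of_real r * p + of_real r' * q)) (at r)"
    and fpq: "\<And>r r'. \<lbrakk>0 \<le> r; r \<le> t; 0 \<le> r'; r' \<le> t\<rbrakk> \<Longrightarrow>
       ((\<lambda>r'. fp (w + of_real r * p + of_real r' * q)) has_real_derivative fpq (w + of_real r * p + of_real r' * q)) (at r')"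
  obtains r r' where "0 \<le> r" "r \<le> t" "0 \<le> r'" "r' \<le> t"
    "f (w + of_real t * p + of_real t * q) - f (w + of_real t * p) - f (w + of_real t * q) + f w
       = t * (t * fpq (w + of_real r * p + of_real r' * q))"
proof -
  define \<phi> where "\<phi> r = f (w + of_real r * p + of_real t * q) - f (w + of_real r * p + of_real 0 * q)" for r
  have "\<exists>r>0. r < t \<and> \<phi> t - \<phi> 0 = (t - 0) * (fp (w + of_real r * p + of_real t * q) - fp (w + of_real r * p + of_real 0 * q))"
    unfolding \<phi>_def using t by (intro MVT2 DERIV_diff fp) auto
  then obtain r where r: "0 < r" "r < t"
    "\<phi> t - \<phi> 0 = t * (fp (w + of_real r * p + of_real t * q) - fp (w + of_real r * p + of_real 0 * q))" by auto
  have "\<exists>r'>0. r' < t \<and> fp (w + of_real r * p + of_real t * q) - fp (w + of_real r * p + of_real 0 * q)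
      = (t - 0) * fpq (w + of_real r * p + of_real r' * q)"
    using t r by (intro MVT2 fpq) auto
  then obtain r' where "0 < r'" "r' < t" "fp (w + of_real r * p + of_real t * q) - fp (w + of_real r * p + of_real 0 * q)
      = t * fpq (w + of_real r * p + of_real r' * q)" by auto
  with r show ?thesis by (intro that[of r r']) (auto simp: \<phi>_def)
qed

lemma has_real_derivative_direction:
  fixes f :: "complex \<Rightarrow> real"
  assumes "(f has_derivative L) (at (a + of_real r * p))"
  shows "((\<lambda>r. f (a + of_real r * p)) has_real_derivative L p) (at r)"
proof -
  have c: "((\<lambda>r. a + of_real r * p) has_derivative (\<lambda>h. h *\<^sub>R p)) (at r)"
    by (auto intro!: derivative_eq_intros simp: scaleR_conv_of_real)
  from has_derivative_compose[OF c assms] have "((\<lambda>r. f (a + of_real r * p)) has_derivative (\<lambda>h. L (h *\<^sub>R p))) (at r)" .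
  moreover interpret bounded_linear L using assms by (rule has_derivative_bounded_linear)
  have "(\<lambda>h. L (h *\<^sub>R p)) = (*) (L p)" by (auto simp: scaleR)
  ultimately show ?thesis by (simp add: has_field_derivative_def)
qed

lemma
  assumes "open \<Omega>" "w \<in> \<Omega>" "f differentiable_on \<Omega>"
  shows pd_has_derivative: "(f has_derivative frechet_derivative f (at w)) (at w)"
    and pdx_open: "pdx \<Omega> f w = frechet_derivative f (at w) 1"
    and pdy_open: "pdy \<Omega> f w = frechet_derivative f (at w) \<i>"
  using assms(3)[unfolded differentiable_on_def, rule_format, OF assms(2)]
  by (simp_all only: at_within_open[OF assms(2,1)] frechet_derivative_works pdx_def pdy_def)

lemma frechet_derivative_partials:
  fixes f :: "complex \<Rightarrow> 'b::real_normed_vector"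
  assumes "(f has_derivative L) F"
  shows "L h = Re h *\<^sub>R L 1 + Im h *\<^sub>R L \<i>"
proof -
  interpret bounded_linear L using assms by (rule has_derivative_bounded_linear)
  have "h = Re h *\<^sub>R 1 + Im h *\<^sub>R \<i>" by (simp add: complex_eq_iff)
  then show ?thesis by (metis add scaleR)
qed

lemma pd_commute:
  fixes f :: "complex \<Rightarrow> real"
  assumes \<Omega>: "open \<Omega>" and C: "Ck_on 2 \<Omega> f" and w: "w \<in> \<Omega>"
  shows "pdy \<Omega> (pdx \<Omega> f) w = pdx \<Omega> (pdy \<Omega> f) w"
proof -
  let ?x = "pdx \<Omega> f" and ?y = "pdy \<Omega> f"
  have diff: "f differentiable_on \<Omega>" "?x differentiable_on \<Omega>" "?y differentiable_on \<Omega>"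
    and cont: "continuous_on \<Omega> (pdy \<Omega> ?x)" "continuous_on \<Omega> (pdx \<Omega> ?y)"
    using C by (auto simp: numeral_2_eq_2)
  have Dx: "((\<lambda>r. g (a + of_real r * 1 + b)) has_real_derivative pdx \<Omega> g (a + of_real r * 1 + b)) (at r)"
    if "g differentiable_on \<Omega>" "a + of_real r * 1 + b \<in> \<Omega>" for g :: "complex \<Rightarrow> real" and a b r
  proof -
    have eq: "a + of_real r * 1 + b = (a + b) + of_real r * 1" for r by simp
    have p: "(a + b) + of_real r * 1 \<in> \<Omega>" using that(2) by (simp only: eq)
    show ?thesis unfolding eq pdx_open[OF \<Omega> p that(1)]
      by (rule has_real_derivative_direction[OF pd_has_derivative[OF \<Omega> p that(1)]])
  qed
  have Dy: "((\<lambda>r. g (a + of_real r * \<i> + b)) has_real_derivative pdy \<Omega> g (a + of_real r * \<i> + b)) (at r)"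
    if "g differentiable_on \<Omega>" "a + of_real r * \<i> + b \<in> \<Omega>" for g :: "complex \<Rightarrow> real" and a b r
  proof -
    have eq: "a + of_real r * \<i> + b = (a + b) + of_real r * \<i>" for r by simp
    have p: "(a + b) + of_real r * \<i> \<in> \<Omega>" using that(2) by (simp only: eq)
    show ?thesis unfolding eq pdy_open[OF \<Omega> p that(1)]
      by (rule has_real_derivative_direction[OF pd_has_derivative[OF \<Omega> p that(1)]])
  qed
  have close: "\<bar>pdy \<Omega> ?x w - pdx \<Omega> ?y w\<bar> \<le> e" if e: "0 < e" for e
  proof -
    obtain d0 where d0: "0 < d0" "ball w d0 \<subseteq> \<Omega>" using \<Omega> w open_contains_ball by blast
    obtain d1 where d1: "0 < d1" "\<And>z. z \<in> \<Omega> \<Longrightarrow> dist z w < d1 \<Longrightarrow> dist (pdy \<Omega> ?x z) (pdy \<Omega> ?x w) < e / 2"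
      using cont(1) w e unfolding continuous_on_iff by (meson half_gt_zero)
    obtain d2 where d2: "0 < d2" "\<And>z. z \<in> \<Omega> \<Longrightarrow> dist z w < d2 \<Longrightarrow> dist (pdx \<Omega> ?y z) (pdx \<Omega> ?y w) < e / 2"
      using cont(2) w e unfolding continuous_on_iff by (meson half_gt_zero)
    \<comment> \<open>A point of the square of side \<open>t\<close> with corner \<open>w\<close>
      has distance at most \<open>2 * t\<close> from \<open>w\<close>, hence lies in each of the
      three balls.\<close>
    define t where "t = min d0 (min d1 d2) / 3"
    have t: "0 < t" "3 * t \<le> d0" "3 * t \<le> d1" "3 * t \<le> d2" using d0 d1 d2 by (auto simp: t_def)
    have near: "dist (w + of_real r * 1 + of_real r' * \<i>) w < 3 * t"
      if "0 \<le> r" "r \<le> t" "0 \<le> r'" "r' \<le> t" for r r'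
    proof -
      have "norm (of_real r * 1 + of_real r' * \<i>) \<le> norm (of_real r * 1 :: complex) + norm (of_real r' * \<i>)"
        by (rule norm_triangle_ineq)
      also have "\<dots> < 3 * t" using that t by (simp add: norm_mult)
      finally show ?thesis by (simp add: dist_norm add.assoc)
    qed
    have in\<Omega>: "w + of_real r * 1 + of_real r' * \<i> \<in> \<Omega>" if "0 \<le> r" "r \<le> t" "0 \<le> r'" "r' \<le> t" for r r'
      using near[OF that] t d0 by (intro subsetD[OF d0(2)]) (simp add: dist_commute)
    have in\<Omega>': "w + of_real r' * \<i> + of_real r * 1 \<in> \<Omega>" if "0 \<le> r" "r \<le> t" "0 \<le> r'" "r' \<le> t" for r r'
      using in\<Omega>[OF that] by (simp add: ac_simps)
    obtain r r' where r: "0 \<le> r" "r \<le> t" "0 \<le> r'" "r' \<le> t"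
      "f (w + of_real t * 1 + of_real t * \<i>) - f (w + of_real t * 1) - f (w + of_real t * \<i>) + f w
         = t * (t * pdy \<Omega> ?x (w + of_real r * 1 + of_real r' * \<i>))"
      by (rule second_difference_MVT[OF t(1), of f w 1 \<i> ?x "pdy \<Omega> ?x"])
         (use Dx[OF diff(1)] Dy[OF diff(2), of _ _ 0] in\<Omega> in \<open>simp_all only: add_0_right\<close>)
    obtain l l' where l: "0 \<le> l" "l \<le> t" "0 \<le> l'" "l' \<le> t"
      "f (w + of_real t * \<i> + of_real t * 1) - f (w + of_real t * \<i>) - f (w + of_real t * 1) + f w
         = t * (t * pdx \<Omega> ?y (w + of_real l * \<i> + of_real l' * 1))"
      by (rule second_difference_MVT[OF t(1), of f w \<i> 1 ?y "pdx \<Omega> ?y"])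
         (use Dy[OF diff(1)] Dx[OF diff(3), of _ _ 0] in\<Omega>' in \<open>simp_all only: add_0_right\<close>)
    have comm: "w + of_real a * \<i> + of_real b * 1 = w + of_real b * 1 + of_real a * \<i>" for a b :: real by simp
    have "t * (t * pdy \<Omega> ?x (w + of_real r * 1 + of_real r' * \<i>)) = t * (t * pdx \<Omega> ?y (w + of_real l' * 1 + of_real l * \<i>))"
      using r(5) l(5) unfolding comm by linarith
    then have eq: "pdy \<Omega> ?x (w + of_real r * 1 + of_real r' * \<i>) = pdx \<Omega> ?y (w + of_real l' * 1 + of_real l * \<i>)"
      using t(1) by (metis mult_cancel_left less_irrefl)
    have "dist (pdy \<Omega> ?x (w + of_real r * 1 + of_real r' * \<i>)) (pdy \<Omega> ?x w) < e / 2"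
      using near[OF r(1-4)] t by (intro d1 in\<Omega> r) auto
    moreover have "dist (pdx \<Omega> ?y (w + of_real l' * 1 + of_real l * \<i>)) (pdx \<Omega> ?y w) < e / 2"
      using near[OF l(3,4,1,2)] t by (intro d2 in\<Omega> l) auto
    ultimately show ?thesis unfolding eq dist_real_def by linarith
  qed
  show ?thesis
  proof (rule ccontr)
    assume "pdy \<Omega> ?x w \<noteq> pdx \<Omega> ?y w"
    moreover define X where "X = \<bar>pdy \<Omega> ?x w - pdx \<Omega> ?y w\<bar>"
    ultimately have X: "0 < X / 2" by simp
    have "X \<le> X / 2" using close[OF X] by (simp only: X_def)
    with X show False by simp
  qed
qed

text \<open>The two Cauchy-Riemann equations are the symmetry of the mixed derivatives and the
  Poisson equation; the term \<open>cnj w / 2\<close> absorbs the constant 2.\<close>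

lemma holomorphic_harmonic_gradient:
  fixes u :: "complex \<Rightarrow> real"
  assumes \<Omega>: "open \<Omega>" and C: "Ck_on 2 \<Omega> u" and lap: "\<And>w. w \<in> \<Omega> \<Longrightarrow> laplacian \<Omega> u w + 2 = 0"
  shows "(\<lambda>w. (of_real (pdx \<Omega> u w) - \<i> * of_real (pdy \<Omega> u w) + cnj w) / 2) holomorphic_on \<Omega>"
  unfolding holomorphic_on_def
proof
  fix w assume w: "w \<in> \<Omega>"
  let ?x = "pdx \<Omega> u" and ?y = "pdy \<Omega> u"
  have diff: "?x differentiable_on \<Omega>" "?y differentiable_on \<Omega>" using C by (auto simp: numeral_2_eq_2)
  let ?A = "frechet_derivative ?x (at w)" and ?B = "frechet_derivative ?y (at w)"
  note A = pd_has_derivative[OF \<Omega> w diff(1)] and B = pd_has_derivative[OF \<Omega> w diff(2)]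
  have "?A \<i> = ?B 1"
    using pd_commute[OF \<Omega> C w] pdy_open[OF \<Omega> w diff(1)] pdx_open[OF \<Omega> w diff(2)] by simp
  moreover have Bi: "?B \<i> = - (?A 1 + 2)"
    using lap[OF w] pdx_open[OF \<Omega> w diff(1)] pdy_open[OF \<Omega> w diff(2)] by (simp add: laplacian_def)
  ultimately have AB: "?A h = Re h * ?A 1 + Im h * ?B 1" "?B h = Re h * ?B 1 - Im h * (?A 1 + 2)" for h
    using frechet_derivative_partials[OF A, of h] frechet_derivative_partials[OF B, of h, unfolded Bi]
    by (simp_all only: real_scaleR_def)
  have "((\<lambda>w. (of_real (?x w) - \<i> * of_real (?y w) + cnj w) / 2) has_derivative
     (\<lambda>h. (of_real (?A h) - \<i> * of_real (?B h) + cnj h) / 2)) (at w)"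
    by (auto intro!: derivative_eq_intros A B)
  moreover have "(\<lambda>h. (of_real (?A h) - \<i> * of_real (?B h) + cnj h) / 2) = (*) (Complex ((?A 1 + 1) / 2) (- ?B 1 / 2))"
    by (rule ext, subst AB, subst AB) (simp add: complex_eq_iff field_simps)
  ultimately have "((\<lambda>w. (of_real (?x w) - \<i> * of_real (?y w) + cnj w) / 2) has_field_derivative
     Complex ((?A 1 + 1) / 2) (- ?B 1 / 2)) (at w)"
    by (simp add: has_field_derivative_def)
  then show "(\<lambda>w. (of_real (?x w) - \<i> * of_real (?y w) + cnj w) / 2) field_differentiable (at w within \<Omega>)"
    using field_differentiable_at_within field_differentiable_def by blast
qed

text \<open>This is the differential of Re (log f), computed through the norm so that no branch of
  the logarithm has to be chosen.\<close>

lemma has_derivative_ln_norm: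
  fixes f :: "complex \<Rightarrow> complex"
  assumes "(f has_field_derivative d) (at z within S)" "f z \<noteq> 0"
  shows "((\<lambda>z. ln (norm (f z))) has_derivative (\<lambda>h. Re (d / f z * h))) (at z within S)"
proof -
  have n: "((\<lambda>w. norm w) has_derivative (\<lambda>h. inner h (sgn (f z)))) (at (f z))"
    by (rule has_derivative_norm[OF assms(2)])
  have "((\<lambda>z. norm (f z)) has_derivative (\<lambda>h. inner (d * h) (sgn (f z)))) (at z within S)"
    using has_derivative_compose[of f "(*) d" z S norm "\<lambda>h. inner h (sgn (f z))"] n assms(1)
    by (simp add: has_field_derivative_def)
  from has_derivative_ln[OF _ this] have "((\<lambda>z. ln (norm (f z))) has_derivative
     (\<lambda>h. inner (d * h) (sgn (f z)) * inverse (norm (f z)))) (at z within S)"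
    using assms(2) by simp
  moreover have "inner (d * h) (sgn (f z)) * inverse (norm (f z)) = Re (d / f z * h)" for h
  proof -
    have "inner (d * h) (f z) = Re (d * h * cnj (f z))" by (simp add: inner_complex_def)
    then have "inner (d * h) (sgn (f z)) * inverse (norm (f z)) = Re (d * h * cnj (f z)) / (norm (f z))\<^sup>2"
      unfolding sgn_div_norm inner_scaleR_right by (simp only: power2_eq_square divide_inverse inverse_mult_distrib mult_ac)
    also have "\<dots> = Re (d * h * cnj (f z) / of_real ((norm (f z))\<^sup>2))" by (rule Re_divide_of_real[symmetric])
    also have "d * h * cnj (f z) / of_real ((norm (f z))\<^sup>2) = d / f z * h"
      using assms(2) unfolding complex_norm_square by (simp add: field_simps)
    finally show ?thesis .
  qed
  ultimately show ?thesis by simp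
qed

section \<open>The developing map\<close>

lemma chol_funpow_dz: "(\<And>k. chol k S f) \<Longrightarrow> chol k S ((dz S ^^ j) f)"
proof (induction j arbitrary: f k)
  case (Suc j)
  have "chol k S (dz S f)" for k using Suc.prems[of "Suc k"] by simp
  then have "chol k S ((dz S ^^ j) (dz S f))" by (rule Suc.IH)
  then show ?case by (simp add: funpow_swap1)
qed simp

locale ring_map =
  fixes \<Omega> \<gamma>\<^sub>1 \<gamma>\<^sub>2 :: "complex set" and s\<^sub>1 s\<^sub>2 T :: real and g :: "complex \<Rightarrow> complex"
  assumes ring: "ring_domain \<Omega> \<gamma>\<^sub>1 \<gamma>\<^sub>2" and dev: "developing_map \<Omega> \<gamma>\<^sub>1 \<gamma>\<^sub>2 s\<^sub>1 s\<^sub>2 T g"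
begin

abbreviation "S \<equiv> band s\<^sub>1 s\<^sub>2"
abbreviation "g1 \<equiv> dz S g"
abbreviation "\<eta> \<equiv> log_factor_z S g"
abbreviation "\<omega> \<equiv> log_factor S g"

lemma s: "s\<^sub>1 < s\<^sub>2" and T: "0 < T" and per_g: "band_periodic s\<^sub>1 s\<^sub>2 T g"
  and g1_nz: "z \<in> S \<Longrightarrow> g1 z \<noteq> 0"
  using dev by (auto simp: developing_map_def)

lemma chol_g: "chol k S g"
  using dev by (intro chol_smooth) (auto simp: developing_map_def)

lemma chol_g1: "chol k S g1"
  using chol_g[of "Suc k"] by simp

lemma deriv_g: "z \<in> S \<Longrightarrow> (g has_field_derivative g1 z) (at z within S)"
  and deriv_g1: "z \<in> S \<Longrightarrow> (g1 has_field_derivative dz S g1 z) (at z within S)"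
  using chol_g chol_g1 by (blast intro: holomorphic_on_dz_band[OF s] chol_imp_holomorphic)+

lemma eta_eq: assumes z: "z \<in> S" shows "\<eta> z = dz S g1 z / (2 * g1 z)"
proof -
  define c where "c = dz S g1 z / g1 z"
  have "(\<omega> has_derivative (\<lambda>h. Re (c * h))) (at z within S)"
    unfolding log_factor_def c_def by (rule has_derivative_ln_norm[OF deriv_g1[OF z] g1_nz[OF z]])
  then have d: "((\<lambda>z. complex_of_real (\<omega> z)) has_derivative (\<lambda>h. of_real (Re (c * h)))) (at z within S)"
    by (rule has_derivative_of_real)
  have "\<eta> z = (of_real (Re (c * 1)) - \<i> * of_real (Re (c * \<i>))) / 2"
    unfolding log_factor_z_def dz_def[of S "\<lambda>z. of_real (\<omega> z)"] pdx_band[OF s z d] pdy_band[OF s z d] ..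
  also have "\<dots> = c / 2" by (simp add: complex_eq_iff)
  finally show ?thesis by (simp add: c_def)
qed

lemma g2_eq: "z \<in> S \<Longrightarrow> dz S g1 z = 2 * \<eta> z * g1 z"
  using g1_nz by (simp add: eta_eq)

lemma chol_eta: "chol k S \<eta>"
proof -
  have "chol k S (\<lambda>z. dz S g1 z * inverse (g1 z) * (1 / 2))"
    using chol_g1[of "Suc k"] by (intro chol_mult[OF s] chol_inverse[OF s] chol_const[OF s] chol_g1 g1_nz) auto
  then show ?thesis by (rule chol_cong[THEN iffD1, rotated]) (simp add: eta_eq field_simps)
qed

lemma per_g1: "band_periodic s\<^sub>1 s\<^sub>2 T g1"
  by (rule band_periodic_dz[OF s chol_imp_holomorphic[OF chol_g] per_g])

lemma per_eta: "band_periodic s\<^sub>1 s\<^sub>2 T \<eta>"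
  using per_g1 band_periodic_dz[OF s chol_imp_holomorphic[OF chol_g1] per_g1]
  by (simp add: band_periodic_def eta_eq)

lemma norm_g1: "z \<in> S \<Longrightarrow> norm (g1 z) = exp (\<omega> z)"
  using g1_nz by (simp add: log_factor_def)

lemma Complex_in_S: "s\<^sub>1 \<le> t \<Longrightarrow> t \<le> s\<^sub>2 \<Longrightarrow> Complex t y \<in> S"
  by (simp add: band_def)

lemma omega_vline:
  assumes t: "s\<^sub>1 \<le> t" "t \<le> s\<^sub>2"
  shows "((\<lambda>y. \<omega> (Complex t y)) has_real_derivative - 2 * Im (\<eta> (Complex t y))) (at y)"
proof -
  note z = Complex_in_S[OF t, of y]
  have "(\<omega> has_derivative (\<lambda>h. Re (dz S g1 (Complex t y) / g1 (Complex t y) * h))) (at (Complex t y) within S)"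
    unfolding log_factor_def by (rule has_derivative_ln_norm[OF deriv_g1[OF z] g1_nz[OF z]])
  from has_vector_derivative_vline[OF this t] show ?thesis
    using g1_nz[OF z] by (simp add: g2_eq[OF z] has_real_derivative_iff_has_vector_derivative)
qed

lemma norm_g1_vline:
  assumes t: "s\<^sub>1 \<le> t" "t \<le> s\<^sub>2"
  shows "((\<lambda>y. norm (g1 (Complex t y))) has_real_derivative
    - 2 * Im (\<eta> (Complex t y)) * norm (g1 (Complex t y))) (at y)"
  using DERIV_chain'[OF omega_vline[OF t] DERIV_exp, of y]
  by (simp add: norm_g1 Complex_in_S[OF t] mult.commute)

lemma field_deriv_vline:
  assumes "(f has_field_derivative d) (at (Complex t y) within S)" "s\<^sub>1 \<le> t" "t \<le> s\<^sub>2"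
  shows "((\<lambda>y. f (Complex t y)) has_vector_derivative \<i> * d) (at y)"
  using has_vector_derivative_vline[of f "(*) d" t y s\<^sub>1 s\<^sub>2] assms by (simp add: has_field_derivative_def mult.commute)

section \<open>Evaluation of differential polynomials on the developing map\<close>

definition ev :: "diffpoly \<Rightarrow> complex \<Rightarrow> complex" where
  "ev p z = diffpoly_eval p (\<lambda>k. (dz S ^^ k) \<eta> z)"

lemma ev_simps:
  "ev (p + q) z = ev p z + ev q z" "ev (p - q) z = ev p z - ev q z" "ev (p * q) z = ev p z * ev q z"
  "ev (numeral w) z = numeral w" "ev (jet 0) z = \<eta> z" "ev (jet (Suc 0)) z = dz S \<eta> z"
  "ev (\<Sum>i\<in>A. f i) z = (\<Sum>i\<in>A. ev (f i) z)"
  by (simp_all add: ev_def diffpoly_eval_add diffpoly_eval_diff diffpoly_eval_mult diffpoly_eval_sum)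

lemma deriv_ev: assumes z: "z \<in> S" shows "(ev p has_field_derivative ev (total_deriv p) z) (at z within S)"
proof (induction p rule: diffpoly_induct)
  case (const c)
  show ?case by (simp add: ev_def[abs_def])
next
  case (jet i)
  have "((dz S ^^ i) \<eta> has_field_derivative dz S ((dz S ^^ i) \<eta>) z) (at z within S)"
    by (rule holomorphic_on_dz_band[OF s chol_imp_holomorphic[OF chol_funpow_dz[OF chol_eta]] z])
  then show ?case by (simp add: ev_def[abs_def])
next
  case (add p q)
  from DERIV_add[OF this] show ?case by (simp add: ev_simps total_deriv_add)
next
  case (mult p q)
  from DERIV_mult[OF this] show ?case by (simp add: ev_simps total_deriv_mult algebra_simps)
qed

lemma holomorphic_ev: "ev p holomorphic_on S"
  using deriv_ev by (auto simp: holomorphic_on_def field_differentiable_def)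

lemma dz_ev: "z \<in> S \<Longrightarrow> dz S (ev p) z = ev (total_deriv p) z"
  by (rule dz_band_field[OF s _ deriv_ev])

lemma chol_ev: "chol k S (ev p)"
proof (induction k arbitrary: p)
  case (Suc k)
  then show ?case by (simp add: holomorphic_ev dz_ev cong: chol_cong)
qed (simp add: holomorphic_ev)

lemma per_jet: "band_periodic s\<^sub>1 s\<^sub>2 T ((dz S ^^ k) \<eta>)"
proof (induction k)
  case (Suc k)
  show ?case
    using band_periodic_dz[OF s chol_imp_holomorphic[OF chol_funpow_dz[OF chol_eta]] Suc] by simp
qed (simp add: per_eta)

lemma per_ev: "band_periodic s\<^sub>1 s\<^sub>2 T (ev p)"
  using per_jet by (simp add: band_periodic_def ev_def)

section \<open>Boundary and interior points under the developing map\<close>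

lemma fundamental_representative:
  assumes z: "z \<in> S"
  obtains w where "w \<in> S" "0 \<le> Im w" "Im w < T" "Re w = Re z" "g w = g z"
proof -
  obtain k :: int where k: "0 \<le> Im (z + \<i> * of_real (of_int k * T))" "Im (z + \<i> * of_real (of_int k * T)) < T"
    by (rule band_fundamental_translate[OF T])
  show ?thesis
  proof (rule that)
    show "z + \<i> * of_real (of_int k * T) \<in> S" using z by (simp only: band_translate)
    show "g (z + \<i> * of_real (of_int k * T)) = g z" by (rule band_periodic_of_int[OF per_g z])
  qed (use k in simp_all)
qed

lemma g_bij: "bij_betw g {z \<in> S. 0 \<le> Im z \<and> Im z < T} (closure \<Omega>)"
  using dev unfolding developing_map_def by blast

lemma g_closure: assumes z: "z \<in> S" shows "g z \<in> closure \<Omega>"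
proof -
  obtain w where w: "w \<in> S" "0 \<le> Im w" "Im w < T" "Re w = Re z" "g w = g z"
    using z by (rule fundamental_representative)
  then have "g w \<in> closure \<Omega>" by (intro bij_betw_apply[OF g_bij]) simp
  then show ?thesis by (simp only: w)
qed

text \<open>The frontier is covered by the images of the two boundary lines. If an interior point
  were sent there, it would share its value with a boundary point; translation into the fundamental
  strip preserves real parts, and injectivity there would force equal real parts.\<close>

lemma g_interior: assumes z: "z \<in> interior S" shows "g z \<in> \<Omega>"
proof (rule ccontr)
  assume "g z \<notin> \<Omega>"
  have zS: "z \<in> S" using z interior_subset by blast
  have "open \<Omega>" "frontier \<Omega> = \<gamma>\<^sub>1 \<union> \<gamma>\<^sub>2" using ring unfolding ring_domain_def by blast+
  then have "closure \<Omega> - \<Omega> = \<gamma>\<^sub>1 \<union> \<gamma>\<^sub>2" by (metis frontier_def interior_open)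
  then have "g z \<in> \<gamma>\<^sub>1 \<union> \<gamma>\<^sub>2" using \<open>g z \<notin> \<Omega>\<close> g_closure[OF zS] by blast
  moreover have "g ` vline s\<^sub>1 = \<gamma>\<^sub>1" "g ` vline s\<^sub>2 = \<gamma>\<^sub>2" using dev unfolding developing_map_def by blast+
  ultimately obtain y where y: "y \<in> vline s\<^sub>1 \<union> vline s\<^sub>2" "g y = g z" by (metis Un_iff imageE)
  then have "y \<in> S" using s by (auto simp: vline_def band_def)
  then obtain y' where y': "y' \<in> S" "0 \<le> Im y'" "Im y' < T" "Re y' = Re y" "g y' = g y"
    by (rule fundamental_representative)
  obtain z' where z': "z' \<in> S" "0 \<le> Im z'" "Im z' < T" "Re z' = Re z" "g z' = g z"
    using zS by (rule fundamental_representative)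
  have "inj_on g {z \<in> S. 0 \<le> Im z \<and> Im z < T}" using g_bij by (rule bij_betw_imp_inj_on)
  from inj_onD[OF this, of y' z'] have "y' = z'" using y(2) y' z' by simp
  then have "Re z = Re y" using y' z' by simp
  then show False using y(1) z by (auto simp: interior_band vline_def)
qed

end

section \<open>The Hopf differential\<close>

locale capillary_map = ring_map +
  fixes u :: "complex \<Rightarrow> real"
  assumes sol: "capillary_solution \<Omega> \<gamma>\<^sub>1 \<gamma>\<^sub>2 u"
begin

abbreviation "ux \<equiv> pdx (closure \<Omega>) u"
abbreviation "uy \<equiv> pdy (closure \<Omega>) u"

text \<open>\<open>K = \<partial>\<^sub>w (u + |w|\<^sup>2 / 2)\<close> is holomorphic, as \<open>u + |w|\<^sup>2 / 2\<close> is harmonic.\<close>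

definition K :: "complex \<Rightarrow> complex" where
  "K w = (of_real (ux w) - \<i> * of_real (uy w) + cnj w) / 2"

definition F :: "complex \<Rightarrow> complex" where
  "F z = K (g z) * g1 z"

lemma open_Omega: "open \<Omega>"
  using ring unfolding ring_domain_def by blast

lemma C2: "Ck_on 2 \<Omega> u" and C1: "Ck_on 1 (closure \<Omega>) u" and lap: "p \<in> \<Omega> \<Longrightarrow> laplacian \<Omega> u p + 2 = 0"
  using sol unfolding capillary_solution_def by blast+

lemma continuous_K: "continuous_on (closure \<Omega>) K"
proof -
  have "continuous_on (closure \<Omega>) ux" "continuous_on (closure \<Omega>) uy" using C1 by simp_all
  then show ?thesis unfolding K_def by (intro continuous_intros) auto
qed

lemma holomorphic_K: "K holomorphic_on \<Omega>"
proof -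
  \<comment> \<open>The partial derivatives in \<open>K\<close> are taken within the closure to keep
    \<open>K\<close> continuous up to the boundary; at points of the domain they agree with the
    ordinary ones.\<close>
  have "ux w = pdx \<Omega> u w \<and> uy w = pdy \<Omega> u w" if w: "w \<in> \<Omega>" for w
  proof -
    have "w \<in> interior (closure \<Omega>)"
      using w open_Omega interior_maximal[OF closure_subset open_Omega] by blast
    then show ?thesis
      unfolding pdx_def pdy_def by (simp only: at_within_interior at_within_open[OF w open_Omega])
  qed
  then have eq: "K w = (of_real (pdx \<Omega> u w) - \<i> * of_real (pdy \<Omega> u w) + cnj w) / 2" if "w \<in> \<Omega>" for w
    using that by (simp add: K_def)
  have "K holomorphic_on \<Omega> \<longleftrightarrow>
      (\<lambda>w. (of_real (pdx \<Omega> u w) - \<i> * of_real (pdy \<Omega> u w) + cnj w) / 2) holomorphic_on \<Omega>"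
    by (intro holomorphic_cong refl eq)
  with holomorphic_harmonic_gradient[OF open_Omega C2 lap] show ?thesis by (simp only:)
qed

lemma g_holomorphic: "g holomorphic_on S" and g1_holomorphic: "g1 holomorphic_on S" and eta_holomorphic: "\<eta> holomorphic_on S"
  using chol_g chol_g1 chol_eta by (blast intro: chol_imp_holomorphic)+

lemma continuous_F: "continuous_on S F"
proof -
  have "continuous_on S (K \<circ> g)"
    by (rule continuous_on_compose[OF holomorphic_on_imp_continuous_on[OF g_holomorphic]])
      (rule continuous_on_subset[OF continuous_K], use g_closure in blast)
  from continuous_on_mult[OF this holomorphic_on_imp_continuous_on[OF g1_holomorphic]] show ?thesis
    unfolding F_def o_def .
qed

lemma holomorphic_F: "F holomorphic_on interior S"
proof -
  have "(K \<circ> g) holomorphic_on interior S"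
    by (rule holomorphic_on_compose[OF holomorphic_on_subset[OF g_holomorphic interior_subset]])
      (rule holomorphic_on_subset[OF holomorphic_K], use g_interior in blast)
  then show ?thesis unfolding F_def o_def
    by (intro holomorphic_on_mult holomorphic_on_subset[OF g1_holomorphic interior_subset])
qed

lemma per_F: "band_periodic s\<^sub>1 s\<^sub>2 T F"
  using per_g per_g1 by (simp add: band_periodic_def F_def)

text \<open>The factor is 2 v_z: by definition F = v_z - \<sigma>_z, and \<sigma>_z = - cnj g g' /
  2. Only the real derivative of \<open>u\<close> within the closure enters, so the formula holds on
  the boundary lines too.\<close>

lemma deriv_v:
  assumes z: "z \<in> S"
  shows "((\<lambda>z. u (g z)) has_derivative (\<lambda>h. Re ((2 * F z - cnj (g z) * g1 z) * h))) (at z within S)"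
proof -
  have "u differentiable (at (g z) within closure \<Omega>)"
    using C1 g_closure[OF z] by (simp add: differentiable_on_def)
  then have du: "(u has_derivative frechet_derivative u (at (g z) within closure \<Omega>)) (at (g z) within closure \<Omega>)"
    by (simp only: frechet_derivative_works)
  let ?D = "frechet_derivative u (at (g z) within closure \<Omega>)"
  have "g ` S \<subseteq> closure \<Omega>" using g_closure by blast
  then have "(u has_derivative ?D) (at (g z) within g ` S)" by (rule has_derivative_subset[OF du])
  from diff_chain_within[OF deriv_g[OF z, unfolded has_field_derivative_def] this]
  have "((\<lambda>z. u (g z)) has_derivative (\<lambda>h. ?D (g1 z * h))) (at z within S)" by (simp only: o_def)
  moreover have "?D (g1 z * h) = Re ((2 * F z - cnj (g z) * g1 z) * h)" for h
  proof -
    have "?D (g1 z * h) = Re (g1 z * h) * ux (g z) + Im (g1 z * h) * uy (g z)"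
      using frechet_derivative_partials[OF du, of "g1 z * h"] by (simp only: pdx_def pdy_def real_scaleR_def)
    also have "\<dots> = Re ((of_real (ux (g z)) - \<i> * of_real (uy (g z))) * (g1 z * h))"
      by (simp add: algebra_simps)
    also have "of_real (ux (g z)) - \<i> * of_real (uy (g z)) = 2 * K (g z) - cnj (g z)" by (simp add: K_def field_simps)
    finally show ?thesis by (simp only: F_def left_diff_distrib mult.assoc)
  qed
  ultimately show ?thesis by simp
qed

lemma dz_v: assumes z: "z \<in> S" shows "dz S (\<lambda>z. of_real (u (g z))) z = F z - cnj (g z) * g1 z / 2"
proof -
  define c where "c = 2 * F z - cnj (g z) * g1 z"
  have d: "((\<lambda>z. complex_of_real (u (g z))) has_derivative (\<lambda>h. of_real (Re (c * h)))) (at z within S)"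
    unfolding c_def by (rule has_derivative_of_real[OF deriv_v[OF z]])
  have "dz S (\<lambda>z. of_real (u (g z))) z = (of_real (Re (c * 1)) - \<i> * of_real (Re (c * \<i>))) / 2"
    unfolding dz_def pdx_band[OF s z d] pdy_band[OF s z d] ..
  also have "\<dots> = c / 2" by (simp add: complex_eq_iff)
  finally show ?thesis by (simp add: c_def diff_divide_distrib)
qed

text \<open>\<open>E\<close> below is 2 \<partial>_z of v - c \<sigma> - L. Its real part is the
  x-derivative, given by the second capillarity condition; its imaginary part is minus the
  tangential derivative of a function that the first condition makes constant on the line. So
  \<open>E\<close> is the real number b |g'|.\<close>

lemma F_vline:
  assumes cap: "capillarity_constants S u g t a b c d\<^sub>1 d\<^sub>2" and t: "s\<^sub>1 \<le> t" "t \<le> s\<^sub>2"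
  shows "2 * F (Complex t y) = of_real b * of_real (norm (g1 (Complex t y)))
     + (Complex d\<^sub>1 (- d\<^sub>2) + of_real (1 - c) * cnj (g (Complex t y))) * g1 (Complex t y)"
proof -
  let ?\<sigma> = "\<lambda>z. - (norm (g z))\<^sup>2 / 2" and ?L = "\<lambda>z. d\<^sub>1 * Re (g z) + d\<^sub>2 * Im (g z)" and ?v = "\<lambda>z. u (g z)"
  define z where "z = Complex t y"
  define D where "D = Complex d\<^sub>1 (- d\<^sub>2)"
  note zS = Complex_in_S[OF t]
  have z: "z \<in> S" by (simp add: z_def zS)
  have cap': "?v w = a + c * ?\<sigma> w + ?L w" "pdx S ?v w = b * exp (\<omega> w) + c * pdx S ?\<sigma> w + pdx S ?L w"
    if "w \<in> vline t" for w
    using cap that unfolding capillarity_constants_def Let_def by blast+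
  have dg: "(g has_derivative (\<lambda>h. g1 z * h)) (at z within S)"
    using deriv_g[OF z] by (simp only: has_field_derivative_def)
  have dRe: "((\<lambda>z. Re (g z)) has_derivative (\<lambda>h. Re (g1 z * h))) (at z within S)"
    and dIm: "((\<lambda>z. Im (g z)) has_derivative (\<lambda>h. Im (g1 z * h))) (at z within S)"
    by (rule has_derivative_Re[OF dg] has_derivative_Im[OF dg])+
  have d\<sigma>: "(?\<sigma> has_derivative (\<lambda>h. - Re (cnj (g z) * g1 z * h))) (at z within S)"
  proof -
    have "?\<sigma> = (\<lambda>z. (- 1 / 2) * (Re (g z) * Re (g z) + Im (g z) * Im (g z)))"
      by (rule ext, unfold cmod_power2) (simp add: power2_eq_square field_simps)
    then show ?thesis
      by (simp only:) (rule has_derivative_eq_rhs[OF has_derivative_mult_right[OF has_derivative_add[OF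
              has_derivative_mult[OF dRe dRe] has_derivative_mult[OF dIm dIm]]]], auto simp: algebra_simps)
  qed
  have dL: "(?L has_derivative (\<lambda>h. Re (D * g1 z * h))) (at z within S)"
    by (rule has_derivative_eq_rhs[OF has_derivative_add[OF has_derivative_mult_right[OF dRe, of d\<^sub>1] has_derivative_mult_right[OF dIm, of d\<^sub>2]]])
      (auto simp: D_def algebra_simps)
  have vl: "z \<in> vline t" by (simp add: z_def vline_def)
  define E where "E = 2 * F z - cnj (g z) * g1 z - (D - of_real c * cnj (g z)) * g1 z"
  have "Re E = b * norm (g1 z)"
    using cap'(2)[OF vl]
    unfolding pdx_band[OF s z deriv_v[OF z]] pdx_band[OF s z d\<sigma>] pdx_band[OF s z dL] norm_g1[OF z]
    by (simp add: E_def algebra_simps)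
  moreover have "Im E = 0"
  proof -
    have "((\<lambda>z. a + c * ?\<sigma> z + ?L z) has_derivative (\<lambda>h. c * (- Re (cnj (g z) * g1 z * h)) + Re (D * g1 z * h))) (at z within S)"
      by (rule has_derivative_eq_rhs[OF has_derivative_add[OF has_derivative_add[OF has_derivative_const
              has_derivative_mult_right[OF d\<sigma>]] dL]]) simp
    from has_vector_derivative_vline[OF this[unfolded z_def] t]
    have "((\<lambda>y. a + c * ?\<sigma> (Complex t y) + ?L (Complex t y)) has_vector_derivative
       c * (- Re (cnj (g z) * g1 z * \<i>)) + Re (D * g1 z * \<i>)) (at y)" by (simp only: z_def)
    moreover have "(\<lambda>y. a + c * ?\<sigma> (Complex t y) + ?L (Complex t y)) = (\<lambda>y. ?v (Complex t y))"
      using cap'(1) by (auto simp: vline_def)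
    moreover have "((\<lambda>y. ?v (Complex t y)) has_vector_derivative Re ((2 * F z - cnj (g z) * g1 z) * \<i>)) (at y)"
      using has_vector_derivative_vline[OF deriv_v[OF zS[of y]] t] by (simp only: z_def)
    ultimately have "c * (- Re (cnj (g z) * g1 z * \<i>)) + Re (D * g1 z * \<i>) = Re ((2 * F z - cnj (g z) * g1 z) * \<i>)"
      using vector_derivative_unique_at by metis
    then show ?thesis by (simp add: E_def algebra_simps)
  qed
  ultimately have "E = of_real b * of_real (norm (g1 z))" by (simp add: complex_eq_iff)
  then show ?thesis by (simp add: E_def z_def D_def algebra_simps)
qed

end

section \<open>The Hopf constant and its expression on the boundary lines\<close>

context capillary_map
begin

lemma deriv_F_interior: "z \<in> interior S \<Longrightarrow> (F has_field_derivative deriv F z) (at z)"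
  using holomorphic_derivI[OF holomorphic_F open_interior] by blast

text \<open>The contribution of \<sigma> to the Hopf differential is \<sigma>_zz - 2 \<eta>
  \<sigma>_z, which vanishes because g'' = 2 \<eta> g'.\<close>

lemma hopf_differential_eq:
  assumes z: "z \<in> interior S"
  shows "hopf_differential S u g z = deriv F z - 2 * \<eta> z * F z"
proof -
  have zS: "z \<in> S" using z interior_subset by blast
  let ?v = "\<lambda>z. complex_of_real (u (g z))"
  have dF: "(F has_derivative (\<lambda>h. deriv F z * h)) (at z within S)"
    using has_field_derivative_at_within[OF deriv_F_interior[OF z]] by (simp only: has_field_derivative_def)
  have dcg: "((\<lambda>z. cnj (g z)) has_derivative (\<lambda>h. cnj (g1 z * h))) (at z within S)"
    using deriv_g[OF zS] unfolding has_field_derivative_def by (rule has_derivative_cnj)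
  have dg1: "(g1 has_derivative (\<lambda>h. dz S g1 z * h)) (at z within S)"
    using deriv_g1[OF zS] by (simp only: has_field_derivative_def)
  have "((\<lambda>z. F z - (1 / 2) * (cnj (g z) * g1 z)) has_derivative
     (\<lambda>h. deriv F z * h - (1 / 2) * (cnj (g z) * (dz S g1 z * h) + cnj (g1 z * h) * g1 z))) (at z within S)"
    by (intro has_derivative_diff has_derivative_mult_right has_derivative_mult dF dcg dg1)
  note d = this
  have "dz S (dz S ?v) z = dz S (\<lambda>z. F z - (1 / 2) * (cnj (g z) * g1 z)) z"
    by (rule dz_cong[OF zS]) (simp add: dz_v)
  also have "\<dots> = deriv F z - (1 / 2) * (cnj (g z) * dz S g1 z)"
    unfolding dz_def[of S "\<lambda>z. F z - _ z"] pdx_band[OF s zS d] pdy_band[OF s zS d] by (simp add: field_simps)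
  finally show ?thesis
    unfolding hopf_differential_def Let_def dz_v[OF zS] g2_eq[OF zS] by (simp add: algebra_simps)
qed

text \<open>If \<open>I' = \<eta> F\<close>, then \<open>F - 2 I\<close> is a primitive of the Hopf differential.\<close>

lemma primitive_vline:
  assumes cap: "capillarity_constants S u g t a b c d\<^sub>1 d\<^sub>2" and t: "s\<^sub>1 \<le> t" "t \<le> s\<^sub>2"
    and I: "\<And>z. z \<in> S \<Longrightarrow> (I has_field_derivative \<eta> z * F z) (at z within S)"
  shows "((\<lambda>y. F (Complex t y) - 2 * I (Complex t y)) has_vector_derivative
    \<i> * of_real (- b * Re (\<eta> (Complex t y)) * norm (g1 (Complex t y)) - (1 - c) / 2 * (norm (g1 (Complex t y)))\<^sup>2)) (at y)"
proof -
  let ?z = "\<lambda>y. Complex t y"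
  define D where "D = Complex d\<^sub>1 (- d\<^sub>2)"
  note zS = Complex_in_S[OF t]
  let ?e = "\<eta> (?z y)" and ?n = "norm (g1 (?z y))" and ?X = "D + of_real (1 - c) * cnj (g (?z y))"
  have F: "F (?z y) = (1 / 2) * (of_real b * of_real (norm (g1 (?z y))) + (D + of_real (1 - c) * cnj (g (?z y))) * g1 (?z y))" for y
    using F_vline[OF cap t, of y] by (simp add: D_def field_simps)
  have dn: "((\<lambda>y. complex_of_real (norm (g1 (?z y)))) has_vector_derivative of_real (- 2 * Im ?e * ?n)) (at y)"
    by (rule has_vector_derivative_of_real[OF norm_g1_vline[OF t]])
  have dcg: "((\<lambda>y. cnj (g (?z y))) has_vector_derivative cnj (\<i> * g1 (?z y))) (at y)"
    by (rule has_vector_derivative_cnj[OF field_deriv_vline[OF deriv_g[OF zS] t]])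
  have dg1: "((\<lambda>y. g1 (?z y)) has_vector_derivative \<i> * (2 * ?e * g1 (?z y))) (at y)"
    using field_deriv_vline[OF deriv_g1[OF zS] t, of y] by (simp only: g2_eq[OF zS])
  have dI: "((\<lambda>y. I (?z y)) has_vector_derivative \<i> * (?e * F (?z y))) (at y)"
    by (rule field_deriv_vline[OF I[OF zS] t])
  have "((\<lambda>y. F (?z y) - 2 * I (?z y)) has_vector_derivative
     (1 / 2) * (of_real b * of_real (- 2 * Im ?e * ?n)
       + (?X * (\<i> * (2 * ?e * g1 (?z y))) + (0 + of_real (1 - c) * cnj (\<i> * g1 (?z y))) * g1 (?z y)))
     - 2 * (\<i> * (?e * F (?z y)))) (at y)"
    unfolding F[of "_ :: real"]
    by (intro has_vector_derivative_diff has_vector_derivative_mult_right has_vector_derivative_add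
        has_vector_derivative_mult has_vector_derivative_const dn dcg dg1 dI[unfolded F])
  \<comment> \<open>With \<open>e\<close>, \<open>w\<close> and \<open>X\<close> abstract, all terms
    in \<open>X\<close> cancel, and with them the constants \<open>d\<^sub>1\<close> and
    \<open>d\<^sub>2\<close>. The two terms in \<open>b\<close> combine through Im e + \<i> e = \<i>
    Re e + (Im e - Im e), leaving a purely imaginary derivative.\<close>
  moreover have "(1 / 2) * (of_real b * of_real (- 2 * Im e * norm w)
       + (X * (\<i> * (2 * e * w)) + (0 + of_real (1 - c) * cnj (\<i> * w)) * w))
     - 2 * (\<i> * (e * ((1 / 2) * (of_real b * of_real (norm w) + X * w))))
     = \<i> * of_real (- b * Re e * norm w - (1 - c) / 2 * (norm w)\<^sup>2)" (is "?lhs = ?rhs") for e w X :: complex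
  proof -
    have "?lhs = - of_real (b * Im e * norm w) - \<i> * e * of_real (b * norm w) - \<i> * of_real ((1 - c) / 2) * (w * cnj w)"
      by (simp add: field_simps)
    also have "\<dots> = ?rhs" unfolding complex_norm_square[symmetric] by (simp add: complex_eq_iff)
    finally show ?thesis .
  qed
  ultimately show ?thesis by (simp only: F)
qed

theorem hopf_constant_vline:
  assumes cap1: "capillarity_constants S u g s\<^sub>1 a\<^sub>1 b\<^sub>1 c\<^sub>1 d\<^sub>1\<^sub>1 d\<^sub>2\<^sub>1"
    and cap2: "capillarity_constants S u g s\<^sub>2 a\<^sub>2 b\<^sub>2 c\<^sub>2 d\<^sub>1\<^sub>2 d\<^sub>2\<^sub>2"
  defines "q \<equiv> hopf_constant s\<^sub>1 s\<^sub>2 u g"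
  shows "q = - b\<^sub>1 * Re (\<eta> (Complex s\<^sub>1 y)) * norm (g1 (Complex s\<^sub>1 y)) - (1 - c\<^sub>1) / 2 * (norm (g1 (Complex s\<^sub>1 y)))\<^sup>2"
    and "q = - b\<^sub>2 * Re (\<eta> (Complex s\<^sub>2 y)) * norm (g1 (Complex s\<^sub>2 y)) - (1 - c\<^sub>2) / 2 * (norm (g1 (Complex s\<^sub>2 y)))\<^sup>2"
proof -
  have int: "interior S \<subseteq> S" by (rule interior_subset)
  have cont_eta: "continuous_on S \<eta>" by (rule holomorphic_on_imp_continuous_on[OF eta_holomorphic])
  have hol: "(\<lambda>z. \<eta> z * F z) holomorphic_on interior S"
    by (intro holomorphic_on_mult holomorphic_F holomorphic_on_subset[OF eta_holomorphic int])
  \<comment> \<open>At the boundary the integrand is only continuous, but the band is convex, so the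
    primitive exists on the closed band with one-sided derivatives there.\<close>
  obtain I where I: "\<And>z. z \<in> S \<Longrightarrow> (I has_field_derivative \<eta> z * F z) (at z within S)"
  proof (rule holomorphic_convex_primitive[OF convex_band finite.emptyI continuous_on_mult[OF cont_eta continuous_F]])
    show "(\<lambda>z. \<eta> z * F z) field_differentiable at z" if "z \<in> interior S - {}" for z
      using that by (intro holomorphic_on_imp_differentiable_at[OF hol open_interior]) simp
  qed blast
  define P where "P z = F z - 2 * I z" for z
  have holI: "I holomorphic_on S" using I unfolding holomorphic_on_def field_differentiable_def by blast
  have contP: "continuous_on S P" unfolding P_def
    by (intro continuous_on_diff continuous_on_mult continuous_on_const continuous_F holomorphic_on_imp_continuous_on[OF holI])
  have holP: "P holomorphic_on interior S" unfolding P_def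
    by (intro holomorphic_on_diff holomorphic_on_mult holomorphic_on_const holomorphic_F holomorphic_on_subset[OF holI int])
  define r where "r b c t y = - b * Re (\<eta> (Complex t y)) * norm (g1 (Complex t y)) - (1 - c) / 2 * (norm (g1 (Complex t y)))\<^sup>2"
    for b c t y :: real
  have P1: "((\<lambda>y. P (Complex s\<^sub>1 y)) has_vector_derivative \<i> * of_real (r b\<^sub>1 c\<^sub>1 s\<^sub>1 y)) (at y)" for y
    using s unfolding P_def r_def by (intro primitive_vline[OF cap1 _ _ I]) auto
  have P2: "((\<lambda>y. P (Complex s\<^sub>2 y)) has_vector_derivative \<i> * of_real (r b\<^sub>2 c\<^sub>2 s\<^sub>2 y)) (at y)" for y
    using s unfolding P_def r_def by (intro primitive_vline[OF cap2 _ _ I]) auto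
  have "Re (P (Complex s\<^sub>1 y)) = Re (P (Complex s\<^sub>1 0))" for y
    by (rule DERIV_isconst_all[of "\<lambda>y. Re (P (Complex s\<^sub>1 y))"]) (use has_real_derivative_Re[OF P1] in simp)
  then have const1: "Re (P z) = Re (P (Complex s\<^sub>1 0))" if "z \<in> vline s\<^sub>1" for z
    using that by (metis (mono_tags) complex_surj mem_Collect_eq vline_def)
  have "Re (P (Complex s\<^sub>2 y)) = Re (P (Complex s\<^sub>2 0))" for y
    by (rule DERIV_isconst_all[of "\<lambda>y. Re (P (Complex s\<^sub>2 y))"]) (use has_real_derivative_Re[OF P2] in simp)
  then have const2: "Re (P z) = Re (P (Complex s\<^sub>2 0))" if "z \<in> vline s\<^sub>2" for z
    using that by (metis (mono_tags) complex_surj mem_Collect_eq vline_def)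
  \<comment> \<open>\<open>I\<close> need not be periodic, but its increment over a period is a
    constant \<open>k\<close>. Since Re P is constant on the line \<open>vline s\<^sub>1\<close>, Re
    k must vanish, so Re P is periodic and the maximum principle applies.\<close>
  let ?c = "\<i> * complex_of_real T"
  have "((\<lambda>z. I (z + ?c) - I z) has_field_derivative 0) (at z within S)" if z: "z \<in> S" for z
  proof -
    have "\<eta> (z + ?c) = \<eta> z" "F (z + ?c) = F z" using band_periodicD[OF per_eta z] band_periodicD[OF per_F z] by simp_all
    then show ?thesis
      using DERIV_diff[OF has_field_derivative_band_shift[of s\<^sub>1 s\<^sub>2 I "\<lambda>z. \<eta> z * F z", OF I z, of T] I[OF z]] by simp
  qed
  from has_field_derivative_zero_constant[OF convex_band this]
  obtain k where k: "\<And>z. z \<in> S \<Longrightarrow> I (z + ?c) - I z = k" by blast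
  have shift: "P (z + ?c) = P z - 2 * k" if "z \<in> S" for z
  proof -
    have "I (z + ?c) = I z + k" using k[OF that] by (simp add: algebra_simps)
    then show ?thesis using band_periodicD[OF per_F that] by (simp add: P_def)
  qed
  have v: "of_real s\<^sub>1 \<in> vline s\<^sub>1" "of_real s\<^sub>1 + ?c \<in> vline s\<^sub>1" "of_real s\<^sub>1 \<in> S"
    using s by (simp_all add: vline_def band_def)
  have "Re k = 0" using const1[OF v(1)] const1[OF v(2)] shift[OF v(3)] by simp
  then have perP: "band_periodic s\<^sub>1 s\<^sub>2 T (\<lambda>z. Re (P z))"
    unfolding band_periodic_def by (simp add: shift)
  obtain A B where AB: "\<And>z. z \<in> S \<Longrightarrow> Re (P z) = A * Re z + B"
    using band_Re_linear[OF s T perP contP holP const1 const2] by blast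
  have dP: "(P has_field_derivative (deriv F z - 2 * (\<eta> z * F z))) (at z)" if z: "z \<in> interior S" for z
  proof -
    have "(I has_field_derivative \<eta> z * F z) (at z)"
      using I[OF subsetD[OF int z]] by (simp only: at_within_interior[OF z])
    then show ?thesis unfolding P_def by (intro DERIV_diff DERIV_cmult deriv_F_interior z)
  qed
  have hopf: "deriv F z - 2 * (\<eta> z * F z) = of_real A" if z: "z \<in> interior S" for z
  proof -
    define d where "d = deriv F z - 2 * (\<eta> z * F z)"
    have zS: "z \<in> S" using z int by blast
    have "(P has_field_derivative d) (at z within S)"
      unfolding d_def by (rule has_field_derivative_at_within[OF dP[OF z]])
    then have "((\<lambda>z. Re (P z)) has_derivative (\<lambda>h. Re (d * h))) (at z within S)"
      unfolding has_field_derivative_def by (rule has_derivative_Re)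
    moreover have "((\<lambda>z. A * Re z + B) has_derivative (\<lambda>h. A * Re h)) (at z within S)"
      by (auto intro!: derivative_eq_intros)
    then have "((\<lambda>z. Re (P z)) has_derivative (\<lambda>h. A * Re h)) (at z within S)"
      by (simp only: has_derivative_cong_on[OF zS AB])
    ultimately have "(\<lambda>h. Re (d * h)) = (\<lambda>h. A * Re h)" by (rule has_derivative_band_unique[OF s zS])
    from fun_cong[OF this, of 1] fun_cong[OF this, of \<i>] show ?thesis
      by (simp add: complex_eq_iff d_def[symmetric])
  qed
  have q: "q = A"
    unfolding q_def hopf_constant_def
  proof (rule the_equality)
    show "\<forall>z. s\<^sub>1 < Re z \<and> Re z < s\<^sub>2 \<longrightarrow> hopf_differential S u g z = complex_of_real A"
      using hopf by (simp add: hopf_differential_eq interior_band mult.assoc)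
    fix q' assume q': "\<forall>z. s\<^sub>1 < Re z \<and> Re z < s\<^sub>2 \<longrightarrow> hopf_differential S u g z = complex_of_real q'"
    have m: "complex_of_real ((s\<^sub>1 + s\<^sub>2) / 2) \<in> interior S" using s by (simp add: interior_band)
    then have "hopf_differential S u g (complex_of_real ((s\<^sub>1 + s\<^sub>2) / 2)) = complex_of_real q'"
      using q' by (simp add: interior_band)
    then show "q' = A" using hopf[OF m] hopf_differential_eq[OF m] by (simp add: mult.assoc)
  qed
  have "((\<lambda>z. P z - of_real A * z) has_field_derivative 0) (at z within interior S)" if z: "z \<in> interior S" for z
  proof -
    have "((\<lambda>z. P z - of_real A * z) has_field_derivative of_real A - of_real A * 1) (at z within interior S)"
      using dP[OF z] hopf[OF z] by (intro DERIV_diff DERIV_cmult DERIV_ident) (simp add: has_field_derivative_at_within)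
    then show ?thesis by simp
  qed
  from has_field_derivative_zero_constant[OF convex_interior[OF convex_band] this]
  obtain C where C: "\<And>z. z \<in> interior S \<Longrightarrow> P z - of_real A * z = C" by blast
  have P: "P z = of_real A * z + C" if "z \<in> S" for z
  proof (rule band_eq_by_continuity[OF s contP _ _ that])
    show "continuous_on S (\<lambda>z. of_real A * z + C)" by (intro continuous_intros)
    show "P z = of_real A * z + C" if "z \<in> interior S" for z using C[OF that] by (simp add: algebra_simps)
  qed
  \<comment> \<open>P = A z + C holds up to the boundary, so its derivative along a boundary line is
    \<i> A; comparison with the derivative from the capillarity conditions evaluates A
    there.\<close>
  have val: "A = r b c t y"
    if t: "s\<^sub>1 \<le> t" "t \<le> s\<^sub>2" and D: "((\<lambda>y. P (Complex t y)) has_vector_derivative \<i> * of_real (r b c t y)) (at y)" for b c t y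
  proof -
    have "((\<lambda>z. of_real A * z + C) has_field_derivative of_real A) (at (Complex t y) within S)"
      by (auto intro!: derivative_eq_intros)
    from field_deriv_vline[OF this t] have "((\<lambda>y. P (Complex t y)) has_vector_derivative \<i> * of_real A) (at y)"
      by (simp only: P[OF Complex_in_S[OF t]])
    from vector_derivative_unique_at[OF D this] show ?thesis by simp
  qed
  show "q = - b\<^sub>1 * Re (\<eta> (Complex s\<^sub>1 y)) * norm (g1 (Complex s\<^sub>1 y)) - (1 - c\<^sub>1) / 2 * (norm (g1 (Complex s\<^sub>1 y)))\<^sup>2"
    using val[OF _ _ P1, of y] s unfolding q r_def by simp
  show "q = - b\<^sub>2 * Re (\<eta> (Complex s\<^sub>2 y)) * norm (g1 (Complex s\<^sub>2 y)) - (1 - c\<^sub>2) / 2 * (norm (g1 (Complex s\<^sub>2 y)))\<^sup>2"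
    using val[OF _ _ P2, of y] s unfolding q r_def by simp
qed

end

section \<open>Jacobi fields from the mKdV hierarchy\<close>

lemma field_derivative_zero_if_Im_zero:
  assumes s: "s\<^sub>1 < s\<^sub>2" and z: "z \<in> band s\<^sub>1 s\<^sub>2" and d: "(f has_field_derivative d) (at z within band s\<^sub>1 s\<^sub>2)"
    and Im: "\<And>z. z \<in> band s\<^sub>1 s\<^sub>2 \<Longrightarrow> Im (f z) = 0"
  shows "d = 0"
proof -
  have "((\<lambda>z. Im (f z)) has_derivative (\<lambda>h. Im (d * h))) (at z within band s\<^sub>1 s\<^sub>2)"
    using d unfolding has_field_derivative_def by (rule has_derivative_Im)
  moreover have "((\<lambda>z. Im (f z)) has_derivative (\<lambda>h. 0)) (at z within band s\<^sub>1 s\<^sub>2)"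
    using has_derivative_cong_on[OF z, of "\<lambda>z. Im (f z)" "\<lambda>_. 0"] Im by simp
  ultimately have "(\<lambda>h. Im (d * h)) = (\<lambda>h. 0)" by (rule has_derivative_band_unique[OF s z])
  from fun_cong[OF this, of 1] fun_cong[OF this, of \<i>] show ?thesis by (simp add: complex_eq_iff)
qed

section \<open>The mKdV functions on the boundary lines and their linear relations\<close>

context ring_map
begin

abbreviation "Q n \<equiv> ev (mkdv n)"
abbreviation "Q' n \<equiv> ev (total_deriv (mkdv n))"
abbreviation "Q'' n \<equiv> ev (total_deriv (total_deriv (mkdv n)))"
abbreviation "B n \<equiv> ev (mkdv_prim n)"

definition lam :: "real \<Rightarrow> real \<Rightarrow> complex \<Rightarrow> real" where
  "lam \<alpha> \<beta> z = 1 / 2 * (\<alpha> * exp (- \<omega> z) - \<beta> * exp (\<omega> z))"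

lemma Q_Suc: "Q (Suc n) z = Q'' n z - 4 * \<eta> z * B n z"
  unfolding mkdv_Suc_eq by (simp add: ev_simps)

lemma Q'_Suc: "Q' (Suc n) z = ev (total_deriv (total_deriv (total_deriv (mkdv n)))) z
    - 4 * dz S \<eta> z * B n z - 4 * \<eta> z * (\<eta> z * Q' n z)"
  unfolding mkdv_Suc_eq
  by (simp add: total_deriv_diff total_deriv_mult total_deriv_mkdv_prim ev_simps algebra_simps)

lemma two_B: "2 * B n z = (\<Sum>i\<le>n. Q i z * Q (n - i) z) - (\<Sum>i<n. Q' i z * Q' (n - Suc i) z)
    + 4 * (\<Sum>i<n. B i z * B (n - Suc i) z)"
proof -
  have "2 * B n z = ev (2 * mkdv_prim n) z" by (simp only: ev_simps)
  then show ?thesis unfolding two_mkdv_prim by (simp only: ev_simps)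
qed

lemma robin_vline:
  assumes t: "s\<^sub>1 \<le> t" "t \<le> s\<^sub>2" and b: "b \<noteq> 0"
    and q: "\<And>y. q = - b * Re (\<eta> (Complex t y)) * norm (g1 (Complex t y)) - (1 - c) / 2 * (norm (g1 (Complex t y)))\<^sup>2"
    and z: "z \<in> vline t"
  defines "\<alpha> \<equiv> 4 * q / b" and "\<beta> \<equiv> 2 * (1 - c) / b"
  shows "Im (Q' n z) = lam \<alpha> \<beta> z * Im (Q n z)" and "Im (B n z) = Re (\<eta> z) * Im (Q n z)"
proof -
  let ?z = "\<lambda>y. Complex t y"
  note zS = Complex_in_S[OF t]
  \<comment> \<open>Since \<omega>_x = 2 Re \<eta>, this is the boundary equation for 2 \<omega>_x;
    it results from dividing the expression for \<open>q\<close> by b |g'| / 4.\<close>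
  have ode: "4 * Re (\<eta> (?z y)) = - \<alpha> * exp (- \<omega> (?z y)) - \<beta> * exp (\<omega> (?z y))" for y
  proof -
    have n: "norm (g1 (?z y)) \<noteq> 0" using g1_nz[OF zS] by simp
    have e: "exp (\<omega> (?z y)) = norm (g1 (?z y))" "exp (- \<omega> (?z y)) = 1 / norm (g1 (?z y))"
      using norm_g1[OF zS] by (simp_all add: exp_minus divide_inverse)
    have "\<alpha> / norm (g1 (?z y)) = - 4 * Re (\<eta> (?z y)) - \<beta> * norm (g1 (?z y))"
      unfolding \<alpha>_def \<beta>_def q[of y] using n b by (simp add: field_simps power2_eq_square)
    then show ?thesis unfolding e by simp
  qed
  note d\<omega> = omega_vline[OF t]
  \<comment> \<open>With \<omega>_y = - 2 Im \<eta>, differentiating \<open>lam\<close> yields the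
    combination of exponentials that \<open>ode\<close> identifies with - 4 Re \<eta>.\<close>
  have dlam: "((\<lambda>y. lam \<alpha> \<beta> (?z y)) has_real_derivative - 4 * Re (\<eta> (?z y)) * Im (\<eta> (?z y))) (at y)" for y
  proof -
    have "((\<lambda>y. lam \<alpha> \<beta> (?z y)) has_real_derivative
       (\<alpha> * exp (- \<omega> (?z y)) + \<beta> * exp (\<omega> (?z y))) * Im (\<eta> (?z y))) (at y)"
      unfolding lam_def by (rule derivative_eq_intros d\<omega> refl)+ (simp add: algebra_simps)
    moreover have "(\<alpha> * exp (- \<omega> (?z y)) + \<beta> * exp (\<omega> (?z y))) = - 4 * Re (\<eta> (?z y))" using ode[of y] by simp
    ultimately show ?thesis by simp
  qed
  have d\<eta>: "((\<lambda>y. \<eta> (?z y)) has_vector_derivative \<i> * dz S \<eta> (?z y)) (at y)" for y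
    by (rule field_deriv_vline[OF holomorphic_on_dz_band[OF s chol_imp_holomorphic[OF chol_eta] zS] t])
  \<comment> \<open>Differentiating \<open>ode\<close> itself along the line gives the Robin
    condition for \<eta>, the start of the induction.\<close>
  have "((\<lambda>y. 4 * Re (\<eta> (?z y))) has_real_derivative 4 * - Im (dz S \<eta> (?z y))) (at y)" for y
    using DERIV_cmult[OF has_real_derivative_Re[OF d\<eta>], of 4 y] by simp
  moreover have "((\<lambda>y. 4 * Re (\<eta> (?z y))) has_real_derivative - 4 * lam \<alpha> \<beta> (?z y) * Im (\<eta> (?z y))) (at y)" for y
    unfolding ode by (rule derivative_eq_intros d\<omega> refl)+ (simp add: lam_def algebra_simps)
  ultimately have "4 * - Im (dz S \<eta> (?z y)) = - 4 * lam \<alpha> \<beta> (?z y) * Im (\<eta> (?z y))" for y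
    using DERIV_unique by blast
  then have robin\<eta>: "Im (dz S \<eta> (?z y)) = lam \<alpha> \<beta> (?z y) * Im (\<eta> (?z y))" for y by (simp add: algebra_simps)
  have dev: "((\<lambda>y. ev p (?z y)) has_vector_derivative \<i> * ev (total_deriv p) (?z y)) (at y)" for p y
    by (rule field_deriv_vline[OF deriv_ev[OF zS] t])
  interpret robin_line "\<lambda>n y. Q n (?z y)" "\<lambda>n y. Q' n (?z y)" "\<lambda>n y. Q'' n (?z y)"
    "\<lambda>n y. ev (total_deriv (total_deriv (total_deriv (mkdv n)))) (?z y)" "\<lambda>n y. B n (?z y)"
    "\<lambda>y. \<eta> (?z y)" "\<lambda>y. dz S \<eta> (?z y)" "\<lambda>y. lam \<alpha> \<beta> (?z y)"
    by (unfold_locales; (rule dev d\<eta> dlam Q_Suc Q'_Suc two_B robin\<eta> | simp add: ev_simps))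
  have "z = ?z (Im z)" using z by (simp add: vline_def complex_eq_iff)
  then show "Im (Q' n z) = lam \<alpha> \<beta> z * Im (Q n z)" "Im (B n z) = Re (\<eta> z) * Im (Q n z)"
    using robin[of n "Im z"] by metis+
qed

lemma Im_ev_eq: "(\<lambda>z. Im (ev p z)) = (\<lambda>z. Re (- \<i> * ev p z))"
  by simp

lemma conformal_jacobi_field_ev:
  assumes "\<And>z. z \<in> vline s\<^sub>1 \<Longrightarrow> Im (ev (total_deriv p) z) = lam \<alpha>\<^sub>1 \<beta>\<^sub>1 z * Im (ev p z)"
    and "\<And>z. z \<in> vline s\<^sub>2 \<Longrightarrow> Im (ev (total_deriv p) z) = lam \<alpha>\<^sub>2 \<beta>\<^sub>2 z * Im (ev p z)"
  shows "conformal_jacobi_field s\<^sub>1 s\<^sub>2 T g \<alpha>\<^sub>1 \<beta>\<^sub>1 \<alpha>\<^sub>2 \<beta>\<^sub>2 (\<lambda>z. Im (ev p z))"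
proof -
  have vl: "z \<in> S" if "z \<in> vline s\<^sub>1 \<or> z \<in> vline s\<^sub>2" for z using that s by (auto simp: vline_def band_def)
  have "pdx S (\<lambda>z. Im (ev p z)) z = Im (ev (total_deriv p) z)" if "z \<in> S" for z
    unfolding Im_ev_eq pdx_Re_mult[OF s holomorphic_ev that] dz_ev[OF that] by simp
  then have "robin_condition S g s\<^sub>1 \<alpha>\<^sub>1 \<beta>\<^sub>1 (\<lambda>z. Im (ev p z))" "robin_condition S g s\<^sub>2 \<alpha>\<^sub>2 \<beta>\<^sub>2 (\<lambda>z. Im (ev p z))"
    using assms vl by (simp_all add: robin_condition_def lam_def)
  moreover have "Ck_on 2 S (\<lambda>z. Im (ev p z))" "\<forall>z\<in>S. laplacian S (\<lambda>z. Im (ev p z)) z = 0"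
    unfolding Im_ev_eq using Ck_on_Re_mult[OF s chol_ev] laplacian_Re_mult[OF s chol_ev] by blast+
  moreover have "band_periodic s\<^sub>1 s\<^sub>2 T (\<lambda>z. Im (ev p z))"
    using per_ev[of p] by (simp add: band_periodic_def)
  ultimately show ?thesis by (simp only: conformal_jacobi_field_def)
qed

lemma lam_bounded: obtains L where "0 < L" "\<And>z. z \<in> S \<Longrightarrow> \<bar>lam \<alpha> \<beta> z\<bar> \<le> L"
proof -
  define f where "f z = 1 / 2 * (\<alpha> / norm (g1 z) - \<beta> * norm (g1 z))" for z
  have eq: "f z = lam \<alpha> \<beta> z" if "z \<in> S" for z
    unfolding f_def lam_def norm_g1[OF that] exp_minus divide_inverse ..
  have "continuous_on S g1" by (rule holomorphic_on_imp_continuous_on[OF chol_imp_holomorphic[OF chol_g1]])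
  then have n: "continuous_on S (\<lambda>z. norm (g1 z))" by (rule continuous_on_norm)
  have nz: "\<forall>z\<in>S. norm (g1 z) \<noteq> 0" using g1_nz by simp
  have cont: "continuous_on S f"
    unfolding f_def by (intro continuous_on_mult continuous_on_diff continuous_on_divide continuous_on_const n nz)
  have per: "band_periodic s\<^sub>1 s\<^sub>2 T f"
    using per_g1 by (simp add: band_periodic_def f_def)
  obtain L where L: "0 < L" "\<And>z. z \<in> S \<Longrightarrow> \<bar>f z\<bar> \<le> L"
    using band_periodic_bounded[OF s T per cont] by blast
  show ?thesis
  proof (rule that[OF L(1)])
    show "\<bar>lam \<alpha> \<beta> z\<bar> \<le> L" if "z \<in> S" for z using L(2)[OF that] by (simp only: eq[OF that])
  qed
qed

lemma finite_relation:
  assumes "\<And>n z. z \<in> vline s\<^sub>1 \<Longrightarrow> Im (Q' n z) = lam \<alpha>\<^sub>1 \<beta>\<^sub>1 z * Im (Q n z)"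
    and "\<And>n z. z \<in> vline s\<^sub>2 \<Longrightarrow> Im (Q' n z) = lam \<alpha>\<^sub>2 \<beta>\<^sub>2 z * Im (Q n z)"
  shows "\<exists>m. \<exists>c :: nat \<Rightarrow> real. \<forall>z\<in>S. Im (Q m z) = (\<Sum>j<m. c j * Im (Q j z))"
proof -
  obtain L1 where L1: "0 < L1" "\<And>z. z \<in> S \<Longrightarrow> \<bar>lam \<alpha>\<^sub>1 \<beta>\<^sub>1 z\<bar> \<le> L1" using lam_bounded[of \<alpha>\<^sub>1 \<beta>\<^sub>1] by blast
  obtain L2 where L2: "0 < L2" "\<And>z. z \<in> S \<Longrightarrow> \<bar>lam \<alpha>\<^sub>2 \<beta>\<^sub>2 z\<bar> \<le> L2" using lam_bounded[of \<alpha>\<^sub>2 \<beta>\<^sub>2] by blast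
  show ?thesis
  proof (rule robin_finite_dimension[OF s T, of Q Q' "\<lambda>z. if z \<in> vline s\<^sub>1 then lam \<alpha>\<^sub>1 \<beta>\<^sub>1 z else lam \<alpha>\<^sub>2 \<beta>\<^sub>2 z" "max L1 L2"])
    show "continuous_on S (Q' j)" for j by (rule holomorphic_on_imp_continuous_on[OF holomorphic_ev])
    show "0 < max L1 L2" using L1 by simp
    fix z assume z: "z \<in> vline s\<^sub>1 \<union> vline s\<^sub>2"
    then have "z \<in> S" using s by (auto simp: vline_def band_def)
    then show "\<bar>if z \<in> vline s\<^sub>1 then lam \<alpha>\<^sub>1 \<beta>\<^sub>1 z else lam \<alpha>\<^sub>2 \<beta>\<^sub>2 z\<bar> \<le> max L1 L2"
      using L1(2) L2(2) by (simp add: le_max_iff_disj)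
    show "Im (Q' j z) = (if z \<in> vline s\<^sub>1 then lam \<alpha>\<^sub>1 \<beta>\<^sub>1 z else lam \<alpha>\<^sub>2 \<beta>\<^sub>2 z) * Im (Q j z)" for j
      using z assms by auto
  qed (rule deriv_ev per_ev | assumption)+
qed

text \<open>
  A relation passes from \<open>Q\<^bsub>N\<^esub>\<close> to the primitives \<open>B\<close> up to a constant, and the boundary formula for
  \<open>Im B\<close> forces this constant to be real.
\<close>

lemma relation_Suc:
  assumes B: "\<And>n z. z \<in> vline s\<^sub>1 \<Longrightarrow> Im (B n z) = Re (\<eta> z) * Im (Q n z)"
    and rel: "\<And>z. z \<in> S \<Longrightarrow> Im (Q N z) = (\<Sum>j<m. c j * Im (Q j z))"
  obtains \<kappa> :: real where "\<And>z. z \<in> S \<Longrightarrow> Im (Q (Suc N) z) = (\<Sum>j<m. c j * Im (Q (Suc j) z)) - 4 * \<kappa> * Im (Q 0 z)"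
proof -
  \<comment> \<open>\<open>comb\<close> applies the given relation to any family of functions and
    commutes with differentiation. The hypothesis says that \<open>comb Q\<close> is real on the
    band, so its derivatives \<open>comb Q'\<close> and \<open>comb Q''\<close> vanish.\<close>
  define comb where "comb f z = (f N z :: complex) - (\<Sum>j<m. of_real (c j) * f j z)" for f :: "nat \<Rightarrow> complex \<Rightarrow> complex" and z
  have deriv: "(comb (\<lambda>n. ev (p n)) has_field_derivative comb (\<lambda>n. ev (total_deriv (p n))) z) (at z within S)"
    if "z \<in> S" for p :: "nat \<Rightarrow> diffpoly" and z
    unfolding comb_def by (intro DERIV_diff DERIV_sum DERIV_cmult deriv_ev that)
  have Q': "comb Q' z = 0" if z: "z \<in> S" for z
    by (rule field_derivative_zero_if_Im_zero[OF s z deriv[OF z]]) (simp add: comb_def rel)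
  have Q'': "comb Q'' z = 0" if z: "z \<in> S" for z
    by (rule field_derivative_zero_if_Im_zero[OF s z deriv[OF z]]) (simp add: Q')
  have "(comb B has_field_derivative 0) (at z within S)" if z: "z \<in> S" for z
  proof -
    have "comb (\<lambda>n. ev (total_deriv (mkdv_prim n))) z = \<eta> z * comb Q' z"
      unfolding total_deriv_mkdv_prim by (simp add: comb_def ev_simps right_diff_distrib sum_distrib_left mult.left_commute)
    then show ?thesis using deriv[OF z, of mkdv_prim] Q'[OF z] by simp
  qed
  from has_field_derivative_zero_constant[OF convex_band this]
  obtain k where k: "\<And>z. z \<in> S \<Longrightarrow> comb B z = k" by blast
  have v: "of_real s\<^sub>1 \<in> vline s\<^sub>1" "of_real s\<^sub>1 \<in> S" using s by (simp_all add: vline_def band_def)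
  \<comment> \<open>The reality of \<open>k\<close> is essential: only then is the imaginary part of
    k times \<open>Q 0\<close> a real multiple of \<open>Im (Q 0 z)\<close>.\<close>
  have "Im (comb B (of_real s\<^sub>1)) = Re (\<eta> (of_real s\<^sub>1)) * Im (comb Q (of_real s\<^sub>1))"
    by (simp add: comb_def B[OF v(1)] right_diff_distrib sum_distrib_left mult.left_commute)
  also have "Im (comb Q (of_real s\<^sub>1)) = 0" by (simp add: comb_def rel[OF v(2)])
  finally have Im_k: "Im k = 0" using k[OF v(2)] by simp
  show ?thesis
  proof (rule that[of "Re k"])
    fix z assume z: "z \<in> S"
    have "comb (\<lambda>n. Q (Suc n)) z = comb Q'' z - 4 * \<eta> z * comb B z"
      unfolding comb_def Q_Suc
      by (simp add: right_diff_distrib sum_subtractf sum_distrib_left mult.left_commute)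
    then have "comb (\<lambda>n. Q (Suc n)) z = - 4 * k * Q 0 z" by (simp add: Q''[OF z] k[OF z] ev_simps)
    then have "Im (comb (\<lambda>n. Q (Suc n)) z) = - 4 * Re k * Im (Q 0 z)" by (simp add: Im_k)
    then show "Im (Q (Suc N) z) = (\<Sum>j<m. c j * Im (Q (Suc j) z)) - 4 * Re k * Im (Q 0 z)"
      by (simp add: comb_def)
  qed
qed

text \<open>One step of \<open>relation_Suc\<close> expresses the next function through
  \<open>Q 0\<close> and the \<open>Q (Suc j)\<close> with \<open>j < m\<close>. All these indices
  are at most \<open>m\<close>, and \<open>Q m\<close> is eliminated by the original
  relation.\<close>

lemma relation_propagates:
  assumes B: "\<And>n z. z \<in> vline s\<^sub>1 \<Longrightarrow> Im (B n z) = Re (\<eta> z) * Im (Q n z)"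
    and rel: "\<exists>c :: nat \<Rightarrow> real. \<forall>z\<in>S. Im (Q m z) = (\<Sum>j<m. c j * Im (Q j z))"
  shows "\<exists>c :: nat \<Rightarrow> real. \<forall>z\<in>S. Im (Q (m + k) z) = (\<Sum>j<m. c j * Im (Q j z))"
proof (induction k)
  case 0
  then show ?case using rel by simp
next
  case (Suc k)
  then obtain c where c: "\<And>z. z \<in> S \<Longrightarrow> Im (Q (m + k) z) = (\<Sum>j<m. c j * Im (Q j z))" by blast
  \<comment> \<open>Including \<open>i = m\<close> also covers \<open>m = 0\<close>, where the
    correction term in \<open>Q 0\<close> is removed by the relation itself.\<close>
  have "\<exists>c :: nat \<Rightarrow> real. \<forall>z\<in>S. Im (Q i z) = (\<Sum>j<m. c j * Im (Q j z))" if "i \<le> m" for i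
  proof (cases "i = m")
    case False
    with that have "i < m" by simp
    then have eq: "Im (Q i z) = (\<Sum>j<m. (if j = i then 1 else 0) * Im (Q j z))" for z
      by (simp add: if_distrib[of "\<lambda>x. x * _"] cong: if_cong)
    show ?thesis by (intro exI[of _ "\<lambda>j. if j = i then 1 else 0"] ballI eq)
  qed (use rel in simp)
  then obtain C where C: "\<And>i z. i \<le> m \<Longrightarrow> z \<in> S \<Longrightarrow> Im (Q i z) = (\<Sum>j<m. C i j * Im (Q j z))" by metis
  obtain \<kappa> :: real where \<kappa>: "\<And>z. z \<in> S \<Longrightarrow>
      Im (Q (Suc (m + k)) z) = (\<Sum>i<m. c i * Im (Q (Suc i) z)) - 4 * \<kappa> * Im (Q 0 z)"
    using relation_Suc[OF B c] by blast
  have eq: "Im (Q (m + Suc k) z) = (\<Sum>j<m. ((\<Sum>i<m. c i * C (Suc i) j) - 4 * \<kappa> * C 0 j) * Im (Q j z))" if z: "z \<in> S" for z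
  proof -
    have "(\<Sum>i<m. c i * Im (Q (Suc i) z)) = (\<Sum>i<m. \<Sum>j<m. c i * C (Suc i) j * Im (Q j z))"
      by (intro sum.cong refl) (simp add: C[OF _ z] sum_distrib_left mult.assoc)
    also have "\<dots> = (\<Sum>j<m. (\<Sum>i<m. c i * C (Suc i) j) * Im (Q j z))"
      by (subst sum.swap) (simp add: sum_distrib_right)
    finally show ?thesis
      using \<kappa>[OF z] C[of 0, OF _ z] by (simp add: left_diff_distrib sum_subtractf sum_distrib_left mult.assoc)
  qed
  show ?case
    by (intro exI[of _ "\<lambda>j. (\<Sum>i<m. c i * C (Suc i) j) - 4 * \<kappa> * C 0 j"] ballI eq)
qed

end

theorem theorem10p8:
  fixes \<Omega> \<gamma>\<^sub>1 \<gamma>\<^sub>2 :: "complex set" and u :: "complex \<Rightarrow> real" and g :: "complex \<Rightarrow> complex"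
    and s\<^sub>1 s\<^sub>2 T :: real
    and a\<^sub>1 b\<^sub>1 c\<^sub>1 d\<^sub>1\<^sub>1 d\<^sub>2\<^sub>1 a\<^sub>2 b\<^sub>2 c\<^sub>2 d\<^sub>1\<^sub>2 d\<^sub>2\<^sub>2 :: real
    and q \<alpha>\<^sub>1 \<beta>\<^sub>1 \<alpha>\<^sub>2 \<beta>\<^sub>2 :: real and h :: "nat \<Rightarrow> complex \<Rightarrow> real"
  assumes "capillary_ring_domain \<Omega> \<gamma>\<^sub>1 \<gamma>\<^sub>2"
    and "capillary_solution \<Omega> \<gamma>\<^sub>1 \<gamma>\<^sub>2 u"
    and "developing_map \<Omega> \<gamma>\<^sub>1 \<gamma>\<^sub>2 s\<^sub>1 s\<^sub>2 T g"
    and "capillarity_constants (band s\<^sub>1 s\<^sub>2) u g s\<^sub>1 a\<^sub>1 b\<^sub>1 c\<^sub>1 d\<^sub>1\<^sub>1 d\<^sub>2\<^sub>1"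
    and "capillarity_constants (band s\<^sub>1 s\<^sub>2) u g s\<^sub>2 a\<^sub>2 b\<^sub>2 c\<^sub>2 d\<^sub>1\<^sub>2 d\<^sub>2\<^sub>2"
    and "b\<^sub>1 \<noteq> 0" and "b\<^sub>2 \<noteq> 0"
  defines "q \<equiv> hopf_constant s\<^sub>1 s\<^sub>2 u g"
    and "\<alpha>\<^sub>1 \<equiv> 4 * q / b\<^sub>1" and "\<beta>\<^sub>1 \<equiv> 2 * (1 - c\<^sub>1) / b\<^sub>1"
    and "\<alpha>\<^sub>2 \<equiv> 4 * q / b\<^sub>2" and "\<beta>\<^sub>2 \<equiv> 2 * (1 - c\<^sub>2) / b\<^sub>2"
    and "h \<equiv> (\<lambda>n z. Im (mkdv_op (band s\<^sub>1 s\<^sub>2) n (log_factor_z (band s\<^sub>1 s\<^sub>2) g) z))"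
  shows "(\<forall>n. conformal_jacobi_field s\<^sub>1 s\<^sub>2 T g \<alpha>\<^sub>1 \<beta>\<^sub>1 \<alpha>\<^sub>2 \<beta>\<^sub>2 (h n)) \<and>
    (\<exists>m::nat. \<exists>c::nat \<Rightarrow> real. \<forall>z\<in>band s\<^sub>1 s\<^sub>2. h m z = (\<Sum>j<m. c j * h j z)) \<and>
    (\<forall>m::nat. (\<exists>c::nat \<Rightarrow> real. \<forall>z\<in>band s\<^sub>1 s\<^sub>2. h m z = (\<Sum>j<m. c j * h j z)) \<longrightarrow>
       (\<forall>k::nat. \<exists>c::nat \<Rightarrow> real. \<forall>z\<in>band s\<^sub>1 s\<^sub>2. h (m + k) z = (\<Sum>j<m. c j * h j z)))"
proof -
  interpret capillary_map \<Omega> \<gamma>\<^sub>1 \<gamma>\<^sub>2 s\<^sub>1 s\<^sub>2 T g u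
    using assms(1-3) by unfold_locales (simp_all add: capillary_ring_domain_def)
  note q = hopf_constant_vline[OF assms(4,5), folded q_def]
  have le: "s\<^sub>1 \<le> s\<^sub>2" using s by simp
  note r1 = robin_vline[OF order_refl le assms(6) q(1), folded \<alpha>\<^sub>1_def \<beta>\<^sub>1_def]
    and r2 = robin_vline[OF le order_refl assms(7) q(2), folded \<alpha>\<^sub>2_def \<beta>\<^sub>2_def]
  have h: "h = (\<lambda>n z. Im (Q n z))" by (simp add: h_def mkdv_op_def ev_def)
  show ?thesis
    unfolding h using conformal_jacobi_field_ev[OF r1(1) r2(1)] finite_relation[OF r1(1) r2(1)] relation_propagates[OF r1(2)]
    by blast
qed

end
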